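(* Over $\mathsf{RCA}_0$, the following are equivalent: (1) $\mathsf{ACA}_0$; (2) every countable commutative ring with the $\Delta^0_1$-a.c.c. is $\Sigma^0_1$-Noetherian; (3) every countable commutative ring with the $\Delta^0_1$-a.c.c. is $\Delta^0_1$-Noetherian; (4) every sequentially Noetherian countable commutative ring is $\Sigma^0_1$-Noetherian; (5) every sequentially Noetherian countable commutative ring is $\Delta^0_1$-Noetherian.
   Context: $\mathsf{RCA}_0$: basic arithmetic, $\Sigma^0_1$-induction, $\Delta^0_1$-comprehension. $\mathsf{ACA}_0$: basic arithmetic with comprehension (and induction) for all arithmetical formulas. Rings are commutative with unity. A $\Delta^0_1$-ideal is an ideal existing as a set; a $\Sigma^0_1$-ideal is a sequence $\langle a_0,a_1,\ldots\rangle$ of ring elements such that for all $i,j,r,s$ there is $k$ with $a_k=a_ir+a_js$ (membership: $r\in\mathcal{I}$ iff $\exists m\,r=a_m$). $(a_0,\ldots,a_{n-1})=\{\sum a_ir_i:r_i\in R\}$. $R$ is $\Delta^0_1$-Noetherian if every $\Delta^0_1$-ideal is finitely generated. $R$ has the $\Delta^0_1$-a.c.c. if there is no sequence of ideals $I_0\subsetneq I_1\subsetneq\cdots$ (equivalently, every chain of ideals $I_0\subseteq I_1\subseteq\cdots$ stabilises). $R$ is sequentially Noetherian if there is no sequence $a_0,a_1,\ldots$ with $a_i\notin(a_0,\ldots,a_{i-1})$ for all $i$. $R$ is $\Sigma^0_1$-Noetherian if every $\Sigma^0_1$-ideal equals $(a_0,\dots,a_{n-1})$ for some finite list (equivalently: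 for every sequence $a_0,a_1,\ldots$ there is $i$ with every $a_j\in(a_0,\ldots,a_{i-1})$). *)

theory Defs
  imports "HOL-Algebra.Ideal"
begin

section \<open>Structures for the language of second-order arithmetic\<close>

text \<open>
  A (Henkin) structure for two-sorted second-order arithmetic.  The numbers are all elements of the
  type \<open>'m\<close>, so they may be nonstandard; set quantifiers range over \<open>l2_sets\<close> only, so these are
  not just the full models or the \<open>\<omega>\<close>-models.  "Over \<open>RCA\<^sub>0\<close>" is read as: in every such structure
  that satisfies \<open>RCA\<^sub>0\<close>.
\<close>

record 'm l2_structure =
  l2_zero :: 'm
  l2_one :: 'm
  l2_plus :: "'m \<Rightarrow> 'm \<Rightarrow> 'm"
  l2_times :: "'m \<Rightarrow> 'm \<Rightarrow> 'm"
  l2_less :: "'m \<Rightarrow> 'm \<Rightarrow> bool"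
  l2_sets :: "'m set set"

definition l2_suc :: "'m l2_structure \<Rightarrow> 'm \<Rightarrow> 'm" where
  "l2_suc M n = l2_plus M n (l2_one M)"

datatype num_term =
    Var nat
  | Zero
  | One
  | Plus num_term num_term
  | Times num_term num_term

text \<open>
  The arithmetical formulas: number quantifiers only, with set variables as parameters.  Number
  variables are de Bruijn indices.  In the bounded quantifiers \<open>BAll t p\<close> and \<open>BEx t p\<close> the bound \<open>t\<close>
  lies outside the scope of the quantifier, so it cannot mention the quantified variable.
\<close>

datatype arith_fm =
    Eq num_term num_term
  | Less num_term num_term
  | Mem num_term nat
  | Neg arith_fm
  | Conj arith_fm arith_fm
  | BAll num_term arith_fm
  | BEx num_term arith_fm
  | All arith_fm
  | Ex arith_fm

primrec num_val :: "'m l2_structure \<Rightarrow> (nat \<Rightarrow> 'm) \<Rightarrow> num_term \<Rightarrow> 'm" where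
  "num_val M e (Var i) = e i"
| "num_val M e Zero = l2_zero M"
| "num_val M e One = l2_one M"
| "num_val M e (Plus s t) = l2_plus M (num_val M e s) (num_val M e t)"
| "num_val M e (Times s t) = l2_times M (num_val M e s) (num_val M e t)"

primrec arith_sat ::
  "'m l2_structure \<Rightarrow> (nat \<Rightarrow> 'm set) \<Rightarrow> (nat \<Rightarrow> 'm) \<Rightarrow> arith_fm \<Rightarrow> bool" where
  "arith_sat M v e (Eq s t) \<longleftrightarrow> num_val M e s = num_val M e t"
| "arith_sat M v e (Less s t) \<longleftrightarrow> l2_less M (num_val M e s) (num_val M e t)"
| "arith_sat M v e (Mem t i) \<longleftrightarrow> num_val M e t \<in> v i"
| "arith_sat M v e (Neg p) \<longleftrightarrow> \<not> arith_sat M v e p"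
| "arith_sat M v e (Conj p q) \<longleftrightarrow> arith_sat M v e p \<and> arith_sat M v e q"
| "arith_sat M v e (BAll t p) \<longleftrightarrow>
     (\<forall>n. l2_less M n (num_val M e t) \<longrightarrow> arith_sat M v (case_nat n e) p)"
| "arith_sat M v e (BEx t p) \<longleftrightarrow>
     (\<exists>n. l2_less M n (num_val M e t) \<and> arith_sat M v (case_nat n e) p)"
| "arith_sat M v e (All p) \<longleftrightarrow> (\<forall>n. arith_sat M v (case_nat n e) p)"
| "arith_sat M v e (Ex p) \<longleftrightarrow> (\<exists>n. arith_sat M v (case_nat n e) p)"

primrec bounded_fm :: "arith_fm \<Rightarrow> bool" where
  "bounded_fm (Eq s t) \<longleftrightarrow> True"
| "bounded_fm (Less s t) \<longleftrightarrow> True"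
| "bounded_fm (Mem t i) \<longleftrightarrow> True"
| "bounded_fm (Neg p) \<longleftrightarrow> bounded_fm p"
| "bounded_fm (Conj p q) \<longleftrightarrow> bounded_fm p \<and> bounded_fm q"
| "bounded_fm (BAll t p) \<longleftrightarrow> bounded_fm p"
| "bounded_fm (BEx t p) \<longleftrightarrow> bounded_fm p"
| "bounded_fm (All p) \<longleftrightarrow> False"
| "bounded_fm (Ex p) \<longleftrightarrow> False"

definition Sigma01_fm :: "arith_fm \<Rightarrow> bool" where
  "Sigma01_fm p \<longleftrightarrow> (\<exists>q. bounded_fm q \<and> p = Ex q)"

definition Pi01_fm :: "arith_fm \<Rightarrow> bool" where
  "Pi01_fm p \<longleftrightarrow> (\<exists>q. bounded_fm q \<and> p = All q)"


section \<open>The axiom systems\<close>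

definition basic_arithmetic :: "'m l2_structure \<Rightarrow> bool" where
  "basic_arithmetic M \<longleftrightarrow>
     (\<forall>n. l2_suc M n \<noteq> l2_zero M) \<and>
     (\<forall>m n. l2_suc M m = l2_suc M n \<longrightarrow> m = n) \<and>
     (\<forall>m. l2_plus M m (l2_zero M) = m) \<and>
     (\<forall>m n. l2_plus M m (l2_suc M n) = l2_suc M (l2_plus M m n)) \<and>
     (\<forall>m. l2_times M m (l2_zero M) = l2_zero M) \<and>
     (\<forall>m n. l2_times M m (l2_suc M n) = l2_plus M (l2_times M m n) m) \<and>
     (\<forall>m. \<not> l2_less M m (l2_zero M)) \<and>
     (\<forall>m n. l2_less M m (l2_suc M n) \<longleftrightarrow> l2_less M m n \<or> m = n)"

text \<open>
  In the schemes below, variable \<open>0\<close> is the induction or comprehension variable; \<open>e\<close> and \<open>v\<close> supply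
  the number and set parameters.
\<close>

definition induction_for :: "(arith_fm \<Rightarrow> bool) \<Rightarrow> 'm l2_structure \<Rightarrow> bool" where
  "induction_for \<Gamma> M \<longleftrightarrow>
     (\<forall>p v e. \<Gamma> p \<longrightarrow> range v \<subseteq> l2_sets M \<longrightarrow>
        arith_sat M v (case_nat (l2_zero M) e) p \<longrightarrow>
        (\<forall>n. arith_sat M v (case_nat n e) p \<longrightarrow> arith_sat M v (case_nat (l2_suc M n) e) p) \<longrightarrow>
        (\<forall>n. arith_sat M v (case_nat n e) p))"

definition Delta01_comprehension :: "'m l2_structure \<Rightarrow> bool" where
  "Delta01_comprehension M \<longleftrightarrow>
     (\<forall>p q v e. Sigma01_fm p \<longrightarrow> Pi01_fm q \<longrightarrow> range v \<subseteq> l2_sets M \<longrightarrow>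
        (\<forall>n. arith_sat M v (case_nat n e) p \<longleftrightarrow> arith_sat M v (case_nat n e) q) \<longrightarrow>
        {n. arith_sat M v (case_nat n e) p} \<in> l2_sets M)"

definition arithmetical_comprehension :: "'m l2_structure \<Rightarrow> bool" where
  "arithmetical_comprehension M \<longleftrightarrow>
     (\<forall>p v e. range v \<subseteq> l2_sets M \<longrightarrow> {n. arith_sat M v (case_nat n e) p} \<in> l2_sets M)"

text \<open>
  The set sort has to be required nonempty: assignments \<open>v\<close> to the set variables are total, so the
  schemes would hold vacuously if there were no sets.
\<close>

definition RCA0 :: "'m l2_structure \<Rightarrow> bool" where
  "RCA0 M \<longleftrightarrow> l2_sets M \<noteq> {} \<and> basic_arithmetic M \<and>
     induction_for Sigma01_fm M \<and> Delta01_comprehension M"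

definition ACA0 :: "'m l2_structure \<Rightarrow> bool" where
  "ACA0 M \<longleftrightarrow> l2_sets M \<noteq> {} \<and> basic_arithmetic M \<and>
     induction_for (\<lambda>p. True) M \<and> arithmetical_comprehension M"


section \<open>Sequences inside a structure\<close>

definition l2_pair :: "'m l2_structure \<Rightarrow> 'm \<Rightarrow> 'm \<Rightarrow> 'm" where
  "l2_pair M m n = l2_plus M (l2_times M (l2_plus M m n) (l2_plus M m n)) m"

text \<open>
  Functions and sequences of sets of the structure are represented by HOL functions whose graph,
  coded by pairs, is a set of the structure.
\<close>

definition l2_sequence :: "'m l2_structure \<Rightarrow> 'm set \<Rightarrow> ('m \<Rightarrow> 'm) \<Rightarrow> bool" where
  "l2_sequence M A f \<longleftrightarrow> range f \<subseteq> A \<and> {l2_pair M i (f i) | i. True} \<in> l2_sets M"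

text \<open>
  Finite sequences have a length \<open>n\<close> in the structure, possibly nonstandard; only the values of \<open>f\<close>
  below \<open>n\<close> matter.  (Within \<open>RCA\<^sub>0\<close>, a bounded set of pairs is the same thing as a number coding it.)
\<close>

definition l2_finite_sequence :: "'m l2_structure \<Rightarrow> 'm set \<Rightarrow> 'm \<Rightarrow> ('m \<Rightarrow> 'm) \<Rightarrow> bool" where
  "l2_finite_sequence M A n f \<longleftrightarrow>
     (\<forall>i. l2_less M i n \<longrightarrow> f i \<in> A) \<and> {l2_pair M i (f i) | i. l2_less M i n} \<in> l2_sets M"

definition l2_set_sequence :: "'m l2_structure \<Rightarrow> ('m \<Rightarrow> 'm set) \<Rightarrow> bool" where
  "l2_set_sequence M J \<longleftrightarrow> {l2_pair M i x | i x. x \<in> J i} \<in> l2_sets M"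


section \<open>Countable commutative rings inside a structure\<close>

text \<open>
  The axioms of \<open>cring\<close> and of \<open>ideal\<close> only quantify over elements of the carrier, so they mean the
  same thing inside the structure as outside.  This is not so for generated ideals, whose elements
  are sums of possibly nonstandard length.
\<close>

definition l2_cring :: "'m l2_structure \<Rightarrow> 'm ring \<Rightarrow> bool" where
  "l2_cring M R \<longleftrightarrow> cring R \<and> carrier R \<in> l2_sets M \<and>
     {l2_pair M (l2_pair M a b) (a \<oplus>\<^bsub>R\<^esub> b) | a b. a \<in> carrier R \<and> b \<in> carrier R} \<in> l2_sets M \<and>
     {l2_pair M (l2_pair M a b) (a \<otimes>\<^bsub>R\<^esub> b) | a b. a \<in> carrier R \<and> b \<in> carrier R} \<in> l2_sets M"

text \<open>
  The set \<open>(a\<^sub>0, \<dots>, a\<^sub>n\<^sub>-\<^sub>1)\<close> of all sums of \<open>a\<^sub>i r\<^sub>i\<close> over \<open>i < n\<close>; \<open>s\<close> is the sequence of partial sums.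
\<close>

definition l2_span :: "'m l2_structure \<Rightarrow> 'm ring \<Rightarrow> 'm \<Rightarrow> ('m \<Rightarrow> 'm) \<Rightarrow> 'm set" where
  "l2_span M R n a =
     {x. \<exists>r s. l2_finite_sequence M (carrier R) n r \<and>
               l2_finite_sequence M (carrier R) (l2_suc M n) s \<and>
               s (l2_zero M) = \<zero>\<^bsub>R\<^esub> \<and>
               (\<forall>i. l2_less M i n \<longrightarrow> s (l2_suc M i) = s i \<oplus>\<^bsub>R\<^esub> a i \<otimes>\<^bsub>R\<^esub> r i) \<and>
               x = s n}"

definition l2_finitely_generated :: "'m l2_structure \<Rightarrow> 'm ring \<Rightarrow> 'm set \<Rightarrow> bool" where
  "l2_finitely_generated M R I \<longleftrightarrow>
     (\<exists>n a. l2_finite_sequence M (carrier R) n a \<and> I = l2_span M R n a)"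

definition Delta01_ideal :: "'m l2_structure \<Rightarrow> 'm ring \<Rightarrow> 'm set \<Rightarrow> bool" where
  "Delta01_ideal M R I \<longleftrightarrow> I \<in> l2_sets M \<and> ideal I R"

text \<open>The set of members of the \<open>\<Sigma>\<^sup>0\<^sub>1\<close>-ideal \<open>a\<close> is \<open>range a\<close>, which need not belong to the structure.\<close>

definition Sigma01_ideal :: "'m l2_structure \<Rightarrow> 'm ring \<Rightarrow> ('m \<Rightarrow> 'm) \<Rightarrow> bool" where
  "Sigma01_ideal M R a \<longleftrightarrow> l2_sequence M (carrier R) a \<and>
     (\<forall>i j. \<forall>r \<in> carrier R. \<forall>s \<in> carrier R. \<exists>k. a k = a i \<otimes>\<^bsub>R\<^esub> r \<oplus>\<^bsub>R\<^esub> a j \<otimes>\<^bsub>R\<^esub> s)"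

definition Delta01_Noetherian :: "'m l2_structure \<Rightarrow> 'm ring \<Rightarrow> bool" where
  "Delta01_Noetherian M R \<longleftrightarrow> (\<forall>I. Delta01_ideal M R I \<longrightarrow> l2_finitely_generated M R I)"

definition Sigma01_Noetherian :: "'m l2_structure \<Rightarrow> 'm ring \<Rightarrow> bool" where
  "Sigma01_Noetherian M R \<longleftrightarrow>
     (\<forall>a. Sigma01_ideal M R a \<longrightarrow> l2_finitely_generated M R (range a))"

definition Delta01_acc :: "'m l2_structure \<Rightarrow> 'm ring \<Rightarrow> bool" where
  "Delta01_acc M R \<longleftrightarrow>
     \<not> (\<exists>J. l2_set_sequence M J \<and> (\<forall>i. Delta01_ideal M R (J i)) \<and>
            (\<forall>i. J i \<subset> J (l2_suc M i)))"

definition sequentially_Noetherian :: "'m l2_structure \<Rightarrow> 'm ring \<Rightarrow> bool" where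
  "sequentially_Noetherian M R \<longleftrightarrow>
     \<not> (\<exists>a. l2_sequence M (carrier R) a \<and> (\<forall>i. a i \<notin> l2_span M R i a))"

end

theory Submission
  imports Defs
begin

text \<open>
  If \<open>ACA\<^sub>0\<close> holds, the ideals \<open>(a\<^sub>0, \<dots>, a\<^sub>i\<^sub>-\<^sub>1)\<close> spanned by initial segments of a sequence exist as
  sets, uniformly in \<open>i\<close>, so a \<open>\<Sigma>\<^sup>0\<^sub>1\<close>-ideal that is not finitely generated yields a strictly
  increasing chain of ideals.

  Conversely, suppose that some \<open>\<Sigma>\<^sup>0\<^sub>1\<close> set does not exist.  We may take it to be a set of primes, listed
  without repetitions by stages \<open>s\<close>.  Invert in the integers the primes that are listed at a stage \<open>s\<close>
  after which a smaller prime is still listed; in the resulting ring \<open>D\<close>, the listed primes that remain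
  non-units are those listed at settled stages, after which only larger primes appear.  Let \<open>A\<close> be
  the \<open>D\<close>-submodule of the rationals generated by the inverses of all listed primes, and \<open>R = D + A \<epsilon>\<close>
  with \<open>\<epsilon>\<^sup>2 = 0\<close>.  The ideal \<open>A \<epsilon>\<close> is decidable and not finitely generated, because there are
  settled stages beyond every bound.  But a sequence in \<open>R\<close> with \<open>a\<^sub>i \<notin> (a\<^sub>0, \<dots>, a\<^sub>i\<^sub>-\<^sub>1)\<close> would compute the
  listed set: if \<open>L\<close> is a common multiple of the numbers below \<open>b\<close>, a computable number of terms
  cannot all have their \<open>\<epsilon>\<close>-parts in \<open>(1/L) D\<close>, since then the least positive integers in the ideals
  they span would descend for too long; hence the denominators of these terms exhibit a settled
  stage listing a prime \<open>\<ge> b\<close>, and every listed prime below \<open>b\<close> is already listed by then.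
\<close>

section \<open>Definability in a structure\<close>

text \<open>A single ring suffices: sequentially Noetherian rings have the a.c.c., and
  Sigma01-Noetherian rings are Delta01-Noetherian, so a ring that is sequentially but not
  Delta01-Noetherian refutes (2) to (5) together.

  If no prime were inverted, the elements \<open>(1/p) \<epsilon>\<close> in the order of listing
  would themselves form a bad sequence in the structure. Once the unsettled primes are units, only
  settled stages contribute generators beyond \<open>D \<epsilon>\<close>. These are the true stages
  of the enumeration (Dekker), and finding them beyond every bound amounts to knowing the listed
  set.

  Invertibility is only Sigma01, so \<open>D\<close> and \<open>A\<close> need not be decidable sets
  of fractions; a ring element is therefore coded together with a stage that witnesses its
  denominators. Passing to dual numbers makes \<open>A\<close> an ideal, which is decidable because
  equality of fractions is.

  Inside the structure only Sigma01 induction is at hand and sums may have nonstandard length, so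
  each induction there is on a statement first shown to be Sigma01.\<close>

primrec tm_rename :: "(nat \<Rightarrow> nat) \<Rightarrow> num_term \<Rightarrow> num_term" where
  "tm_rename r (Var i) = Var (r i)"
| "tm_rename r Zero = Zero"
| "tm_rename r One = One"
| "tm_rename r (Plus s t) = Plus (tm_rename r s) (tm_rename r t)"
| "tm_rename r (Times s t) = Times (tm_rename r s) (tm_rename r t)"

primrec fm_rename :: "(nat \<Rightarrow> nat) \<Rightarrow> (nat \<Rightarrow> nat) \<Rightarrow> arith_fm \<Rightarrow> arith_fm" where
  "fm_rename r k (Eq s t) = Eq (tm_rename r s) (tm_rename r t)"
| "fm_rename r k (Less s t) = Less (tm_rename r s) (tm_rename r t)"
| "fm_rename r k (Mem t i) = Mem (tm_rename r t) (k i)"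
| "fm_rename r k (Neg p) = Neg (fm_rename r k p)"
| "fm_rename r k (Conj p q) = Conj (fm_rename r k p) (fm_rename r k q)"
| "fm_rename r k (BAll t p) = BAll (tm_rename r t) (fm_rename (case_nat 0 (Suc \<circ> r)) k p)"
| "fm_rename r k (BEx t p) = BEx (tm_rename r t) (fm_rename (case_nat 0 (Suc \<circ> r)) k p)"
| "fm_rename r k (All p) = All (fm_rename (case_nat 0 (Suc \<circ> r)) k p)"
| "fm_rename r k (Ex p) = Ex (fm_rename (case_nat 0 (Suc \<circ> r)) k p)"

lemma num_val_rename [simp]: "num_val M e (tm_rename r t) = num_val M (e \<circ> r) t"
  by (induction t) auto

lemma case_nat_comp: "case_nat n e \<circ> case_nat 0 (Suc \<circ> r) = case_nat n (e \<circ> r)"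
  by (auto simp: fun_eq_iff split: nat.splits)

lemma arith_sat_rename [simp]:
  "arith_sat M v e (fm_rename r k p) \<longleftrightarrow> arith_sat M (v \<circ> k) (e \<circ> r) p"
  by (induction p arbitrary: e r) (auto simp: case_nat_comp)

lemma bounded_fm_rename [simp]: "bounded_fm (fm_rename r k p) \<longleftrightarrow> bounded_fm p"
  by (induction p arbitrary: r) auto

text \<open>In \<open>mix e c\<close> the variables \<open>e\<close> sit at the even indices and the parameters \<open>c\<close> at the odd ones.\<close>

definition mix :: "(nat \<Rightarrow> 'a) \<Rightarrow> (nat \<Rightarrow> 'a) \<Rightarrow> nat \<Rightarrow> 'a" where
  "mix e c i = (if even i then e (i div 2) else c (i div 2))"

lemma mix_simps [simp]:
  "mix e c (2 * i) = e i" "mix e c (Suc (2 * i)) = c i" "mix e c 0 = e 0" "mix e c (Suc 0) = c 0"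
  by (auto simp: mix_def)

lemma mix_range: "range v \<subseteq> S \<Longrightarrow> range w \<subseteq> S \<Longrightarrow> range (mix v w) \<subseteq> S"
  by (auto simp: mix_def)

lemma mix_cases:
  fixes i :: nat
  obtains j where "i = 2 * j" | j where "i = Suc (2 * j)"
  by (metis evenE oddE Suc_eq_plus1)

lemma mix_comp_double: "mix v w \<circ> (\<lambda>i. 2 * i) = v" "mix v w \<circ> (\<lambda>i. Suc (2 * i)) = w"
  by auto

abbreviation (input) left_index :: "nat \<Rightarrow> nat" where
  "left_index \<equiv> \<lambda>i. if even i then i else Suc (2 * (2 * (i div 2)))"

abbreviation (input) right_index :: "nat \<Rightarrow> nat" where
  "right_index \<equiv> \<lambda>i. if even i then i else Suc (2 * (Suc (2 * (i div 2))))"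

text \<open>A binder puts its variable in front of the interleaved list, whereas
  \<open>mix (case_nat x e) c\<close> expects it at the head of the even half; hence positive even
  indices move down and odd ones up by one.\<close>

abbreviation (input) binder_index :: "nat \<Rightarrow> nat" where
  "binder_index \<equiv> \<lambda>i. if i = 0 then 0 else if even i then i - 1 else Suc i"

text \<open>Even positions from 4 on carry the dummy value \<open>c 0\<close>, which sits at index 2
  of \<open>case_nat y (case_nat x c)\<close>.\<close>

abbreviation (input) two_vars_index :: "nat \<Rightarrow> nat" where
  "two_vars_index \<equiv> \<lambda>i. if i = 0 then 0 else if i = 2 then 1 else if even i then 2 else Suc (Suc (i div 2))"

lemma mix_comp_left: "mix e (mix c d) \<circ> left_index = mix e c"
proof
  show "(mix e (mix c d) \<circ> left_index) i = mix e c i" for i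
    by (cases rule: mix_cases[of i]) (auto simp: mix_def)
qed

lemma mix_comp_right:
  "mix e (mix c d) \<circ> right_index = mix e d"
proof
  show "(mix e (mix c d) \<circ> right_index) i = mix e d i" for i
    by (cases rule: mix_cases[of i]) (auto simp: mix_def)
qed

lemma mix_case_nat: "case_nat x (mix e c) \<circ> binder_index =
  mix (case_nat x e) c"
proof
  show "(case_nat x (mix e c) \<circ> binder_index) i =
    mix (case_nat x e) c i" for i
  proof (cases rule: mix_cases[of i])
    case (1 j)
    then show ?thesis by (cases j) (auto simp: mix_def)
  next
    case (2 j)
    then show ?thesis by auto
  qed
qed

lemma mix_comp_vars: "mix (e \<circ> r) c = mix e c \<circ> (\<lambda>i. if even i then 2 * r (i div 2) else i)"
  by (auto simp: mix_def fun_eq_iff)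

lemma mix_two_vars:
  "mix (case_nat y (case_nat x (\<lambda>_. c 0))) c =
   case_nat y (case_nat x c) \<circ> two_vars_index"
proof
  show "mix (case_nat y (case_nat x (\<lambda>_. c 0))) c i = (case_nat y (case_nat x c) \<circ>
    two_vars_index) i" for i
  proof (cases rule: mix_cases[of i])
    case (1 j)
    consider "j = 0" | "j = 1" | k where "j = Suc (Suc k)" by (metis One_nat_def old.nat.exhaust)
    then show ?thesis by cases (auto simp: mix_def 1)
  next
    case (2 j)
    then show ?thesis by auto
  qed
qed

section \<open>Predicates on assignments that are definable by terms and bounded formulas with
  parameters\<close>

locale rca_structure =
  fixes M :: "'m l2_structure"
  assumes rca: "RCA0 M"
begin

definition T0 :: "((nat \<Rightarrow> 'm) \<Rightarrow> 'm) \<Rightarrow> bool" where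
  "T0 t \<longleftrightarrow> (\<exists>s c. \<forall>e. t e = num_val M (mix e c) s)"

text \<open>A semantic stand-in for bounded formulas with number and set parameters: once closure
  under the connectives is proved, the axiom schemes apply to HOL predicates by resolution, and no
  formula has to be written out.\<close>

definition D0 :: "((nat \<Rightarrow> 'm) \<Rightarrow> bool) \<Rightarrow> bool" where
  "D0 P \<longleftrightarrow> (\<exists>q v c. bounded_fm q \<and> range v \<subseteq> l2_sets M \<and> (\<forall>e. P e \<longleftrightarrow> arith_sat M v (mix e c) q))"

lemma T0_extend_left: "num_val M (mix e c) s = num_val M (mix e (mix c d)) (tm_rename
    left_index s)"
  by (simp only: num_val_rename mix_comp_left)

lemma T0_extend_right: "num_val M (mix e d) s = num_val M (mix e (mix c d)) (tm_rename
    right_index s)"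
  by (simp only: num_val_rename mix_comp_right)

lemma D0_extend_left: "arith_sat M v (mix e c) q = arith_sat M (mix v w) (mix e (mix c d)) (fm_rename
    left_index (\<lambda>i. 2 * i) q)"
  by (simp only: arith_sat_rename mix_comp_left mix_comp_double)

lemma D0_extend_right: "arith_sat M w (mix e d) q = arith_sat M (mix v w) (mix e (mix c d)) (fm_rename
    right_index (\<lambda>i. Suc (2 * i)) q)"
  by (simp only: arith_sat_rename mix_comp_right mix_comp_double)

text \<open>Each side comes with its own parameters; \<open>mix c d\<close> holds both lists, and
  the two renamings lead each term to its half.\<close>

lemma T0_merge:
  assumes "T0 s" "T0 t"
  shows "\<exists>s' t' c. (\<forall>e. s e = num_val M (mix e c) s') \<and> (\<forall>e. t e = num_val M (mix e c) t')"
proof -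
  obtain s1 c where s: "\<And>e. s e = num_val M (mix e c) s1" using assms(1) T0_def by auto
  obtain t1 d where t: "\<And>e. t e = num_val M (mix e d) t1" using assms(2) T0_def by auto
  show ?thesis
    by (intro exI conjI allI, rule trans[OF s T0_extend_left[where d = d]], rule trans[OF t T0_extend_right[where c = c]])
qed

lemma D0_merge:
  assumes "D0 P" "D0 Q"
  shows "\<exists>p q v c. bounded_fm p \<and> bounded_fm q \<and> range v \<subseteq> l2_sets M \<and>
    (\<forall>e. P e \<longleftrightarrow> arith_sat M v (mix e c) p) \<and> (\<forall>e. Q e \<longleftrightarrow> arith_sat M v (mix e c) q)"
proof -
  obtain p v c where p: "bounded_fm p" "range v \<subseteq> l2_sets M" "\<And>e. P e \<longleftrightarrow> arith_sat M v (mix e c) p"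
    using assms(1) D0_def by auto
  obtain q w d where q: "bounded_fm q" "range w \<subseteq> l2_sets M" "\<And>e. Q e \<longleftrightarrow> arith_sat M w (mix e d) q"
    using assms(2) D0_def by auto
  show ?thesis
  proof (intro exI conjI allI)
    show "range (mix v w) \<subseteq> l2_sets M" using p(2) q(2) by (rule mix_range)
    show "P e \<longleftrightarrow> arith_sat M (mix v w) (mix e (mix c d)) (fm_rename
      left_index (\<lambda>i. 2 * i) p)" for e
      by (rule trans[OF p(3) D0_extend_left])
    show "Q e \<longleftrightarrow> arith_sat M (mix v w) (mix e (mix c d)) (fm_rename
      right_index (\<lambda>i. Suc (2 * i)) q)" for e
      by (rule trans[OF q(3) D0_extend_right])
  qed (use p q in auto)
qed

lemma T0_D0_merge:
  assumes "T0 t" "D0 Q"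
  shows "\<exists>s q v c. bounded_fm q \<and> range v \<subseteq> l2_sets M \<and>
    (\<forall>e. t e = num_val M (mix e c) s) \<and> (\<forall>e. Q e \<longleftrightarrow> arith_sat M v (mix e c) q)"
proof -
  obtain s c where s: "\<And>e. t e = num_val M (mix e c) s" using assms(1) T0_def by auto
  obtain q w d where q: "bounded_fm q" "range w \<subseteq> l2_sets M" "\<And>e. Q e \<longleftrightarrow> arith_sat M w (mix e d) q"
    using assms(2) D0_def by auto
  show ?thesis
  proof (intro exI conjI allI)
    show "range (mix w w) \<subseteq> l2_sets M" using q(2) q(2) by (rule mix_range)
    show "t e = num_val M (mix e (mix c d)) (tm_rename
      left_index s)" for e
      by (rule trans[OF s T0_extend_left])
    show "Q e \<longleftrightarrow> arith_sat M (mix w w) (mix e (mix c d)) (fm_rename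
      right_index (\<lambda>i. Suc (2 * i)) q)" for e
      by (rule trans[OF q(3) D0_extend_right])
  qed (use q in auto)
qed

lemma T0_var: "T0 (\<lambda>e. e i)"
  unfolding T0_def by (rule exI[of _ "Var (2 * i)"]) simp

lemma T0_const: "T0 (\<lambda>e. a)"
  unfolding T0_def by (rule exI[of _ "Var 1"], rule exI[of _ "\<lambda>_. a"]) simp

lemma T0_plus:
  assumes "T0 s" "T0 t" shows "T0 (\<lambda>e. l2_plus M (s e) (t e))"
proof -
  obtain s' t' c where *: "\<forall>e. s e = num_val M (mix e c) s'" "\<forall>e. t e = num_val M (mix e c) t'"
    using T0_merge[OF assms] by blast
  show ?thesis unfolding T0_def by (rule exI[of _ "Plus s' t'"], rule exI[of _ c]) (simp add: *)
qed

lemma T0_times: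
  assumes "T0 s" "T0 t" shows "T0 (\<lambda>e. l2_times M (s e) (t e))"
proof -
  obtain s' t' c where *: "\<forall>e. s e = num_val M (mix e c) s'" "\<forall>e. t e = num_val M (mix e c) t'"
    using T0_merge[OF assms] by blast
  show ?thesis unfolding T0_def by (rule exI[of _ "Times s' t'"], rule exI[of _ c]) (simp add: *)
qed

lemma T0_suc: "T0 t \<Longrightarrow> T0 (\<lambda>e. l2_suc M (t e))"
  unfolding l2_suc_def by (rule T0_plus[OF _ T0_const])

text \<open>Even a formula without set variables is evaluated under a total set assignment, so one
  has to be at hand.\<close>

lemma ex_sets_assignment: "\<exists>v :: nat \<Rightarrow> 'm set. range v \<subseteq> l2_sets M"
proof -
  obtain A where "A \<in> l2_sets M" using rca unfolding RCA0_def by auto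
  then show ?thesis by (intro exI[of _ "\<lambda>_. A"]) auto
qed

lemma D0_eq:
  assumes "T0 s" "T0 t" shows "D0 (\<lambda>e. s e = t e)"
proof -
  obtain s' t' c where *: "\<forall>e. s e = num_val M (mix e c) s'" "\<forall>e. t e = num_val M (mix e c) t'"
    using T0_merge[OF assms] by blast
  obtain v :: "nat \<Rightarrow> 'm set" where "range v \<subseteq> l2_sets M" using ex_sets_assignment by blast
  then show ?thesis unfolding D0_def
    by (intro exI[of _ "Eq s' t'"] exI[of _ v] exI[of _ c]) (simp add: *)
qed

lemma D0_less:
  assumes "T0 s" "T0 t" shows "D0 (\<lambda>e. l2_less M (s e) (t e))"
proof -
  obtain s' t' c where *: "\<forall>e. s e = num_val M (mix e c) s'" "\<forall>e. t e = num_val M (mix e c) t'"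
    using T0_merge[OF assms] by blast
  obtain v :: "nat \<Rightarrow> 'm set" where "range v \<subseteq> l2_sets M" using ex_sets_assignment by blast
  then show ?thesis unfolding D0_def
    by (intro exI[of _ "Less s' t'"] exI[of _ v] exI[of _ c]) (simp add: *)
qed

lemma D0_mem:
  assumes "A \<in> l2_sets M" "T0 t" shows "D0 (\<lambda>e. t e \<in> A)"
proof -
  obtain s c where "\<And>e. t e = num_val M (mix e c) s" using assms(2) T0_def by auto
  then show ?thesis using assms(1) unfolding D0_def
    by (intro exI[of _ "Mem s 0"] exI[of _ "\<lambda>_. A"] exI[of _ c]) auto
qed

lemma D0_not: "D0 P \<Longrightarrow> D0 (\<lambda>e. \<not> P e)"
  unfolding D0_def by (metis arith_sat.simps(4) bounded_fm.simps(4))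

lemma D0_conj: "D0 P \<Longrightarrow> D0 Q \<Longrightarrow> D0 (\<lambda>e. P e \<and> Q e)"
proof -
  assume "D0 P" "D0 Q"
  then obtain p q v c where "bounded_fm p" "bounded_fm q" "range v \<subseteq> l2_sets M"
    "\<forall>e. P e \<longleftrightarrow> arith_sat M v (mix e c) p" "\<forall>e. Q e \<longleftrightarrow> arith_sat M v (mix e c) q"
    using D0_merge by metis
  then show "D0 (\<lambda>e. P e \<and> Q e)" unfolding D0_def
    by (intro exI[of _ "Conj p q"] exI[of _ v] exI[of _ c]) simp
qed

lemma D0_disj: "D0 P \<Longrightarrow> D0 Q \<Longrightarrow> D0 (\<lambda>e. P e \<or> Q e)"
  using D0_not[OF D0_conj[OF D0_not D0_not], of P Q] by simp

lemma D0_imp: "D0 P \<Longrightarrow> D0 Q \<Longrightarrow> D0 (\<lambda>e. P e \<longrightarrow> Q e)"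
  using D0_not[OF D0_conj[OF _ D0_not], of P Q] by simp

lemma D0_rename:
  assumes "D0 P" shows "D0 (\<lambda>e. P (\<lambda>i. e (r i)))"
proof -
  from assms obtain q v c where q: "bounded_fm q" "range v \<subseteq> l2_sets M" "\<And>e. P e \<longleftrightarrow> arith_sat M v (mix e c) q"
    unfolding D0_def by auto
  have "P (\<lambda>i. e (r i)) \<longleftrightarrow> arith_sat M v (mix e c)
    (fm_rename (\<lambda>i. if even i then 2 * r (i div 2) else i) (\<lambda>i. i) q)" for e
    using q(3)[of "e \<circ> r"] mix_comp_vars[of e r c] by (simp add: comp_def)
  with q show ?thesis unfolding D0_def
    by (intro exI[of _ "fm_rename (\<lambda>i. if even i then 2 * r (i div 2) else i) (\<lambda>i. i) q"]
        exI[of _ v] exI[of _ c]) (simp del: arith_sat_rename)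
qed

lemma D0_ball:
  assumes "T0 t" "D0 (\<lambda>e. P (e 0) (\<lambda>i. e (Suc i)))"
  shows "D0 (\<lambda>e. \<forall>x. l2_less M x (t e) \<longrightarrow> P x e)"
proof -
  obtain s q v c where *: "bounded_fm q" "range v \<subseteq> l2_sets M"
    "\<forall>e. t e = num_val M (mix e c) s" "\<forall>e. P (e 0) (\<lambda>i. e (Suc i)) \<longleftrightarrow> arith_sat M v (mix e c) q"
    using T0_D0_merge[OF assms] by blast
  have "P x e \<longleftrightarrow> arith_sat M v (case_nat x (mix e c))
     (fm_rename binder_index (\<lambda>i. i) q)" for x e
    unfolding arith_sat_rename mix_case_nat using *(4)[rule_format, of "case_nat x e"] by (simp add: comp_def)
  with * show ?thesis unfolding D0_def
    by (intro exI[of _ "BAll s (fm_rename binder_index (\<lambda>i. i) q)"]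
        exI[of _ v] exI[of _ c]) (simp del: arith_sat_rename)
qed

lemma D0_bex:
  assumes "T0 t" "D0 (\<lambda>e. P (e 0) (\<lambda>i. e (Suc i)))"
  shows "D0 (\<lambda>e. \<exists>x. l2_less M x (t e) \<and> P x e)"
  using D0_not[OF D0_ball[OF assms(1), of "\<lambda>x e. \<not> P x e"]] D0_not[OF assms(2)] by simp

lemmas D0_intros = D0_not D0_conj D0_disj D0_imp D0_ball D0_bex D0_eq D0_less D0_mem
  T0_var T0_plus T0_times T0_suc T0_const

text \<open>Passes from the interleaved assignments of \<open>D0\<close> to the form
  \<open>case_nat y (case_nat x c)\<close>, in which the axiom schemes present the witness and the
  induction or comprehension variable.\<close>

lemma bounded_formula_two_vars:
  assumes "bounded_fm q" "range v \<subseteq> l2_sets M" "\<And>e. Q (e 0) (e (Suc 0)) \<longleftrightarrow> arith_sat M v (mix e c) q"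
  shows "Q y x \<longleftrightarrow> arith_sat M v (case_nat y (case_nat x c)) (fm_rename
    two_vars_index (\<lambda>i. i) q)"
  using assms(3)[of "case_nat y (case_nat x (\<lambda>_. c 0))"]
  unfolding arith_sat_rename mix_two_vars by (simp add: comp_def)

lemma sigma_induct0:
  assumes "D0 (\<lambda>e. Q (e 0) (e (Suc 0)))" "\<exists>y. Q y (l2_zero M)"
    and "\<And>x. \<exists>y. Q y x \<Longrightarrow> \<exists>y. Q y (l2_suc M x)"
  shows "\<exists>y. Q y n"
proof -
  obtain q v c where *: "bounded_fm q" "range v \<subseteq> l2_sets M"
    "\<And>e. Q (e 0) (e (Suc 0)) \<longleftrightarrow> arith_sat M v (mix e c) q"
    using assms(1) unfolding D0_def by auto
  obtain q' where q': "bounded_fm q'" "\<And>y x. Q y x \<longleftrightarrow> arith_sat M v (case_nat y (case_nat x c)) q'"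
    using bounded_formula_two_vars[OF *] *(1) bounded_fm_rename by blast
  have "induction_for Sigma01_fm M" using rca unfolding RCA0_def by simp
  note induct = this[unfolded induction_for_def, rule_format]
  have "Sigma01_fm (Ex q')" using q'(1) unfolding Sigma01_fm_def by blast
  from induct[OF this *(2), of c n] assms(2,3) have "arith_sat M v (case_nat n c) (Ex q')"
    by (simp add: q'(2))
  then show ?thesis by (simp add: q'(2))
qed

lemma D0_induct:
  assumes "D0 (\<lambda>e. P (e 0))" "P (l2_zero M)" "\<And>x. P x \<Longrightarrow> P (l2_suc M x)"
  shows "P n"
  using sigma_induct0[of "\<lambda>y x. P x"] assms D0_rename[OF assms(1), of "\<lambda>i. Suc i"] by auto

lemma comprehension0:
  assumes "D0 (\<lambda>e. P (e 0) (e (Suc 0)))" "D0 (\<lambda>e. Q (e 0) (e (Suc 0)))"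
    and "\<And>x. (\<exists>y. P y x) \<longleftrightarrow> \<not> (\<exists>y. Q y x)"
  shows "{x. \<exists>y. P y x} \<in> l2_sets M"
proof -
  obtain p q v c where *: "bounded_fm p" "bounded_fm q" "range v \<subseteq> l2_sets M"
    "\<forall>e. P (e 0) (e (Suc 0)) \<longleftrightarrow> arith_sat M v (mix e c) p"
    "\<forall>e. Q (e 0) (e (Suc 0)) \<longleftrightarrow> arith_sat M v (mix e c) q"
    using D0_merge[OF assms(1,2)] by blast
  obtain p' where p': "bounded_fm p'" "\<And>y x. P y x \<longleftrightarrow> arith_sat M v (case_nat y (case_nat x c)) p'"
    using bounded_formula_two_vars[OF *(1,3) *(4)[rule_format]] *(1) bounded_fm_rename by blast
  obtain q' where q': "bounded_fm q'" "\<And>y x. Q y x \<longleftrightarrow> arith_sat M v (case_nat y (case_nat x c)) q'"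
    using bounded_formula_two_vars[OF *(2,3) *(5)[rule_format]] *(2) bounded_fm_rename by blast
  have "Sigma01_fm (Ex p')" using p'(1) unfolding Sigma01_fm_def by blast
  moreover have "Pi01_fm (All (Neg q'))" using q'(1) unfolding Pi01_fm_def by simp
  moreover have "\<forall>x. arith_sat M v (case_nat x c) (Ex p') \<longleftrightarrow> arith_sat M v (case_nat x c) (All (Neg q'))"
    using assms(3) by (simp add: p'(2) q'(2))
  moreover have "Delta01_comprehension M" using rca unfolding RCA0_def by simp
  ultimately have "{x. arith_sat M v (case_nat x c) (Ex p')} \<in> l2_sets M"
    using *(3) unfolding Delta01_comprehension_def by blast
  then show ?thesis by (simp add: p'(2))
qed

section \<open>Arithmetic in a model of RCA0\<close>

abbreviation zero_M ("\<^bold>0") where "\<^bold>0 \<equiv> l2_zero M"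
abbreviation one_M ("\<^bold>1") where "\<^bold>1 \<equiv> l2_one M"
abbreviation plus_M (infixl "\<^bold>+" 65) where "a \<^bold>+ b \<equiv> l2_plus M a b"
abbreviation times_M (infixl "\<^bold>*" 70) where "a \<^bold>* b \<equiv> l2_times M a b"
abbreviation less_M (infix "\<^bold><" 50) where "a \<^bold>< b \<equiv> l2_less M a b"
abbreviation suc_M where "suc_M a \<equiv> l2_suc M a"

definition le_M (infix "\<^bold>\<le>" 50) where "a \<^bold>\<le> b \<longleftrightarrow> a \<^bold>< b \<or> a = b"

lemma basic: "basic_arithmetic M"
  using rca unfolding RCA0_def by simp

lemma suc_not_zero [simp]: "suc_M n \<noteq> \<^bold>0" "\<^bold>0 \<noteq> suc_M n"
  and suc_inject [simp]: "suc_M m = suc_M n \<longleftrightarrow> m = n"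
  and add_zero [simp]: "m \<^bold>+ \<^bold>0 = m"
  and add_suc: "m \<^bold>+ suc_M n = suc_M (m \<^bold>+ n)"
  and mult_zero [simp]: "m \<^bold>* \<^bold>0 = \<^bold>0"
  and mult_suc: "m \<^bold>* suc_M n = m \<^bold>* n \<^bold>+ m"
  and not_less_zero [simp]: "\<not> m \<^bold>< \<^bold>0"
  and less_suc: "m \<^bold>< suc_M n \<longleftrightarrow> m \<^bold>< n \<or> m = n"
  using basic unfolding basic_arithmetic_def by metis+

lemma less_suc_le: "m \<^bold>< suc_M n \<longleftrightarrow> m \<^bold>\<le> n"
  by (simp add: less_suc le_M_def)

lemma zero_add [simp]: "\<^bold>0 \<^bold>+ m = m"
proof (rule D0_induct[of "\<lambda>m. \<^bold>0 \<^bold>+ m = m"])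
qed (rule D0_intros | simp add: add_suc)+

lemma suc_add: "suc_M m \<^bold>+ n = suc_M (m \<^bold>+ n)"
proof (rule D0_induct[of "\<lambda>n. suc_M m \<^bold>+ n = suc_M (m \<^bold>+ n)"])
qed (rule D0_intros | simp add: add_suc)+

lemma add_commute: "m \<^bold>+ n = n \<^bold>+ m"
proof (rule D0_induct[of "\<lambda>n. m \<^bold>+ n = n \<^bold>+ m"])
qed (rule D0_intros | simp add: add_suc suc_add)+

lemma add_assoc: "(m \<^bold>+ n) \<^bold>+ k = m \<^bold>+ (n \<^bold>+ k)"
proof (rule D0_induct[of "\<lambda>k. (m \<^bold>+ n) \<^bold>+ k = m \<^bold>+ (n \<^bold>+ k)"])
qed (rule D0_intros | simp add: add_suc)+

lemma add_left_commute: "m \<^bold>+ (n \<^bold>+ k) = n \<^bold>+ (m \<^bold>+ k)"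
  by (metis add_assoc add_commute)

lemmas add_ac = add_assoc add_commute add_left_commute

lemma suc_zero [simp]: "suc_M \<^bold>0 = \<^bold>1"
  by (simp add: l2_suc_def)

lemma suc_eq: "suc_M m = m \<^bold>+ \<^bold>1"
  by (simp add: l2_suc_def)

lemma zero_mult [simp]: "\<^bold>0 \<^bold>* m = \<^bold>0"
proof (rule D0_induct[of "\<lambda>m. \<^bold>0 \<^bold>* m = \<^bold>0"])
qed (rule D0_intros | simp add: mult_suc)+

lemma suc_mult: "suc_M m \<^bold>* n = m \<^bold>* n \<^bold>+ n"
proof (rule D0_induct[of "\<lambda>n. suc_M m \<^bold>* n = m \<^bold>* n \<^bold>+ n"])
qed (rule D0_intros | simp add: mult_suc add_suc suc_add add_ac)+

lemma mult_commute: "m \<^bold>* n = n \<^bold>* m"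
proof (rule D0_induct[of "\<lambda>n. m \<^bold>* n = n \<^bold>* m"])
qed (rule D0_intros | simp add: mult_suc suc_mult)+

lemma distrib_left: "k \<^bold>* (m \<^bold>+ n) = k \<^bold>* m \<^bold>+ k \<^bold>* n"
proof (rule D0_induct[of "\<lambda>n. k \<^bold>* (m \<^bold>+ n) = k \<^bold>* m \<^bold>+ k \<^bold>* n"])
qed (rule D0_intros | simp add: mult_suc add_suc suc_add add_ac)+

lemma distrib_right: "(m \<^bold>+ n) \<^bold>* k = m \<^bold>* k \<^bold>+ n \<^bold>* k"
  by (metis mult_commute distrib_left)

lemma mult_assoc: "(m \<^bold>* n) \<^bold>* k = m \<^bold>* (n \<^bold>* k)"
proof (rule D0_induct[of "\<lambda>k. (m \<^bold>* n) \<^bold>* k = m \<^bold>* (n \<^bold>* k)"])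
qed (rule D0_intros | simp add: mult_suc distrib_left)+

lemma mult_left_commute: "m \<^bold>* (n \<^bold>* k) = n \<^bold>* (m \<^bold>* k)"
  by (metis mult_assoc mult_commute)

lemma mult_one [simp]: "m \<^bold>* \<^bold>1 = m" "\<^bold>1 \<^bold>* m = m"
  using mult_suc[of m "\<^bold>0"] mult_commute by auto

lemmas semiring_ac = distrib_left distrib_right add_ac mult_assoc mult_commute mult_left_commute

lemma add_right_cancel [simp]: "m \<^bold>+ k = n \<^bold>+ k \<longleftrightarrow> m = n"
proof -
  have "m \<^bold>+ k = n \<^bold>+ k \<longrightarrow> m = n"
  proof (rule D0_induct[of "\<lambda>k. m \<^bold>+ k = n \<^bold>+ k \<longrightarrow> m = n"])
  qed (rule D0_intros | simp add: add_suc)+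
  then show ?thesis by blast
qed

lemma add_left_cancel [simp]: "k \<^bold>+ m = k \<^bold>+ n \<longleftrightarrow> m = n"
  by (metis add_commute add_right_cancel)

lemma zero_or_suc: "n = \<^bold>0 \<or> (\<exists>m. n = suc_M m)"
proof -
  have "\<exists>m. n = \<^bold>0 \<or> n = suc_M m"
    by (rule sigma_induct0[of "\<lambda>m n. n = \<^bold>0 \<or> n = suc_M m"]) (rule D0_intros | auto)+
  then show ?thesis by blast
qed

lemma add_eq_zero [simp]: "m \<^bold>+ n = \<^bold>0 \<longleftrightarrow> m = \<^bold>0 \<and> n = \<^bold>0"
  by (metis add_suc add_zero suc_not_zero(1) zero_or_suc)

lemma add_eq_self [simp]: "m \<^bold>+ n = m \<longleftrightarrow> n = \<^bold>0"
  by (metis add_zero add_left_cancel)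

lemma less_iff_add: "m \<^bold>< n \<longleftrightarrow> (\<exists>k. n = m \<^bold>+ suc_M k)"
proof
  have "\<exists>k. m \<^bold>< n \<longrightarrow> n = m \<^bold>+ suc_M k"
  proof (rule sigma_induct0[of "\<lambda>k n. m \<^bold>< n \<longrightarrow> n = m \<^bold>+ suc_M k"])
    fix n assume "\<exists>k. m \<^bold>< n \<longrightarrow> n = m \<^bold>+ suc_M k"
    then obtain k where k: "m \<^bold>< n \<longrightarrow> n = m \<^bold>+ suc_M k" by blast
    show "\<exists>k. m \<^bold>< suc_M n \<longrightarrow> suc_M n = m \<^bold>+ suc_M k"
    proof (cases "m = n")
      case True
      then show ?thesis by (intro exI[of _ "\<^bold>0"]) (simp add: suc_eq)
    next
      case False
      then show ?thesis using k by (intro exI[of _ "suc_M k"]) (auto simp: less_suc add_suc)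
    qed
  qed (rule D0_intros | simp)+
  then show "m \<^bold>< n \<Longrightarrow> \<exists>k. n = m \<^bold>+ suc_M k" by blast
next
  have "m \<^bold>< m \<^bold>+ suc_M k" for k
  proof (rule D0_induct[of "\<lambda>k. m \<^bold>< m \<^bold>+ suc_M k"])
  qed (rule D0_intros | simp add: add_suc less_suc | simp add: add_suc less_suc suc_eq[symmetric])+
  then show "\<exists>k. n = m \<^bold>+ suc_M k \<Longrightarrow> m \<^bold>< n" by blast
qed

lemma le_iff_add: "m \<^bold>\<le> n \<longleftrightarrow> (\<exists>k. n = m \<^bold>+ k)"
  unfolding le_M_def less_iff_add by (metis add_zero zero_or_suc)

lemma less_or_eq_or_greater: "m \<^bold>< n \<or> m = n \<or> n \<^bold>< m"
proof (rule D0_induct[of "\<lambda>m. m \<^bold>< n \<or> m = n \<or> n \<^bold>< m"])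
  show "\<^bold>0 \<^bold>< n \<or> \<^bold>0 = n \<or> n \<^bold>< \<^bold>0"
    by (metis less_iff_add zero_add zero_or_suc)
  fix m assume "m \<^bold>< n \<or> m = n \<or> n \<^bold>< m"
  then consider k where "n = m \<^bold>+ suc_M k" | "n \<^bold>< suc_M m"
    unfolding less_suc using less_iff_add by blast
  then show "suc_M m \<^bold>< n \<or> suc_M m = n \<or> n \<^bold>< suc_M m"
  proof cases
    case (1 k)
    then have n: "n = suc_M m \<^bold>+ k" by (simp add: add_suc suc_add)
    show ?thesis using zero_or_suc[of k] n less_iff_add by auto
  qed simp
qed (rule D0_intros)+

sublocale linorder le_M "l2_less M"
proof
  fix x y z
  show "x \<^bold>< y \<longleftrightarrow> x \<^bold>\<le> y \<and> \<not> y \<^bold>\<le> x"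
    by (auto simp: le_M_def less_iff_add add_assoc add_suc suc_add)
       (metis add_assoc add_eq_self suc_not_zero(1) add_suc)+
  show "x \<^bold>\<le> x" by (simp add: le_M_def)
  show "x \<^bold>\<le> y \<Longrightarrow> y \<^bold>\<le> z \<Longrightarrow> x \<^bold>\<le> z"
    by (auto simp: le_iff_add add_assoc)
  show "x \<^bold>\<le> y \<Longrightarrow> y \<^bold>\<le> x \<Longrightarrow> x = y"
    unfolding le_iff_add by (metis add_assoc add_eq_self add_eq_zero add_zero)
  show "x \<^bold>\<le> y \<or> y \<^bold>\<le> x" using less_or_eq_or_greater[of x y] by (auto simp: le_M_def)
qed

lemma zero_le [simp]: "\<^bold>0 \<^bold>\<le> n" by (simp add: le_iff_add)

lemma zero_less_iff: "\<^bold>0 \<^bold>< n \<longleftrightarrow> n \<noteq> \<^bold>0"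
  by (metis le_M_def zero_le less_irrefl)

lemma le_zero [simp]: "n \<^bold>\<le> \<^bold>0 \<longleftrightarrow> n = \<^bold>0"
  by (auto simp: le_M_def)

lemma less_self_suc [simp]: "m \<^bold>< suc_M m" by (simp add: less_suc)

lemma suc_le_iff: "suc_M m \<^bold>\<le> n \<longleftrightarrow> m \<^bold>< n"
  by (auto simp: le_iff_add less_iff_add add_suc suc_add)

lemma suc_less_suc [simp]: "suc_M m \<^bold>< suc_M n \<longleftrightarrow> m \<^bold>< n"
  by (simp add: less_suc_le suc_le_iff)

lemma le_add1 [simp]: "m \<^bold>\<le> m \<^bold>+ n" and le_add2 [simp]: "n \<^bold>\<le> m \<^bold>+ n"
  unfolding le_iff_add by (metis add_commute)+

lemma add_le_mono: "m \<^bold>\<le> n \<Longrightarrow> k \<^bold>\<le> l \<Longrightarrow> m \<^bold>+ k \<^bold>\<le> n \<^bold>+ l"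
  unfolding le_iff_add by (metis add_assoc add_left_commute)

lemma add_less_cancel_right [simp]: "m \<^bold>+ k \<^bold>< n \<^bold>+ k \<longleftrightarrow> m \<^bold>< n"
proof -
  have "m \<^bold>+ k \<^bold>< n \<^bold>+ k \<longleftrightarrow> (\<exists>l. n \<^bold>+ k = (m \<^bold>+ suc_M l) \<^bold>+ k)"
    unfolding less_iff_add by (simp add: add_ac)
  then show ?thesis unfolding less_iff_add by simp
qed

lemma add_less_cancel_left [simp]: "k \<^bold>+ m \<^bold>< k \<^bold>+ n \<longleftrightarrow> m \<^bold>< n"
  by (metis add_commute add_less_cancel_right)

lemma add_le_cancel_right [simp]: "m \<^bold>+ k \<^bold>\<le> n \<^bold>+ k \<longleftrightarrow> m \<^bold>\<le> n"
  by (simp add: le_M_def)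

lemma add_le_cancel_left [simp]: "k \<^bold>+ m \<^bold>\<le> k \<^bold>+ n \<longleftrightarrow> m \<^bold>\<le> n"
  by (simp add: le_M_def)

lemma one_not_zero [simp]: "\<^bold>1 \<noteq> \<^bold>0" "\<^bold>0 \<noteq> \<^bold>1"
  by (metis suc_zero suc_not_zero)+

lemma mult_eq_zero [simp]: "m \<^bold>* n = \<^bold>0 \<longleftrightarrow> m = \<^bold>0 \<or> n = \<^bold>0"
  by (metis add_eq_zero mult_suc mult_zero zero_mult zero_or_suc)

lemma mult_le_mono: "m \<^bold>\<le> n \<Longrightarrow> k \<^bold>\<le> l \<Longrightarrow> m \<^bold>* k \<^bold>\<le> n \<^bold>* l"
proof -
  assume "m \<^bold>\<le> n" "k \<^bold>\<le> l"
  then obtain a b where "n = m \<^bold>+ a" "l = k \<^bold>+ b" by (auto simp: le_iff_add)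
  then have "n \<^bold>* l = m \<^bold>* k \<^bold>+ (m \<^bold>* b \<^bold>+ a \<^bold>* k \<^bold>+ a \<^bold>* b)" by (simp add: semiring_ac)
  then show ?thesis unfolding le_iff_add by blast
qed

lemma mult_less_mono: "m \<^bold>< n \<Longrightarrow> k \<noteq> \<^bold>0 \<Longrightarrow> m \<^bold>* k \<^bold>< n \<^bold>* k"
proof -
  assume "m \<^bold>< n" "k \<noteq> \<^bold>0"
  then obtain l where n: "n = m \<^bold>+ suc_M l" using less_iff_add by blast
  have "n \<^bold>* k = m \<^bold>* k \<^bold>+ suc_M l \<^bold>* k" by (simp add: n distrib_right)
  moreover have "suc_M l \<^bold>* k \<noteq> \<^bold>0" using \<open>k \<noteq> \<^bold>0\<close> by simp
  ultimately show ?thesis by (metis less_iff_add zero_or_suc)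
qed

lemma mult_right_cancel [simp]: "m \<^bold>* k = n \<^bold>* k \<longleftrightarrow> m = n \<or> k = \<^bold>0"
  by (metis less_irrefl less_or_eq_or_greater mult_less_mono mult_zero)

lemma mult_left_cancel [simp]: "k \<^bold>* m = k \<^bold>* n \<longleftrightarrow> m = n \<or> k = \<^bold>0"
  by (metis mult_commute mult_right_cancel)

lemma le_mult: "k \<noteq> \<^bold>0 \<Longrightarrow> m \<^bold>\<le> m \<^bold>* k"
  using mult_le_mono[of m m "\<^bold>1" k] suc_le_iff[of "\<^bold>0" k] by (simp add: zero_less_iff)

lemma less_one [simp]: "n \<^bold>< \<^bold>1 \<longleftrightarrow> n = \<^bold>0"
  using less_suc[of n "\<^bold>0"] by simp

section \<open>Sigma01 and Delta01 predicates and functions\<close>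

text \<open>A predicate \<open>P e\<close> on assignments may mention the values \<open>e i\<close> of finitely many variables;
  everything else in it is a parameter.\<close>

definition S1 :: "((nat \<Rightarrow> 'm) \<Rightarrow> bool) \<Rightarrow> bool" where
  "S1 P \<longleftrightarrow> (\<exists>Q. D0 Q \<and> (\<forall>e. P e \<longleftrightarrow> (\<exists>y. Q (case_nat y e))))"

definition D1 :: "((nat \<Rightarrow> 'm) \<Rightarrow> bool) \<Rightarrow> bool" where
  "D1 P \<longleftrightarrow> S1 P \<and> S1 (\<lambda>e. \<not> P e)"

text \<open>Variable 0 is the value, the others are the arguments. As the function is total, a
  Sigma01 graph is already Delta01, which is why substituting \<open>t\<close> preserves
  \<open>D1\<close> as well as \<open>S1\<close>.\<close>

definition F1 :: "((nat \<Rightarrow> 'm) \<Rightarrow> 'm) \<Rightarrow> bool" where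
  "F1 t \<longleftrightarrow> S1 (\<lambda>e. e 0 = t (\<lambda>i. e (Suc i)))"

lemma D0_reindex:
  assumes "D0 Q" "\<And>e. f e = (\<lambda>i. e (r i))" shows "D0 (\<lambda>e. Q (f e))"
  using D0_rename[OF assms(1), of r] by (simp add: assms(2))

lemma S1I: "D0 Q \<Longrightarrow> (\<And>e. P e \<longleftrightarrow> (\<exists>y. Q (case_nat y e))) \<Longrightarrow> S1 P"
  unfolding S1_def by blast

lemma S1_D0: "D0 P \<Longrightarrow> S1 P"
  unfolding S1_def by (rule exI[of _ "\<lambda>e. P (\<lambda>i. e (Suc i))"]) (auto intro: D0_rename)

lemma S1_rename:
  assumes "S1 P" shows "S1 (\<lambda>e. P (\<lambda>i. e (r i)))"
proof -
  obtain Q where Q: "D0 Q" "\<And>e. P e \<longleftrightarrow> (\<exists>y. Q (case_nat y e))" using assms S1_def by auto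
  have "D0 (\<lambda>e. Q (case_nat (e 0) (\<lambda>i. e (Suc (r i)))))"
    by (rule D0_reindex[OF Q(1), of _ "case_nat 0 (\<lambda>i. Suc (r i))"]) (auto split: nat.splits)
  then show ?thesis by (rule S1I) (simp add: Q(2))
qed

text \<open>Two unbounded witnesses are contracted into one common bound \<open>z\<close>, under
  which both are sought; \<open>x + y\<close> serves as this bound.\<close>

lemma S1_ex:
  assumes "S1 (\<lambda>e. P (e 0) (\<lambda>i. e (Suc i)))" shows "S1 (\<lambda>e. \<exists>x. P x e)"
proof -
  obtain Q where Q: "D0 Q" "\<And>e. P (e 0) (\<lambda>i. e (Suc i)) \<longleftrightarrow> (\<exists>y. Q (case_nat y e))"
    using assms S1_def by auto
  have P: "P x e \<longleftrightarrow> (\<exists>y. Q (case_nat y (case_nat x e)))" for x e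
    using Q(2)[of "case_nat x e"] by simp
  have D: "D0 (\<lambda>e. \<exists>x. x \<^bold>< suc_M (e 0) \<and> (\<exists>y. y \<^bold>< suc_M (e 0) \<and>
      Q (case_nat y (case_nat x (\<lambda>i. e (Suc i))))))"
    by (rule D0_intros D0_reindex[OF Q(1), of _ "case_nat 0 (case_nat (Suc 0) (\<lambda>i. Suc (Suc (Suc i))))"])+
       (auto split: nat.splits)
  have "(\<exists>x. P x e) \<longleftrightarrow> (\<exists>z. \<exists>x. x \<^bold>< suc_M z \<and> (\<exists>y. y \<^bold>< suc_M z \<and> Q (case_nat y (case_nat x e))))" for e
  proof
    assume "\<exists>x. P x e"
    then obtain x y where "Q (case_nat y (case_nat x e))" unfolding P by blast
    moreover have "x \<^bold>< suc_M (x \<^bold>+ y)" "y \<^bold>< suc_M (x \<^bold>+ y)" by (simp_all add: less_suc_le)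
    ultimately show "\<exists>z. \<exists>x. x \<^bold>< suc_M z \<and> (\<exists>y. y \<^bold>< suc_M z \<and> Q (case_nat y (case_nat x e)))" by blast
  qed (use P in blast)
  then show ?thesis by (intro S1I[OF D]) simp
qed

lemma S1_disj:
  assumes "S1 P" "S1 Q" shows "S1 (\<lambda>e. P e \<or> Q e)"
proof -
  obtain P' where P: "D0 P'" "\<And>e. P e \<longleftrightarrow> (\<exists>y. P' (case_nat y e))" using assms S1_def by auto
  obtain Q' where Q: "D0 Q'" "\<And>e. Q e \<longleftrightarrow> (\<exists>y. Q' (case_nat y e))" using assms S1_def by auto
  show ?thesis unfolding S1_def P(2) Q(2)
    by (rule exI[of _ "\<lambda>e. P' e \<or> Q' e"]) (auto intro: D0_disj P(1) Q(1))
qed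

lemma S1_conj_D0:
  assumes "D0 P" "S1 Q" shows "S1 (\<lambda>e. P e \<and> Q e)"
proof -
  obtain Q' where Q: "D0 Q'" "\<And>e. Q e \<longleftrightarrow> (\<exists>y. Q' (case_nat y e))" using assms S1_def by auto
  show ?thesis
    by (rule S1I[OF D0_conj[OF D0_rename[OF assms(1), of Suc] Q(1)]]) (simp add: Q(2))
qed

text \<open>The witness of \<open>P\<close> becomes one more free variable, so that only a bounded
  conjunct is left beside \<open>Q\<close>; \<open>S1_ex\<close> then absorbs the quantifier
  again.\<close>

lemma S1_conj:
  assumes "S1 P" "S1 Q" shows "S1 (\<lambda>e. P e \<and> Q e)"
proof -
  obtain P' where P: "D0 P'" "\<And>e. P e \<longleftrightarrow> (\<exists>y. P' (case_nat y e))" using assms S1_def by auto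
  have *: "(\<lambda>e. P e \<and> Q e) = (\<lambda>e. \<exists>y. P' (case_nat y e) \<and> Q e)" unfolding P(2) by auto
  have "case_nat (e 0) (\<lambda>i. e (Suc i)) = e" for e :: "nat \<Rightarrow> 'm" by (auto split: nat.splits)
  then show ?thesis unfolding * using S1_conj_D0[OF P(1) S1_rename[OF assms(2), of Suc]]
    by (intro S1_ex) simp
qed

lemma S1_subst:
  assumes "F1 t" "S1 (\<lambda>e. P (e 0) (\<lambda>i. e (Suc i)))" shows "S1 (\<lambda>e. P (t e) e)"
proof -
  have "S1 (\<lambda>e. \<exists>x. x = t e \<and> P x e)"
    using assms unfolding F1_def by (intro S1_ex S1_conj)
  then show ?thesis by simp
qed

lemma F1_T0:
  assumes "T0 t" shows "F1 t"
proof -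
  obtain s c where s: "\<And>e. t e = num_val M (mix e c) s" using assms T0_def by auto
  have "T0 (\<lambda>e. t (\<lambda>i. e (Suc i)))" unfolding T0_def s
    by (rule exI[of _ "tm_rename (\<lambda>i. if even i then 2 * Suc (i div 2) else i) s"], rule exI[of _ c])
       (simp only: num_val_rename mix_comp_vars[where r = Suc, symmetric], simp add: comp_def)
  then show ?thesis unfolding F1_def by (intro S1_D0 D0_eq T0_var)
qed

lemma F1_rename:
  assumes "F1 t" shows "F1 (\<lambda>e. t (\<lambda>i. e (r i)))"
  using S1_rename[OF assms[unfolded F1_def], of "case_nat 0 (\<lambda>i. Suc (r i))"] unfolding F1_def by simp

lemma F1_var: "F1 (\<lambda>e. e i)" and F1_const: "F1 (\<lambda>e. a)"
  by (rule F1_T0 T0_var T0_const)+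

lemma S1_subst2:
  assumes "F1 s" "F1 t" "S1 (\<lambda>e. P (e 0) (e (Suc 0)))" shows "S1 (\<lambda>e. P (s e) (t e))"
proof (rule S1_subst[OF assms(1)])
  show "S1 (\<lambda>e. P (e 0) (t (\<lambda>i. e (Suc i))))"
    by (rule S1_subst[OF F1_rename[OF assms(2)], where P = "\<lambda>x e. P (e 0) x"])
       (use S1_rename[OF assms(3), of "case_nat 1 (\<lambda>_. 0)"] in simp)
qed

lemma S1_subst1:
  assumes "F1 s" "S1 (\<lambda>e. P (e 0))" shows "S1 (\<lambda>e. P (s e))"
  using S1_subst2[OF assms(1,1), of "\<lambda>x y. P x"] assms(2) by simp

lemma S1_subst3:
  assumes "F1 s" "F1 t" "F1 u" "S1 (\<lambda>e. P (e 0) (e (Suc 0)) (e (Suc (Suc 0))))"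
  shows "S1 (\<lambda>e. P (s e) (t e) (u e))"
proof (rule S1_subst[OF assms(1)])
  show "S1 (\<lambda>e. P (e 0) (t (\<lambda>i. e (Suc i))) (u (\<lambda>i. e (Suc i))))"
  proof (rule S1_subst[OF F1_rename[OF assms(2)], where P = "\<lambda>x e. P (e 0) x (u (\<lambda>i. e (Suc i)))"])
    show "S1 (\<lambda>e. P (e (Suc 0)) (e 0) (u (\<lambda>i. e (Suc (Suc i)))))"
      by (rule S1_subst[OF F1_rename[OF assms(3)], where P = "\<lambda>x e. P (e (Suc 0)) (e 0) x"])
         (use S1_rename[OF assms(4), of "case_nat 2 (case_nat 1 (\<lambda>_. 0))"] in \<open>simp add: numeral_2_eq_2\<close>)
  qed
qed

lemma D1_subst1: "F1 s \<Longrightarrow> D1 (\<lambda>e. P (e 0)) \<Longrightarrow> D1 (\<lambda>e. P (s e))"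
  unfolding D1_def using S1_subst1[of s P] S1_subst1[of s "\<lambda>x. \<not> P x"] by blast

lemma D1_subst2: "F1 s \<Longrightarrow> F1 t \<Longrightarrow> D1 (\<lambda>e. P (e 0) (e (Suc 0))) \<Longrightarrow> D1 (\<lambda>e. P (s e) (t e))"
  unfolding D1_def using S1_subst2[of s t P] S1_subst2[of s t "\<lambda>x y. \<not> P x y"] by blast

lemma D1_subst3: "F1 s \<Longrightarrow> F1 t \<Longrightarrow> F1 u \<Longrightarrow> D1 (\<lambda>e. P (e 0) (e (Suc 0)) (e (Suc (Suc 0)))) \<Longrightarrow>
    D1 (\<lambda>e. P (s e) (t e) (u e))"
  unfolding D1_def using S1_subst3[of s t u P] S1_subst3[of s t u "\<lambda>x y z. \<not> P x y z"] by blast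

lemma F1_subst1:
  assumes "F1 s" "F1 (\<lambda>e. f (e 0))" shows "F1 (\<lambda>e. f (s e))"
  unfolding F1_def
  by (rule S1_subst2[OF F1_var F1_rename[OF assms(1)], of "\<lambda>x y. x = f y"])
     (use assms(2) in \<open>simp add: F1_def\<close>)

lemma F1_subst2:
  assumes "F1 s" "F1 t" "F1 (\<lambda>e. f (e 0) (e (Suc 0)))" shows "F1 (\<lambda>e. f (s e) (t e))"
  unfolding F1_def
  by (rule S1_subst3[OF F1_var F1_rename[OF assms(1)] F1_rename[OF assms(2)], of "\<lambda>x y z. x = f y z"])
     (use assms(3) in \<open>simp add: F1_def\<close>)

lemma F1_plus: "F1 s \<Longrightarrow> F1 t \<Longrightarrow> F1 (\<lambda>e. s e \<^bold>+ t e)"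
  by (erule (1) F1_subst2) (rule F1_T0 D0_intros)+

lemma F1_times: "F1 s \<Longrightarrow> F1 t \<Longrightarrow> F1 (\<lambda>e. s e \<^bold>* t e)"
  by (erule (1) F1_subst2) (rule F1_T0 D0_intros)+

lemma F1_suc: "F1 s \<Longrightarrow> F1 (\<lambda>e. suc_M (s e))"
  by (erule F1_subst1) (rule F1_T0 D0_intros)+

lemma D1_D0: "D0 P \<Longrightarrow> D1 P"
  unfolding D1_def by (intro conjI S1_D0 D0_not)

lemma D1_eq: "F1 s \<Longrightarrow> F1 t \<Longrightarrow> D1 (\<lambda>e. s e = t e)"
  by (erule (1) D1_subst2) (rule D1_D0 D0_intros)+

lemma D1_less: "F1 s \<Longrightarrow> F1 t \<Longrightarrow> D1 (\<lambda>e. s e \<^bold>< t e)"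
  by (erule (1) D1_subst2) (rule D1_D0 D0_intros)+

lemma D1_le: "F1 s \<Longrightarrow> F1 t \<Longrightarrow> D1 (\<lambda>e. s e \<^bold>\<le> t e)"
  unfolding le_M_def by (erule (1) D1_subst2) (rule D1_D0 D0_intros)+

lemma D1_mem: "A \<in> l2_sets M \<Longrightarrow> F1 t \<Longrightarrow> D1 (\<lambda>e. t e \<in> A)"
  by (erule D1_subst1) (rule D1_D0 D0_mem T0_var | assumption)+

lemma D1_imp_S1: "D1 P \<Longrightarrow> S1 P" by (simp add: D1_def)

lemma D1_not: "D1 P \<Longrightarrow> D1 (\<lambda>e. \<not> P e)" by (simp add: D1_def)

lemma D1_conj: "D1 P \<Longrightarrow> D1 Q \<Longrightarrow> D1 (\<lambda>e. P e \<and> Q e)"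
  unfolding D1_def using S1_conj S1_disj[of "\<lambda>e. \<not> P e" "\<lambda>e. \<not> Q e"] by simp

lemma D1_disj: "D1 P \<Longrightarrow> D1 Q \<Longrightarrow> D1 (\<lambda>e. P e \<or> Q e)"
  unfolding D1_def using S1_disj S1_conj[of "\<lambda>e. \<not> P e" "\<lambda>e. \<not> Q e"] by simp

lemma D1_imp: "D1 P \<Longrightarrow> D1 Q \<Longrightarrow> D1 (\<lambda>e. P e \<longrightarrow> Q e)"
  unfolding imp_conv_disj by (intro D1_disj D1_not)

lemma D1_iff: "D1 P \<Longrightarrow> D1 Q \<Longrightarrow> D1 (\<lambda>e. P e \<longleftrightarrow> Q e)"
  unfolding iff_conv_conj_imp by (intro D1_conj D1_imp)

lemma S1_imp: "D1 P \<Longrightarrow> S1 Q \<Longrightarrow> S1 (\<lambda>e. P e \<longrightarrow> Q e)"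
  unfolding imp_conv_disj by (intro S1_disj D1_imp_S1[OF D1_not])

lemma S1_induct [consumes 1, case_names zero suc]:
  assumes "S1 (\<lambda>e. P (e 0))" "P \<^bold>0" "\<And>x. P x \<Longrightarrow> P (suc_M x)"
  shows "P n"
proof -
  obtain Q where Q: "D0 Q" "\<And>e. P (e 0) \<longleftrightarrow> (\<exists>y. Q (case_nat y e))" using assms(1) S1_def by auto
  \<comment> \<open>\<open>P\<close> looks at variable 0 only, so nothing is lost on constant
    assignments, and these leave just the two variables that \<open>sigma_induct0\<close>
    allows.\<close>
  have P: "P x \<longleftrightarrow> (\<exists>y. Q (case_nat y (\<lambda>_. x)))" for x using Q(2)[of "\<lambda>_. x"] by simp
  have "D0 (\<lambda>e. Q (case_nat (e 0) (\<lambda>_. e (Suc 0))))"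
    by (rule D0_reindex[OF Q(1), of _ "case_nat 0 (\<lambda>_. Suc 0)"]) (auto split: nat.splits)
  from sigma_induct0[OF this] assms(2,3) show ?thesis unfolding P by blast
qed

lemma comprehension:
  assumes "D1 (\<lambda>e. P (e 0))" shows "{x. P x} \<in> l2_sets M"
proof -
  obtain Q where Q: "D0 Q" "\<And>e. P (e 0) \<longleftrightarrow> (\<exists>y. Q (case_nat y e))" using assms S1_def D1_def by auto
  obtain R where R: "D0 R" "\<And>e. \<not> P (e 0) \<longleftrightarrow> (\<exists>y. R (case_nat y e))" using assms S1_def D1_def by auto
  have P: "P x \<longleftrightarrow> (\<exists>y. Q (case_nat y (\<lambda>_. x)))" "\<not> P x \<longleftrightarrow> (\<exists>y. R (case_nat y (\<lambda>_. x)))" for x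
    using Q(2)[of "\<lambda>_. x"] R(2)[of "\<lambda>_. x"] by simp_all
  have "D0 (\<lambda>e. Q (case_nat (e 0) (\<lambda>_. e (Suc 0))))" "D0 (\<lambda>e. R (case_nat (e 0) (\<lambda>_. e (Suc 0))))"
    by (rule D0_reindex[OF Q(1), of _ "case_nat 0 (\<lambda>_. Suc 0)"] D0_reindex[OF R(1), of _ "case_nat 0 (\<lambda>_. Suc 0)"],
        auto split: nat.splits)+
  from comprehension0[OF this] show ?thesis unfolding P(1)[symmetric] P(2)[symmetric] by blast
qed

text \<open>Collection from induction on \<open>n\<close>: with the common bound \<open>z\<close> as
  the unbounded witness, the claim for all \<open>x\<close> below \<open>n\<close> is
  Sigma01.\<close>

lemma D0_collection:
  assumes "D0 (\<lambda>e. Q (e 0) (e (Suc 0)))" "\<And>x. x \<^bold>< t \<Longrightarrow> \<exists>y. Q y x"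
  shows "\<exists>z. \<forall>x. x \<^bold>< t \<longrightarrow> (\<exists>y. y \<^bold>< z \<and> Q y x)"
proof -
  have "\<exists>z. n \<^bold>\<le> t \<longrightarrow> (\<forall>x. x \<^bold>< n \<longrightarrow> (\<exists>y. y \<^bold>< z \<and> Q y x))" for n
  proof (rule S1_induct[of "\<lambda>n. \<exists>z. n \<^bold>\<le> t \<longrightarrow> (\<forall>x. x \<^bold>< n \<longrightarrow> (\<exists>y. y \<^bold>< z \<and> Q y x))"])
    have "D0 (\<lambda>e. e (Suc 0) \<^bold>\<le> t \<longrightarrow> (\<forall>x. x \<^bold>< e (Suc 0) \<longrightarrow> (\<exists>y. y \<^bold>< e 0 \<and> Q y x)))"
      unfolding le_M_def by (rule D0_intros assms(1))+
    then show "S1 (\<lambda>e. \<exists>z. e 0 \<^bold>\<le> t \<longrightarrow> (\<forall>x. x \<^bold>< e 0 \<longrightarrow> (\<exists>y. y \<^bold>< z \<and> Q y x)))"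
      by (intro S1_ex S1_D0)
    fix n
    assume "\<exists>z. n \<^bold>\<le> t \<longrightarrow> (\<forall>x. x \<^bold>< n \<longrightarrow> (\<exists>y. y \<^bold>< z \<and> Q y x))"
    then obtain z where z: "n \<^bold>\<le> t \<Longrightarrow> x \<^bold>< n \<Longrightarrow> \<exists>y. y \<^bold>< z \<and> Q y x" for x by blast
    show "\<exists>z. suc_M n \<^bold>\<le> t \<longrightarrow> (\<forall>x. x \<^bold>< suc_M n \<longrightarrow> (\<exists>y. y \<^bold>< z \<and> Q y x))"
    proof (cases "suc_M n \<^bold>\<le> t")
      case True
      then have "n \<^bold>< t" by (simp add: suc_le_iff)
      then obtain y0 where y0: "Q y0 n" using assms(2) by blast
      have "\<exists>y. y \<^bold>< z \<^bold>+ suc_M y0 \<and> Q y x" if x: "x \<^bold>< suc_M n" for x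
      proof (cases "x = n")
        case True
        then show ?thesis using y0 by (intro exI[of _ y0]) (simp add: add_suc less_suc_le)
      next
        case False
        then obtain y where "y \<^bold>< z" "Q y x" using z[of x] x \<open>n \<^bold>< t\<close> by (auto simp: less_suc le_M_def)
        then show ?thesis using less_le_trans[OF _ le_add1] by blast
      qed
      then show ?thesis by blast
    qed blast
  qed simp
  from this[of t] show ?thesis by simp
qed

lemma S1_ball:
  assumes "F1 t" "S1 (\<lambda>e. P (e 0) (\<lambda>i. e (Suc i)))"
  shows "S1 (\<lambda>e. \<forall>x. x \<^bold>< t e \<longrightarrow> P x e)"
proof (rule S1_subst[OF assms(1)])
  obtain Q where Q: "D0 Q" "\<And>e. P (e 0) (\<lambda>i. e (Suc i)) \<longleftrightarrow> (\<exists>y. Q (case_nat y e))"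
    using assms(2) S1_def by auto
  have P: "P x e \<longleftrightarrow> (\<exists>y. Q (case_nat y (case_nat x e)))" for x e
    using Q(2)[of "case_nat x e"] by simp
  have D: "D0 (\<lambda>e. \<forall>x. x \<^bold>< e (Suc 0) \<longrightarrow> (\<exists>y. y \<^bold>< e 0 \<and> Q (case_nat y (case_nat x (\<lambda>i. e (Suc (Suc i)))))))"
    by (rule D0_intros D0_reindex[OF Q(1), of _ "case_nat 0 (case_nat (Suc 0) (\<lambda>i. Suc (Suc (Suc (Suc i)))))"])+
       (auto split: nat.splits)
  have "(\<forall>x. x \<^bold>< t \<longrightarrow> P x e) \<longleftrightarrow> (\<exists>z. \<forall>x. x \<^bold>< t \<longrightarrow> (\<exists>y. y \<^bold>< z \<and> Q (case_nat y (case_nat x e))))" for e t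
  proof
    assume *: "\<forall>x. x \<^bold>< t \<longrightarrow> P x e"
    obtain c :: "nat \<Rightarrow> 'm" and q v where q: "bounded_fm q" "range v \<subseteq> l2_sets M" "\<And>e. Q e \<longleftrightarrow> arith_sat M v (mix e c) q"
      using Q(1) D0_def by auto
    \<comment> \<open>Collection is stated for two variables, so the remaining assignment
      \<open>e\<close> is turned into parameters: the index map sends its entries into the odd half,
      next to those of \<open>c\<close>.\<close>
    have "D0 (\<lambda>e'. Q (case_nat (e' 0) (case_nat (e' (Suc 0)) e)))"
    proof -
      have "mix (case_nat (e' 0) (case_nat (e' (Suc 0)) e)) c = mix e' (mix e c) \<circ>
        (\<lambda>i. if i = 0 then 0 else if i = 2 then 2 else if even i then Suc (2 * (i - 4)) else Suc (2 * i))" for e'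
      proof
        show "mix (case_nat (e' 0) (case_nat (e' (Suc 0)) e)) c i = (mix e' (mix e c) \<circ>
          (\<lambda>i. if i = 0 then 0 else if i = 2 then 2 else if even i then Suc (2 * (i - 4)) else Suc (2 * i))) i" for i
        proof (cases rule: mix_cases[of i])
          case (1 j)
          consider "j = 0" | "j = 1" | k where "j = Suc (Suc k)" by (metis One_nat_def old.nat.exhaust)
          then show ?thesis by cases (auto simp: mix_def 1)
        next
          case (2 j)
          then show ?thesis by (auto simp: mix_def)
        qed
      qed
      then show ?thesis unfolding D0_def q(3)
        by (intro exI[of _ "fm_rename (\<lambda>i. if i = 0 then 0 else if i = 2 then 2 else if even i then Suc (2 * (i - 4)) else Suc (2 * i)) (\<lambda>i. i) q"]
            exI[of _ v] exI[of _ "mix e c"]) (simp add: q(1,2) comp_def[of v])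
    qed
    from D0_collection[OF this, of t] *
    show "\<exists>z. \<forall>x. x \<^bold>< t \<longrightarrow> (\<exists>y. y \<^bold>< z \<and> Q (case_nat y (case_nat x e)))" unfolding P by blast
  qed (use P in blast)
  then show "S1 (\<lambda>e. \<forall>x. x \<^bold>< e 0 \<longrightarrow> P x (\<lambda>i. e (Suc i)))"
    by (intro S1I[OF D]) simp
qed

lemma S1_bex:
  assumes "F1 t" "S1 (\<lambda>e. P (e 0) (\<lambda>i. e (Suc i)))"
  shows "S1 (\<lambda>e. \<exists>x. x \<^bold>< t e \<and> P x e)"
  by (intro S1_ex S1_conj assms(2) D1_imp_S1[OF D1_less] F1_var F1_rename[OF assms(1)])

lemma D1_ball:
  assumes "F1 t" "D1 (\<lambda>e. P (e 0) (\<lambda>i. e (Suc i)))"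
  shows "D1 (\<lambda>e. \<forall>x. x \<^bold>< t e \<longrightarrow> P x e)"
  using assms S1_ball[of t P] S1_bex[of t "\<lambda>x e. \<not> P x e"] unfolding D1_def by simp

lemma D1_bex:
  assumes "F1 t" "D1 (\<lambda>e. P (e 0) (\<lambda>i. e (Suc i)))"
  shows "D1 (\<lambda>e. \<exists>x. x \<^bold>< t e \<and> P x e)"
  using assms S1_bex[of t P] S1_ball[of t "\<lambda>x e. \<not> P x e"] unfolding D1_def by simp

lemma D1_ball_le:
  assumes "F1 t" "D1 (\<lambda>e. P (e 0) (\<lambda>i. e (Suc i)))"
  shows "D1 (\<lambda>e. \<forall>x. x \<^bold>\<le> t e \<longrightarrow> P x e)"
  using D1_ball[OF F1_suc[OF assms(1)] assms(2)] by (simp add: less_suc_le)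

lemma D1_bex_le:
  assumes "F1 t" "D1 (\<lambda>e. P (e 0) (\<lambda>i. e (Suc i)))"
  shows "D1 (\<lambda>e. \<exists>x. x \<^bold>\<le> t e \<and> P x e)"
  using D1_bex[OF F1_suc[OF assms(1)] assms(2)] by (simp add: less_suc_le)

end

text \<open>Resolving repeatedly with these rules shows a predicate to be Delta01 by following its
  syntax. This is why later definitions spell out bounds on their quantifiers.\<close>

named_theorems definable

lemmas (in rca_structure) [definable] =
  F1_const F1_var F1_suc F1_times F1_plus
  D1_mem D1_le D1_less D1_eq D1_not D1_conj D1_disj D1_iff D1_imp D1_ball D1_bex D1_ball_le D1_bex_le

lemmas (in rca_structure) S1_intros = S1_conj S1_disj S1_ball S1_ex S1_imp

context rca_structure
begin

section \<open>Induction, bounding and division\<close>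

lemma strong_induct [consumes 1, case_names less]:
  assumes "S1 (\<lambda>e. P (e 0))" "\<And>n. (\<And>m. m \<^bold>< n \<Longrightarrow> P m) \<Longrightarrow> P n"
  shows "P n"
proof -
  have "S1 (\<lambda>e. \<forall>m. m \<^bold>< e 0 \<longrightarrow> P m)"
    by (rule S1_ball F1_var assms(1))+
  then have "\<forall>m. m \<^bold>< suc_M n \<longrightarrow> P m"
  proof (induction rule: S1_induct)
    case (suc x)
    then show ?case using assms(2) by (metis less_suc)
  qed simp
  then show ?thesis by simp
qed

lemma Pi_least:
  assumes "S1 (\<lambda>e. \<not> P (e 0))" "P x"
  shows "\<exists>x. P x \<and> (\<forall>y. y \<^bold>< x \<longrightarrow> \<not> P y)"
proof (rule ccontr)
  assume *: "\<not> ?thesis"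
  have "\<not> P n" for n
    using assms(1) by (induction n rule: strong_induct) (use * in blast)
  then show False using assms(2) by blast
qed

text \<open>The negation is Pi01, so strong induction does not apply to it. Instead, without a least
  solution each solution has a smaller one, and Sigma01 induction on \<open>n\<close> yields a
  solution \<open>y\<close> with \<open>y + n\<close> at most \<open>x\<close>; this fails at
  \<open>n = x + 1\<close>.\<close>

lemma S1_least:
  assumes "S1 (\<lambda>e. P (e 0))" "P x"
  shows "\<exists>x. P x \<and> (\<forall>y. y \<^bold>< x \<longrightarrow> \<not> P y)"
proof (rule ccontr)
  assume *: "\<not> ?thesis"
  have "S1 (\<lambda>e. \<exists>y. y \<^bold>+ e 0 \<^bold>\<le> x \<and> P y)"
    by (rule S1_ex S1_conj D1_imp_S1[OF D1_le] F1_plus F1_var F1_const S1_rename[OF assms(1), of "\<lambda>_. 0", simplified])+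
  then have "\<exists>y. y \<^bold>+ suc_M x \<^bold>\<le> x \<and> P y"
  proof (induction rule: S1_induct)
    case zero
    then show ?case using assms(2) by (intro exI[of _ x]) simp
  next
    case (suc n)
    then obtain y where y: "y \<^bold>+ n \<^bold>\<le> x" "P y" by blast
    with * obtain z where z: "z \<^bold>< y" "P z" by blast
    then have "suc_M z \<^bold>+ n \<^bold>\<le> x" using y(1) by (meson add_le_cancel_right order_trans suc_le_iff)
    then show ?case using z by (intro exI[of _ z]) (simp add: add_suc suc_add)
  qed
  then show False
    by (metis add_suc le_add2 less_self_suc not_less order_trans)
qed

lemma D1_least:
  assumes "D1 (\<lambda>e. P (e 0))" "P x"
  shows "\<exists>x. P x \<and> (\<forall>y. y \<^bold>< x \<longrightarrow> \<not> P y)"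
  by (rule S1_least[OF D1_imp_S1]) fact+

text \<open>The induction of \<open>D0_collection\<close>, now available for Sigma01 predicates
  because these are closed under bounded quantification.\<close>

lemma bounding:
  assumes P: "S1 (\<lambda>e. P (e 0) (e (Suc 0)))" and ex: "\<And>x. x \<^bold>< t \<Longrightarrow> \<exists>y. P x y"
  shows "\<exists>z. \<forall>x. x \<^bold>< t \<longrightarrow> (\<exists>y. y \<^bold>< z \<and> P x y)"
proof -
  have "S1 (\<lambda>e. \<exists>z. e 0 \<^bold>\<le> t \<longrightarrow> (\<forall>x. x \<^bold>< e 0 \<longrightarrow> (\<exists>y. y \<^bold>< z \<and> P x y)))"
    by (rule S1_ex S1_imp S1_ball S1_conj D1_le D1_imp_S1[OF D1_less] F1_var F1_const
        S1_rename[OF P, of "case_nat (Suc 0) (\<lambda>_. 0)", simplified])+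
  then have "\<exists>z. t \<^bold>\<le> t \<longrightarrow> (\<forall>x. x \<^bold>< t \<longrightarrow> (\<exists>y. y \<^bold>< z \<and> P x y))"
  proof (induction rule: S1_induct)
    case (suc n)
    then obtain z where z: "n \<^bold>\<le> t \<Longrightarrow> x \<^bold>< n \<Longrightarrow> \<exists>y. y \<^bold>< z \<and> P x y" for x by blast
    show ?case
    proof (cases "suc_M n \<^bold>\<le> t")
      case True
      then have "n \<^bold>< t" by (simp add: suc_le_iff)
      then obtain y0 where y0: "P n y0" using ex by blast
      have "\<exists>y. y \<^bold>< z \<^bold>+ suc_M y0 \<and> P x y" if x: "x \<^bold>< suc_M n" for x
      proof (cases "x = n")
        case True
        then show ?thesis using y0 by (intro exI[of _ y0]) (simp add: add_suc less_suc_le)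
      next
        case False
        then obtain y where "y \<^bold>< z" "P x y" using z[of x] x \<open>n \<^bold>< t\<close> by (auto simp: less_suc le_M_def)
        then show ?thesis using less_le_trans[OF _ le_add1] by blast
      qed
      then show ?thesis by blast
    qed blast
  qed simp
  then show ?thesis by simp
qed

lemma division: "d \<noteq> \<^bold>0 \<Longrightarrow> \<exists>q r. r \<^bold>< d \<and> a = d \<^bold>* q \<^bold>+ r"
proof -
  assume d: "d \<noteq> \<^bold>0"
  have "S1 (\<lambda>e. \<exists>q r. r \<^bold>< d \<and> e 0 = d \<^bold>* q \<^bold>+ r)"
    by (rule S1_intros D1_imp_S1 definable)+
  then show ?thesis
  proof (induction rule: S1_induct)
    case zero
    show ?case using d by (intro exI[of _ "\<^bold>0"]) (simp add: zero_less_iff)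
  next
    case (suc x)
    then obtain q r where qr: "r \<^bold>< d" "x = d \<^bold>* q \<^bold>+ r" by blast
    show ?case
    proof (cases "suc_M r = d")
      case True
      then have "suc_M x = d \<^bold>* suc_M q \<^bold>+ \<^bold>0" by (metis qr(2) add_suc add_zero mult_suc)
      then show ?thesis using d zero_less_iff by blast
    next
      case False
      then have "suc_M r \<^bold>< d" using qr(1) suc_le_iff[of r d] by (simp add: le_M_def)
      then show ?thesis using qr(2) by (metis add_suc)
    qed
  qed
qed

definition dvd_M (infix "\<^bold>|" 50) where "a \<^bold>| b \<longleftrightarrow> (\<exists>k. b = a \<^bold>* k)"

lemma dvd_self [simp]: "a \<^bold>| a"
  and dvd_zero [simp]: "a \<^bold>| \<^bold>0"
  and one_dvd [simp]: "\<^bold>1 \<^bold>| a"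
  and dvd_mult_left [simp]: "a \<^bold>| a \<^bold>* b"
  and dvd_mult_right [simp]: "a \<^bold>| b \<^bold>* a"
  unfolding dvd_M_def by (metis mult_one mult_zero mult_commute)+

lemma zero_dvd [simp]: "\<^bold>0 \<^bold>| a \<longleftrightarrow> a = \<^bold>0"
  by (auto simp: dvd_M_def)

lemma dvd_trans: "a \<^bold>| b \<Longrightarrow> b \<^bold>| c \<Longrightarrow> a \<^bold>| c"
  unfolding dvd_M_def by (metis mult_assoc)

lemma dvd_mult: "a \<^bold>| b \<Longrightarrow> a \<^bold>| c \<^bold>* b" and dvd_mult2: "a \<^bold>| b \<Longrightarrow> a \<^bold>| b \<^bold>* c"
  using dvd_trans dvd_mult_left dvd_mult_right by blast+

lemma mult_dvd_mono: "a \<^bold>| b \<Longrightarrow> c \<^bold>| d \<Longrightarrow> a \<^bold>* c \<^bold>| b \<^bold>* d"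
  unfolding dvd_M_def by (metis mult_assoc mult_left_commute)

lemma dvd_le: "a \<^bold>| b \<Longrightarrow> b \<noteq> \<^bold>0 \<Longrightarrow> a \<^bold>\<le> b"
  unfolding dvd_M_def using le_mult mult_zero by metis

lemma dvd_add_cancel: "a \<^bold>| b \<^bold>+ c \<Longrightarrow> a \<^bold>| b \<Longrightarrow> a \<^bold>| c"
proof -
  assume "a \<^bold>| b \<^bold>+ c" "a \<^bold>| b"
  then obtain k l where kl: "b \<^bold>+ c = a \<^bold>* l" "b = a \<^bold>* k" unfolding dvd_M_def by blast
  show ?thesis
  proof (cases "k \<^bold>\<le> l")
    case True
    then obtain j where "l = k \<^bold>+ j" using le_iff_add by blast
    then have "c = a \<^bold>* j" using kl by (simp add: distrib_left)
    then show ?thesis by simp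
  next
    case False
    then have "l \<^bold>\<le> k" by simp
    then have "b \<^bold>+ c \<^bold>\<le> b" using kl mult_le_mono[of a a l k] by simp
    then have "c = \<^bold>0" using le_iff_add by (metis add_assoc add_eq_self add_eq_zero)
    then show ?thesis by simp
  qed
qed

lemma dvd_one [simp]: "a \<^bold>| \<^bold>1 \<longleftrightarrow> a = \<^bold>1"
  by (metis dvd_le dvd_self le_zero less_one one_not_zero(1) dvd_M_def le_M_def mult_eq_zero)

lemma D1_dvd: "F1 s \<Longrightarrow> F1 t \<Longrightarrow> D1 (\<lambda>e. s e \<^bold>| t e)"
proof (erule (1) D1_subst2)
  have "a \<^bold>| b \<longleftrightarrow> (\<exists>k. k \<^bold>\<le> b \<and> b = a \<^bold>* k)" for a b
    unfolding dvd_M_def using le_mult[of a] by (metis mult_commute mult_eq_zero zero_le)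
  then show "D1 (\<lambda>e. e 0 \<^bold>| e (Suc 0))" by simp (rule definable)+
qed

lemmas [definable] = D1_dvd

text \<open>Takes the role of the factorial, as no recursion is available yet.\<close>

lemma common_multiple: "\<exists>d. d \<noteq> \<^bold>0 \<and> (\<forall>k. k \<^bold>\<le> n \<longrightarrow> k \<noteq> \<^bold>0 \<longrightarrow> k \<^bold>| d)"
proof -
  have "S1 (\<lambda>e. \<exists>d. d \<noteq> \<^bold>0 \<and> (\<forall>k. k \<^bold>\<le> e 0 \<longrightarrow> k \<noteq> \<^bold>0 \<longrightarrow> k \<^bold>| d))"
    by (rule S1_ex D1_imp_S1 definable)+
  then show ?thesis
  proof (induction rule: S1_induct)
    case zero
    show ?case by (intro exI[of _ "\<^bold>1"]) simp
  next
    case (suc x)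
    then obtain d where d: "d \<noteq> \<^bold>0" "\<And>k. k \<^bold>\<le> x \<Longrightarrow> k \<noteq> \<^bold>0 \<Longrightarrow> k \<^bold>| d" by blast
    show ?case
      by (rule exI[of _ "d \<^bold>* suc_M x"]) (use d in \<open>auto simp: le_M_def[of _ "suc_M x"] less_suc_le intro: dvd_mult2\<close>)
  qed
qed

text \<open>With \<open>P\<close> merely Sigma01, being a common multiple is Pi01, so a least one
  comes from \<open>Pi_least\<close>. It divides any other because a nonzero remainder would be a
  smaller common multiple.\<close>

lemma least_common_multiple:
  assumes "S1 (\<lambda>e. P (e 0))" "\<And>k. P k \<Longrightarrow> k \<noteq> \<^bold>0"
  shows "\<exists>L. L \<noteq> \<^bold>0 \<and> (\<forall>k. k \<^bold>< m \<longrightarrow> P k \<longrightarrow> k \<^bold>| L) \<and> (\<forall>x. (\<forall>k. k \<^bold>< m \<longrightarrow> P k \<longrightarrow> k \<^bold>| x) \<longrightarrow> L \<^bold>| x)"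
proof -
  let ?C = "\<lambda>x. x \<noteq> \<^bold>0 \<and> (\<forall>k. k \<^bold>< m \<longrightarrow> P k \<longrightarrow> k \<^bold>| x)"
  have *: "(\<not> ?C x) \<longleftrightarrow> (x = \<^bold>0 \<or> (\<exists>k. k \<^bold>< m \<and> P k \<and> \<not> k \<^bold>| x))" for x by blast
  have "S1 (\<lambda>e. \<not> ?C (e 0))"
    unfolding * by (rule assms(1) S1_intros S1_bex D1_imp_S1 definable)+
  moreover obtain d where "d \<noteq> \<^bold>0" "\<And>k. k \<^bold>\<le> m \<Longrightarrow> k \<noteq> \<^bold>0 \<Longrightarrow> k \<^bold>| d" using common_multiple[of m] by blast
  then have "?C d" using assms(2) by auto
  ultimately obtain L where L: "?C L" "\<And>y. y \<^bold>< L \<Longrightarrow> \<not> ?C y" using Pi_least[of ?C] by blast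
  have "L \<^bold>| x" if x: "\<And>k. k \<^bold>< m \<Longrightarrow> P k \<Longrightarrow> k \<^bold>| x" for x
  proof -
    obtain q r where qr: "r \<^bold>< L" "x = L \<^bold>* q \<^bold>+ r" using division L(1) by blast
    have "k \<^bold>| r" if "k \<^bold>< m" "P k" for k
      using x[OF that] that L(1) unfolding qr(2) by (meson dvd_add_cancel dvd_mult2)
    then have "r = \<^bold>0" using L(2) qr(1) by blast
    then show ?thesis using qr(2) by simp
  qed
  then show ?thesis using L(1) by blast
qed

section \<open>Prime numbers\<close>

definition prime_M where "prime_M p \<longleftrightarrow> \<^bold>1 \<^bold>< p \<and> (\<forall>d. d \<^bold>\<le> p \<longrightarrow> d \<^bold>| p \<longrightarrow> d = \<^bold>1 \<or> d = p)"

lemma D1_prime: "F1 t \<Longrightarrow> D1 (\<lambda>e. prime_M (t e))"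
  by (erule D1_subst1) (unfold prime_M_def, (rule definable)+)

lemmas [definable] = D1_prime

lemma prime_dvd: "prime_M p \<Longrightarrow> d \<^bold>| p \<Longrightarrow> d = \<^bold>1 \<or> d = p"
  unfolding prime_M_def using dvd_le not_less_zero by blast

lemma prime_not_zero: "prime_M p \<Longrightarrow> p \<noteq> \<^bold>0"
  by (auto simp: prime_M_def)

lemma prime_not_one: "prime_M p \<Longrightarrow> p \<noteq> \<^bold>1"
  by (auto simp: prime_M_def)

lemma prime_divisor:
  assumes "\<^bold>1 \<^bold>< n" shows "\<exists>p. prime_M p \<and> p \<^bold>| n"
proof -
  have "D1 (\<lambda>e. \<^bold>1 \<^bold>< e 0 \<and> e 0 \<^bold>| n)" by (rule definable)+
  from D1_least[OF this, of n] assms obtain p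
    where p: "\<^bold>1 \<^bold>< p" "p \<^bold>| n" "\<And>d. d \<^bold>< p \<Longrightarrow> \<not> (\<^bold>1 \<^bold>< d \<and> d \<^bold>| n)" by auto
  have "d = \<^bold>1 \<or> d = p" if "d \<^bold>| p" "d \<^bold>\<le> p" for d
  proof -
    have "d \<noteq> \<^bold>0" using that p(1) by auto
    moreover have "d \<^bold>| n" using that p(2) dvd_trans by blast
    ultimately show ?thesis using p(3) that(2) by (metis less_one le_M_def not_le)
  qed
  then show ?thesis using p(1,2) unfolding prime_M_def by blast
qed

text \<open>Euclid's lemma without Bezout, as there are no negative numbers: by division with
  remainder, the least positive \<open>c\<close> with \<open>p\<close> dividing \<open>c * b\<close>
  divides every \<open>x\<close> with that property, in particular \<open>p\<close> and
  \<open>a\<close>.\<close>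

lemma prime_dvd_mult:
  assumes "prime_M p" "p \<^bold>| a \<^bold>* b" shows "p \<^bold>| a \<or> p \<^bold>| b"
proof (cases "p \<^bold>| a")
  case False
  have "D1 (\<lambda>e. e 0 \<noteq> \<^bold>0 \<and> p \<^bold>| e 0 \<^bold>* b)" by (rule definable)+
  from D1_least[OF this, of p] obtain c where c: "c \<noteq> \<^bold>0" "p \<^bold>| c \<^bold>* b"
    "\<And>y. y \<^bold>< c \<Longrightarrow> \<not> (y \<noteq> \<^bold>0 \<and> p \<^bold>| y \<^bold>* b)" using prime_not_zero[OF assms(1)] by auto
  have dvd: "c \<^bold>| x" if "p \<^bold>| x \<^bold>* b" for x
  proof -
    obtain q r where qr: "r \<^bold>< c" "x = c \<^bold>* q \<^bold>+ r" using division c(1) by blast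
    have "x \<^bold>* b = q \<^bold>* (c \<^bold>* b) \<^bold>+ r \<^bold>* b" by (simp add: qr(2) semiring_ac)
    then have "p \<^bold>| r \<^bold>* b" using that c(2) by (metis dvd_add_cancel dvd_mult)
    then have "r = \<^bold>0" using c(3) qr(1) by blast
    then show ?thesis using qr(2) by simp
  qed
  have "c = \<^bold>1 \<or> c = p" using dvd[of p] prime_dvd[OF assms(1)] by simp
  then show ?thesis using dvd[OF assms(2)] False c(2) by auto
qed simp

lemma primes_unbounded: "\<exists>p. prime_M p \<and> n \<^bold>< p"
proof -
  obtain d where d: "d \<noteq> \<^bold>0" "\<And>k. k \<^bold>\<le> n \<Longrightarrow> k \<noteq> \<^bold>0 \<Longrightarrow> k \<^bold>| d" using common_multiple by blast
  have "\<^bold>1 \<^bold>< suc_M d" using d(1) suc_less_suc[of "\<^bold>0" d] by (simp add: zero_less_iff)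
  then obtain p where p: "prime_M p" "p \<^bold>| suc_M d" using prime_divisor by blast
  have "\<not> p \<^bold>\<le> n"
  proof
    assume "p \<^bold>\<le> n"
    then have "p \<^bold>| d" using d(2) prime_not_zero p(1) by blast
    then have "p \<^bold>| \<^bold>1" using p(2) dvd_add_cancel[of p d "\<^bold>1"] by (simp add: suc_eq)
    then show False using p(1) prime_not_one by simp
  qed
  then show ?thesis using p(1) by auto
qed

text \<open>If \<open>P p\<close> failed, cancelling \<open>p\<close> from \<open>L\<close> would
  leave a number still divisible by all \<open>k\<close> with \<open>P k\<close>, these being primes
  other than \<open>p\<close>; then \<open>L\<close> would divide a smaller nonzero number.\<close>

lemma prime_dvd_lcm:
  assumes L: "L \<noteq> \<^bold>0" "\<And>k. P k \<Longrightarrow> k \<^bold>| L" "\<And>x. (\<And>k. P k \<Longrightarrow> k \<^bold>| x) \<Longrightarrow> L \<^bold>| x"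
    and prime: "\<And>k. P k \<Longrightarrow> prime_M k" and p: "prime_M p" "p \<^bold>| L"
  shows "P p"
proof (rule ccontr)
  assume "\<not> P p"
  obtain x where x: "L = p \<^bold>* x" using p(2) dvd_M_def by auto
  have "k \<^bold>| x" if "P k" for k
    using prime_dvd_mult[OF prime[OF that], of p x] L(2)[OF that] x prime_dvd[OF p(1), of k]
      prime_not_one[OF prime[OF that]] that \<open>\<not> P p\<close> by auto
  then have "L \<^bold>| x" using L(3) by blast
  moreover have "x \<noteq> \<^bold>0" using L(1) x by auto
  ultimately have "p \<^bold>* x \<^bold>\<le> x" using dvd_le x by blast
  moreover have "\<^bold>1 \<^bold>* x \<^bold>< p \<^bold>* x" using mult_less_mono[of "\<^bold>1" p x] p(1) \<open>x \<noteq> \<^bold>0\<close> by (simp add: prime_M_def)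
  ultimately show False by simp
qed

section \<open>Pairs\<close>

abbreviation pair_M where "pair_M m n \<equiv> l2_pair M m n"

text \<open>With \<open>s = m + n\<close>, the code lies between s^2 and s^2 + s, hence below (s +
  1)^2; so it determines \<open>s\<close> and then \<open>m\<close>.\<close>

lemma pair_inject [simp]: "pair_M m n = pair_M m' n' \<longleftrightarrow> m = m' \<and> n = n'"
proof -
  have less: "s \<^bold>* s \<^bold>+ m \<^bold>< t \<^bold>* t \<^bold>+ k" if "s \<^bold>< t" "m \<^bold>\<le> s" for s t m k
  proof -
    have "s \<^bold>* s \<^bold>+ m \<^bold>\<le> s \<^bold>* s \<^bold>+ s" using that by simp
    also have "\<dots> \<^bold>< suc_M s \<^bold>* suc_M s" by (simp add: suc_mult mult_suc add_suc less_suc_le)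
    also have "\<dots> \<^bold>\<le> t \<^bold>* t" using that by (simp add: mult_le_mono suc_le_iff)
    also have "\<dots> \<^bold>\<le> t \<^bold>* t \<^bold>+ k" by simp
    finally show ?thesis .
  qed
  show ?thesis
    using less[of "m \<^bold>+ n" "m' \<^bold>+ n'" m m'] less[of "m' \<^bold>+ n'" "m \<^bold>+ n" m' m]
      less_or_eq_or_greater[of "m \<^bold>+ n" "m' \<^bold>+ n'"] unfolding l2_pair_def by auto
qed

lemma F1_pair: "F1 s \<Longrightarrow> F1 t \<Longrightarrow> F1 (\<lambda>e. pair_M (s e) (t e))"
  unfolding l2_pair_def by (intro F1_plus F1_times)

lemma fst_le_pair [simp]: "m \<^bold>\<le> pair_M m n" by (simp add: l2_pair_def)

lemma snd_le_pair [simp]: "n \<^bold>\<le> pair_M m n"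
proof -
  have "m \<^bold>+ n \<^bold>\<le> (m \<^bold>+ n) \<^bold>* (m \<^bold>+ n)" using le_mult by (cases "m \<^bold>+ n = \<^bold>0") auto
  then show ?thesis unfolding l2_pair_def by (meson le_add1 le_add2 order_trans)
qed

lemma pair_mono: "m \<^bold>\<le> m' \<Longrightarrow> n \<^bold>\<le> n' \<Longrightarrow> pair_M m n \<^bold>\<le> pair_M m' n'"
  unfolding l2_pair_def by (intro add_le_mono mult_le_mono)

text \<open>Not every number is a pair; the default 0 makes the projections total, as
  \<open>F1\<close> requires.\<close>

definition fst_M where "fst_M z = (if \<exists>m n. z = pair_M m n then SOME m. \<exists>n. z = pair_M m n else \<^bold>0)"
definition snd_M where "snd_M z = (if \<exists>m n. z = pair_M m n then SOME n. \<exists>m. z = pair_M m n else \<^bold>0)"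

lemma fst_pair [simp]: "fst_M (pair_M m n) = m" and snd_pair [simp]: "snd_M (pair_M m n) = n"
  by (auto simp: fst_M_def snd_M_def)

text \<open>Components do not exceed the code, so the search for them can be bounded and the graph
  is definable.\<close>

lemma fst_eq_iff: "x = fst_M z \<longleftrightarrow> (\<exists>n. n \<^bold>\<le> z \<and> z = pair_M x n) \<or>
    (\<not> (\<exists>m. m \<^bold>\<le> z \<and> (\<exists>n. n \<^bold>\<le> z \<and> z = pair_M m n)) \<and> x = \<^bold>0)"
proof (cases "\<exists>m n. z = pair_M m n")
  case True
  then obtain m n where "z = pair_M m n" by blast
  moreover have "m \<^bold>\<le> pair_M m n" "n \<^bold>\<le> pair_M m n" by simp_all
  ultimately show ?thesis by auto
next
  case False
  then show ?thesis by (auto simp: fst_M_def)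
qed

lemma snd_eq_iff: "x = snd_M z \<longleftrightarrow> (\<exists>m. m \<^bold>\<le> z \<and> z = pair_M m x) \<or>
    (\<not> (\<exists>m. m \<^bold>\<le> z \<and> (\<exists>n. n \<^bold>\<le> z \<and> z = pair_M m n)) \<and> x = \<^bold>0)"
proof (cases "\<exists>m n. z = pair_M m n")
  case True
  then obtain m n where "z = pair_M m n" by blast
  moreover have "m \<^bold>\<le> pair_M m n" "n \<^bold>\<le> pair_M m n" by simp_all
  ultimately show ?thesis by auto
next
  case False
  then show ?thesis by (auto simp: snd_M_def)
qed

lemmas [definable] = F1_pair

lemma F1_fst: "F1 t \<Longrightarrow> F1 (\<lambda>e. fst_M (t e))"
  by (erule F1_subst1) (unfold F1_def fst_eq_iff, rule D1_imp_S1, (rule definable)+)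

lemma F1_snd: "F1 t \<Longrightarrow> F1 (\<lambda>e. snd_M (t e))"
  by (erule F1_subst1) (unfold F1_def snd_eq_iff, rule D1_imp_S1, (rule definable)+)

lemmas [definable] = F1_fst F1_snd

lemma fst_le: "fst_M z \<^bold>\<le> z"
  by (cases "\<exists>m n. z = pair_M m n") (auto, simp add: fst_M_def)

lemma graph_in_sets:
  assumes "F1 (\<lambda>e. f (e 0))" shows "{pair_M i (f i) | i. True} \<in> l2_sets M"
proof -
  have "{pair_M i (f i) | i. True} = {z. \<exists>i. i \<^bold>\<le> z \<and> z = pair_M i (f i)}" by auto
  moreover have "D1 (\<lambda>e. \<exists>i. i \<^bold>\<le> e 0 \<and> e 0 = pair_M i (f i))"
    by (rule definable F1_subst1[OF F1_var assms])+
  ultimately show ?thesis using comprehension by simp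
qed

lemma F1_graph:
  assumes "{pair_M i (f i) | i. True} \<in> l2_sets M" "F1 t" shows "F1 (\<lambda>e. f (t e))"
proof (rule F1_subst1[OF assms(2)])
  have "x = f i \<longleftrightarrow> pair_M i x \<in> {pair_M i (f i) | i. True}" for x i by auto
  then show "F1 (\<lambda>e. f (e 0))" unfolding F1_def
    by (simp only:) (rule D1_imp_S1 definable assms(1))+
qed

section \<open>Finite sets coded by divisibility, and iteration\<close>

text \<open>The moduli \<open>1 + (i + 1) d\<close> for \<open>i < b\<close> are pairwise coprime when \<open>d\<close> is divisible by all
  positive numbers up to \<open>b\<close>.\<close>

definition mem_code where "mem_code c d i \<longleftrightarrow> suc_M (suc_M i \<^bold>* d) \<^bold>| c"

lemma D1_mem_code: "F1 c \<Longrightarrow> F1 d \<Longrightarrow> F1 i \<Longrightarrow> D1 (\<lambda>e. mem_code (c e) (d e) (i e))"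
  unfolding mem_code_def by (rule definable | assumption)+

lemmas [definable] = D1_mem_code

text \<open>Coprimality of the moduli x and y of \<open>i\<close> and \<open>k\<close>, phrased
  without subtraction: (k + 1) x and (i + 1) y differ by \<open>l\<close>, so x divides
  \<open>c * l\<close> and hence \<open>c * d\<close>; since x is 1 + (i + 1) d, it also divides
  \<open>c\<close>.\<close>

lemma modulus_dvd_mult:
  assumes "k = i \<^bold>+ l \<or> i = k \<^bold>+ l" "l \<^bold>| d" "suc_M (suc_M i \<^bold>* d) \<^bold>| c \<^bold>* suc_M (suc_M k \<^bold>* d)"
  shows "suc_M (suc_M i \<^bold>* d) \<^bold>| c"
proof -
  let ?x = "suc_M (suc_M i \<^bold>* d)" and ?y = "suc_M (suc_M k \<^bold>* d)"
  have cl: "?x \<^bold>| c \<^bold>* l"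
  proof (rule disjE[OF assms(1)])
    assume "k = i \<^bold>+ l"
    then have "c \<^bold>* suc_M k \<^bold>* ?x = suc_M i \<^bold>* (c \<^bold>* ?y) \<^bold>+ c \<^bold>* l"
      by (simp add: suc_eq semiring_ac)
    then show ?thesis using assms(3) by (metis dvd_add_cancel dvd_mult dvd_mult_right)
  next
    assume "i = k \<^bold>+ l"
    then have "suc_M i \<^bold>* (c \<^bold>* ?y) = c \<^bold>* suc_M k \<^bold>* ?x \<^bold>+ c \<^bold>* l"
      by (simp add: suc_eq semiring_ac)
    then show ?thesis using assms(3) by (metis dvd_add_cancel dvd_mult dvd_mult_right)
  qed
  have "?x \<^bold>| suc_M i \<^bold>* (c \<^bold>* d)"
    using cl assms(2) by (meson dvd_mult dvd_trans mult_dvd_mono dvd_self)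
  moreover have "c \<^bold>* ?x = suc_M i \<^bold>* (c \<^bold>* d) \<^bold>+ c" by (simp add: suc_eq semiring_ac)
  ultimately show ?thesis by (metis dvd_add_cancel dvd_mult_right)
qed

text \<open>\<open>c\<close> is the product of the moduli of the members, extended by one index at a
  time; by coprimality a new factor does not affect the other indices.\<close>

lemma code_exists:
  assumes "D1 (\<lambda>e. P (e 0))" shows "\<exists>c d. \<forall>i. i \<^bold>< b \<longrightarrow> (mem_code c d i \<longleftrightarrow> P i)"
proof -
  obtain d where d: "d \<noteq> \<^bold>0" "\<And>k. k \<^bold>\<le> b \<Longrightarrow> k \<noteq> \<^bold>0 \<Longrightarrow> k \<^bold>| d" using common_multiple by blast
  have "S1 (\<lambda>e. \<exists>c. c \<noteq> \<^bold>0 \<and> (\<forall>i. i \<^bold>< b \<longrightarrow> (mem_code c d i \<longleftrightarrow> i \<^bold>< e 0 \<and> P i)))"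
    by (rule S1_ex D1_imp_S1 definable D1_subst1[OF F1_var assms])+
  then have "\<exists>c. c \<noteq> \<^bold>0 \<and> (\<forall>i. i \<^bold>< b \<longrightarrow> (mem_code c d i \<longleftrightarrow> i \<^bold>< b \<and> P i))"
  proof (induction rule: S1_induct)
    case zero
    have "\<not> mem_code \<^bold>1 d i" for i
      using d(1) suc_inject[of "suc_M i \<^bold>* d" "\<^bold>0"] by (simp add: mem_code_def)
    then show ?case by (intro exI[of _ "\<^bold>1"]) simp
  next
    case (suc k)
    then obtain c where c: "c \<noteq> \<^bold>0" "\<And>i. i \<^bold>< b \<Longrightarrow> mem_code c d i \<longleftrightarrow> i \<^bold>< k \<and> P i" by blast
    show ?case
    proof (cases "k \<^bold>< b \<and> P k")
      case True
      have "mem_code (c \<^bold>* suc_M (suc_M k \<^bold>* d)) d i \<longleftrightarrow> i \<^bold>< suc_M k \<and> P i" if i: "i \<^bold>< b" for i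
      proof (cases "i = k")
        case True
        with \<open>k \<^bold>< b \<and> P k\<close> show ?thesis by (simp add: mem_code_def)
      next
        case False
        then obtain l where l: "k = i \<^bold>+ l \<or> i = k \<^bold>+ l" "l \<noteq> \<^bold>0"
          using le_iff_add[of i k] le_iff_add[of k i] by (metis add_zero linear)
        then have "l \<^bold>\<le> b" using i True by (metis le_add2 le_M_def order_trans)
        then have "mem_code (c \<^bold>* suc_M (suc_M k \<^bold>* d)) d i \<longleftrightarrow> mem_code c d i"
          unfolding mem_code_def using modulus_dvd_mult[OF l(1)] d(2)[OF _ l(2)] dvd_mult2 by blast
        then show ?thesis using c(2)[OF i] False by (simp add: less_suc)
      qed
      then show ?thesis using c(1) by (intro exI[of _ "c \<^bold>* suc_M (suc_M k \<^bold>* d)"]) simp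
    next
      case False
      then show ?thesis using c by (intro exI[of _ c]) (auto simp: less_suc)
    qed
  qed
  then show ?thesis by blast
qed

text \<open>Recursion by certificates: a coded finite set of pairs in which every entry up to
  position \<open>n\<close> is either the start or \<open>g\<close> of an entry one position
  earlier. Single-valuedness is not built in; induction on the position shows that any two
  certificates agree.\<close>

lemma iteration:
  assumes g: "F1 (\<lambda>e. g (e 0))"
  shows "\<exists>h. F1 (\<lambda>e. h (e 0)) \<and> h \<^bold>0 = a \<and> (\<forall>n. h (suc_M n) = g (h n))"
proof -
  define hist where "hist c d b n x \<longleftrightarrow> x \<^bold>< b \<and> mem_code c d (pair_M n x) \<and>
    (\<forall>m. m \<^bold>\<le> n \<longrightarrow> (\<forall>y. y \<^bold>< b \<longrightarrow> mem_code c d (pair_M m y) \<longrightarrow> (m = \<^bold>0 \<and> y = a) \<or>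
      (\<exists>k. k \<^bold>< m \<and> (\<exists>z. z \<^bold>< b \<and> m = suc_M k \<and> y = g z \<and> mem_code c d (pair_M k z)))))" for c d b n x
  have D: "D1 (\<lambda>e. hist (c e) (d e) (b e) (n e) (x e))" if "F1 c" "F1 d" "F1 b" "F1 n" "F1 x" for c d b n x
    unfolding hist_def by (rule definable F1_subst1[OF F1_var g] that[THEN F1_rename] that)+
  have uniq: "x = x'" if h: "hist c d b n x" "hist c' d' b' n x'" for c d b c' d' b' n x x'
  proof -
    have "D1 (\<lambda>e. e 0 \<^bold>\<le> n \<longrightarrow> (\<forall>y. y \<^bold>< b \<longrightarrow> mem_code c d (pair_M (e 0) y) \<longrightarrow>
      (\<forall>y'. y' \<^bold>< b' \<longrightarrow> mem_code c' d' (pair_M (e 0) y') \<longrightarrow> y = y')))"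
      by (rule definable)+
    then have "n \<^bold>\<le> n \<longrightarrow> (\<forall>y. y \<^bold>< b \<longrightarrow> mem_code c d (pair_M n y) \<longrightarrow>
      (\<forall>y'. y' \<^bold>< b' \<longrightarrow> mem_code c' d' (pair_M n y') \<longrightarrow> y = y'))"
    proof (induction n rule: S1_induct[OF D1_imp_S1, consumes 1, case_names zero suc])
      case zero
      then show ?case using h unfolding hist_def by (metis not_less_zero zero_le)
    next
      case (suc m)
      show ?case
      proof (intro impI allI)
        fix y y'
        assume m: "suc_M m \<^bold>\<le> n" and y: "y \<^bold>< b" "mem_code c d (pair_M (suc_M m) y)"
          and y': "y' \<^bold>< b'" "mem_code c' d' (pair_M (suc_M m) y')"
        obtain z where z: "z \<^bold>< b" "y = g z" "mem_code c d (pair_M m z)"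
          using h(1) m y unfolding hist_def by (metis suc_inject suc_not_zero(1))
        obtain z' where z': "z' \<^bold>< b'" "y' = g z'" "mem_code c' d' (pair_M m z')"
          using h(2) m y' unfolding hist_def by (metis suc_inject suc_not_zero(1))
        have "m \<^bold>\<le> n" using m by (simp add: suc_le_iff)
        then show "y = y'" using suc z z' by blast
      qed
    qed
    then show ?thesis using h unfolding hist_def by blast
  qed
  have ex: "\<exists>x c d b. hist c d b n x" for n
  proof -
    have "S1 (\<lambda>e. \<exists>x c d b. hist c d b (e 0) x)" by (rule S1_ex D1_imp_S1 D F1_var)+
    then show ?thesis
    proof (induction rule: S1_induct)
      case zero
      have "D1 (\<lambda>e. e 0 = pair_M \<^bold>0 a)" by (rule definable)+
      from code_exists[OF this, of "suc_M (pair_M \<^bold>0 a)"] obtain c d where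
        cd: "\<And>i. i \<^bold>\<le> pair_M \<^bold>0 a \<Longrightarrow> mem_code c d i \<longleftrightarrow> i = pair_M \<^bold>0 a" unfolding less_suc_le by blast
      have "hist c d (suc_M a) \<^bold>0 a"
        unfolding hist_def less_suc_le using cd by (simp add: pair_mono)
      then show ?case by blast
    next
      case (suc n)
      then obtain x c d b where h: "hist c d b n x" by blast
      \<comment> \<open>The bound has to exceed the old entries as well as the new value
        \<open>g x\<close>.\<close>
      let ?b = "b \<^bold>+ suc_M (g x)"
      have "D1 (\<lambda>e. (\<exists>m. m \<^bold>\<le> n \<and> (\<exists>y. y \<^bold>< b \<and> e 0 = pair_M m y \<and> mem_code c d (e 0))) \<or> e 0 = pair_M (suc_M n) (g x))"
        by (rule definable)+
      \<comment> \<open>A code is correct only below a bound fixed beforehand; by monotonicity of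
        pairing this one covers all pairs with position up to \<open>n + 1\<close> and value up to
        \<open>?b\<close>.\<close>
      from code_exists[OF this, of "suc_M (pair_M (suc_M n) ?b)"] obtain c' d' where
        cd: "\<And>i. i \<^bold>\<le> pair_M (suc_M n) ?b \<Longrightarrow> mem_code c' d' i \<longleftrightarrow>
          (\<exists>m. m \<^bold>\<le> n \<and> (\<exists>y. y \<^bold>< b \<and> i = pair_M m y \<and> mem_code c d i)) \<or> i = pair_M (suc_M n) (g x)"
        unfolding less_suc_le by blast
      have cd': "mem_code c' d' (pair_M m y) \<longleftrightarrow> (m \<^bold>\<le> n \<and> y \<^bold>< b \<and> mem_code c d (pair_M m y)) \<or> (m = suc_M n \<and> y = g x)"
        if "m \<^bold>\<le> suc_M n" "y \<^bold>< ?b" for m y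
        using cd[of "pair_M m y"] that pair_mono[of m "suc_M n" y ?b] by (auto simp: le_M_def)
      have b: "y \<^bold>< b \<Longrightarrow> y \<^bold>< ?b" for y using less_le_trans[OF _ le_add1] .
      have gx: "g x \<^bold>< ?b" by (simp add: add_suc less_suc_le)
      have n: "m \<^bold>\<le> n \<Longrightarrow> m \<^bold>\<le> suc_M n" for m by (simp add: le_M_def less_suc)
      have xb: "x \<^bold>< b" "mem_code c d (pair_M n x)" using h unfolding hist_def by blast+
      have "hist c' d' ?b (suc_M n) (g x)"
        unfolding hist_def
      proof (intro conjI allI impI gx)
        show "mem_code c' d' (pair_M (suc_M n) (g x))" using cd' gx by simp
        fix m y assume my: "m \<^bold>\<le> suc_M n" "y \<^bold>< ?b" "mem_code c' d' (pair_M m y)"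
        then consider "m \<^bold>\<le> n" "y \<^bold>< b" "mem_code c d (pair_M m y)" | "m = suc_M n" "y = g x"
          using cd' by blast
        then show "m = \<^bold>0 \<and> y = a \<or> (\<exists>k. k \<^bold>< m \<and> (\<exists>z. z \<^bold>< ?b \<and> m = suc_M k \<and> y = g z \<and> mem_code c' d' (pair_M k z)))"
        proof cases
          case 1
          then consider "m = \<^bold>0 \<and> y = a" | k z where "k \<^bold>< m" "z \<^bold>< b" "m = suc_M k" "y = g z" "mem_code c d (pair_M k z)"
            using h unfolding hist_def by blast
          then show ?thesis
          proof cases
            case (2 k z)
            then have "k \<^bold>\<le> n" using 1 suc_le_iff by (simp add: less_imp_le)
            then have "mem_code c' d' (pair_M k z)" using cd'[OF n b] 2 by blast
            then show ?thesis using 2 b by blast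
          qed blast
        next
          case 2
          have "mem_code c' d' (pair_M n x)" using cd'[OF n b] xb by simp
          then show ?thesis using 2 b xb(1) less_self_suc by blast
        qed
      qed
      then show ?case by blast
    qed
  qed
  define h where "h n = (THE x. \<exists>c d b. hist c d b n x)" for n
  have h: "x = h n \<longleftrightarrow> (\<exists>c d b. hist c d b n x)" for x n
  proof -
    have "\<exists>!x. \<exists>c d b. hist c d b n x" using ex[of n] uniq by blast
    from theI'[OF this] this show ?thesis unfolding h_def by blast
  qed
  show ?thesis
  proof (intro exI conjI allI)
    show "F1 (\<lambda>e. h (e 0))" unfolding F1_def h by (rule S1_ex D1_imp_S1 D F1_var)+
    show "h \<^bold>0 = a"
    proof -
      obtain c d b where "hist c d b \<^bold>0 (h \<^bold>0)" using h by blast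
      then show ?thesis unfolding hist_def by (metis not_less_zero zero_le)
    qed
    show "h (suc_M n) = g (h n)" for n
    proof -
      obtain c d b where *: "hist c d b (suc_M n) (h (suc_M n))" using h by blast
      then obtain z where z: "z \<^bold>< b" "h (suc_M n) = g z" "mem_code c d (pair_M n z)"
        unfolding hist_def by (metis suc_inject suc_not_zero(1) order_refl)
      have "m \<^bold>\<le> n \<Longrightarrow> m \<^bold>\<le> suc_M n" for m by (simp add: le_M_def less_suc)
      then have "hist c d b n z" using * z unfolding hist_def by blast
      then show ?thesis using h z(2) by metis
    qed
  qed
qed

lemma increasing_enumeration:
  assumes B: "B \<in> l2_sets M" and unb: "\<And>n. \<exists>x. n \<^bold>< x \<and> x \<in> B"
  shows "\<exists>h. F1 (\<lambda>e. h (e 0)) \<and> (\<forall>n. h n \<in> B) \<and> (\<forall>n. h n \<^bold>< h (suc_M n))"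
proof -
  have ex: "\<exists>x. (n \<^bold>< x \<and> x \<in> B) \<and> (\<forall>y. y \<^bold>< x \<longrightarrow> \<not> (n \<^bold>< y \<and> y \<in> B))" for n
  proof -
    have "D1 (\<lambda>e. n \<^bold>< e 0 \<and> e 0 \<in> B)" by (rule definable B)+
    then show ?thesis using D1_least[of "\<lambda>x. n \<^bold>< x \<and> x \<in> B"] unb by blast
  qed
  define g where "g n = (THE x. (n \<^bold>< x \<and> x \<in> B) \<and> (\<forall>y. y \<^bold>< x \<longrightarrow> \<not> (n \<^bold>< y \<and> y \<in> B)))" for n
  have g: "x = g n \<longleftrightarrow> (n \<^bold>< x \<and> x \<in> B) \<and> (\<forall>y. y \<^bold>< x \<longrightarrow> \<not> (n \<^bold>< y \<and> y \<in> B))" for x n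
  proof -
    have "\<exists>!x. (n \<^bold>< x \<and> x \<in> B) \<and> (\<forall>y. y \<^bold>< x \<longrightarrow> \<not> (n \<^bold>< y \<and> y \<in> B))"
      using ex[of n] by (metis less_or_eq_or_greater)
    from theI'[OF this] this show ?thesis unfolding g_def by blast
  qed
  have "F1 (\<lambda>e. g (e 0))" unfolding F1_def g by (rule D1_imp_S1 definable B)+
  \<comment> \<open>Starting at \<open>g 0\<close> rather than at 0 puts the first value into
    \<open>B\<close> as well.\<close>
  from iteration[OF this, of "g \<^bold>0"] obtain h where h: "F1 (\<lambda>e. h (e 0))" "h \<^bold>0 = g \<^bold>0" "\<And>n. h (suc_M n) = g (h n)"
    by blast
  have "n \<^bold>< g n" "g n \<in> B" for n using g by blast+
  moreover from this have "h n \<in> B" for n using h(2,3) zero_or_suc[of n] by metis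
  ultimately show ?thesis using h by metis
qed

lemma strict_increasing:
  assumes "F1 (\<lambda>e. h (e 0))" "\<And>n. h n \<^bold>< h (suc_M n)" "m \<^bold>< n" shows "h m \<^bold>< h n"
proof -
  have "D1 (\<lambda>e. h m \<^bold>< h (m \<^bold>+ suc_M (e 0)))" by (rule definable F1_subst1[OF _ assms(1)])+
  then have "h m \<^bold>< h (m \<^bold>+ suc_M k)" for k
  proof (induction k rule: S1_induct[OF D1_imp_S1, consumes 1, case_names zero suc])
    case zero
    then show ?case using assms(2)[of m] by (simp add: suc_eq)
  next
    case (suc x)
    then show ?case using assms(2)[of "m \<^bold>+ suc_M x"] by (simp add: add_suc)
  qed
  then show ?thesis using assms(3) unfolding less_iff_add by blast
qed

section \<open>Arithmetical comprehension from Sigma01 comprehension\<close>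

lemma D1_rename: "D1 P \<Longrightarrow> D1 (\<lambda>e. P (\<lambda>i. e (r i)))"
  unfolding D1_def by (blast intro: S1_rename[of P] S1_rename[of "\<lambda>e. \<not> P e"])

lemma D1_subst:
  assumes "F1 t" "D1 (\<lambda>e. P (e 0) (\<lambda>i. e (Suc i)))" shows "D1 (\<lambda>e. P (t e) e)"
  using assms S1_subst[of t P] S1_subst[of t "\<lambda>x e. \<not> P x e"] unfolding D1_def by blast

lemma F1_if:
  assumes "D1 P" "F1 s" "F1 t" shows "F1 (\<lambda>e. if P e then s e else t e)"
proof -
  have "S1 (\<lambda>e. (P (\<lambda>i. e (Suc i)) \<and> e 0 = s (\<lambda>i. e (Suc i))) \<or> (\<not> P (\<lambda>i. e (Suc i)) \<and> e 0 = t (\<lambda>i. e (Suc i))))"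
    using assms unfolding F1_def
    by (intro S1_disj S1_conj D1_imp_S1[OF D1_rename[OF assms(1)]] D1_imp_S1[OF D1_not[OF D1_rename[OF assms(1)]]])
  then show ?thesis unfolding F1_def by (rule back_subst[where P = S1]) auto
qed

lemmas [definable] = F1_if

text \<open>Assignments are infinite, but comprehension forms sets of single numbers. A definable
  predicate depends on finitely many variables, and these can be packed into one by pairing.\<close>

definition supported :: "nat \<Rightarrow> ((nat \<Rightarrow> 'm) \<Rightarrow> 'b) \<Rightarrow> bool" where
  "supported k P \<longleftrightarrow> (\<forall>e e'. (\<forall>i<k. e i = e' i) \<longrightarrow> P e = P e')"

lemma supportedD: "supported k P \<Longrightarrow> (\<And>i. i < k \<Longrightarrow> e i = e' i) \<Longrightarrow> P e = P e'"
  unfolding supported_def by blast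

lemma supported_mono:
  assumes "supported k P" "k \<le> l" shows "supported l P"
  unfolding supported_def by (intro allI impI supportedD[OF assms(1)]) (use assms(2) in simp)

lemma supported_case_nat:
  assumes "supported k P" shows "supported k (\<lambda>e. P (case_nat x e))"
  unfolding supported_def by (intro allI impI supportedD[OF assms]) (auto split: nat.split)

lemma supported_quant:
  assumes "supported k Q" "\<And>e e'. (\<And>x. Q (case_nat x e) = Q (case_nat x e')) \<Longrightarrow> P e = P e'"
  shows "supported k P"
  unfolding supported_def
  by (intro allI impI assms(2) supportedD[OF supported_case_nat[OF assms(1)]]) simp

lemma supported_binary:
  assumes "\<exists>k. supported k P" "\<exists>k. supported k Q" "\<And>e e'. P e = P e' \<Longrightarrow> Q e = Q e' \<Longrightarrow> R e = R e'"
  shows "\<exists>k. supported k R"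
proof -
  obtain k l where "supported k P" "supported l Q" using assms by blast
  then have "supported (k + l) P" "supported (k + l) Q" by (auto elim: supported_mono)
  then have "supported (k + l) R" using assms(3) unfolding supported_def by blast
  then show ?thesis by blast
qed

lemma num_val_supported: "\<exists>k. supported k (\<lambda>e. num_val M e t)"
proof (induction t)
  case (Var i)
  show ?case by (intro exI[of _ "Suc i"]) (simp add: supported_def)
next
  case (Plus s t)
  show ?case by (rule supported_binary[OF Plus]) simp
next
  case (Times s t)
  show ?case by (rule supported_binary[OF Times]) simp
qed (auto simp: supported_def)

lemma arith_sat_supported: "\<exists>k. supported k (\<lambda>e. arith_sat M v e p)"
proof (induction p)
  case (Eq s t)
  show ?case by (rule supported_binary[OF num_val_supported[of s] num_val_supported[of t]]) simp
next
  case (Less s t)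
  show ?case by (rule supported_binary[OF num_val_supported[of s] num_val_supported[of t]]) simp
next
  case (Mem t i)
  show ?case by (rule supported_binary[OF num_val_supported[of t] num_val_supported[of t]]) simp
next
  case (Neg p)
  show ?case by (rule supported_binary[OF Neg Neg]) simp
next
  case (Conj p q)
  show ?case by (rule supported_binary[OF Conj]) simp
next
  case (BAll t p)
  then obtain k where "supported k (\<lambda>e. arith_sat M v e p)" by blast
  then have "supported k (\<lambda>e x. arith_sat M v (case_nat x e) p)"
    by (rule supported_quant) blast
  then have "\<exists>k. supported k (\<lambda>e x. arith_sat M v (case_nat x e) p)" by blast
  from num_val_supported[of t] this show ?case by (rule supported_binary) (simp, metis)
next
  case (BEx t p)
  then obtain k where "supported k (\<lambda>e. arith_sat M v e p)" by blast
  then have "supported k (\<lambda>e x. arith_sat M v (case_nat x e) p)"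
    by (rule supported_quant) blast
  then have "\<exists>k. supported k (\<lambda>e x. arith_sat M v (case_nat x e) p)" by blast
  from num_val_supported[of t] this show ?case by (rule supported_binary) (simp, metis)
next
  case (All p)
  then obtain k where k: "supported k (\<lambda>e. arith_sat M v e p)" by blast
  show ?case by (rule exI, rule supported_quant[OF k]) simp
next
  case (Ex p)
  then obtain k where k: "supported k (\<lambda>e. arith_sat M v e p)" by blast
  show ?case by (rule exI, rule supported_quant[OF k]) simp
qed

lemma D0_supported: "D0 P \<Longrightarrow> \<exists>k. supported k P"
proof -
  assume "D0 P"
  then obtain q v c where q: "\<And>e. P e \<longleftrightarrow> arith_sat M v (mix e c) q" unfolding D0_def by blast
  obtain k where k: "supported k (\<lambda>e. arith_sat M v e q)" using arith_sat_supported by blast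
  have "supported k P" unfolding supported_def q
  proof (intro allI impI)
    fix e e' :: "nat \<Rightarrow> 'm" assume "\<forall>i<k. e i = e' i"
    then have "\<forall>i<k. mix e c i = mix e' c i" by (auto simp: mix_def)
    then show "arith_sat M v (mix e c) q = arith_sat M v (mix e' c) q" using k unfolding supported_def by blast
  qed
  then show ?thesis by blast
qed

lemma S1_supported: "S1 P \<Longrightarrow> \<exists>k. supported k P"
proof -
  assume "S1 P"
  then obtain Q where Q: "D0 Q" "\<And>e. P e \<longleftrightarrow> (\<exists>y. Q (case_nat y e))" unfolding S1_def by blast
  obtain k where k: "supported k Q" using D0_supported Q(1) by blast
  have "supported k P" by (rule supported_quant[OF k]) (simp add: Q(2))
  then show ?thesis by blast
qed

definition Sigma01_comprehension where
  "Sigma01_comprehension \<longleftrightarrow> (\<forall>P. S1 (\<lambda>e. P (e 0)) \<longrightarrow> {x. P x} \<in> l2_sets M)"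

text \<open>Comprehension settles the case of one variable. In the induction on the support the
  first two variables are fused into a pair, which lowers the support by one.\<close>

lemma S1_imp_D1:
  assumes "Sigma01_comprehension" "S1 P" shows "D1 P"
proof -
  have "S1 P \<Longrightarrow> supported (Suc k) P \<Longrightarrow> D1 P" for k P
  proof (induction k arbitrary: P)
    case 0
    have "S1 (\<lambda>e. P (\<lambda>_. e 0))" using S1_rename[OF 0(1)] .
    then have A: "{x. P (\<lambda>_. x)} \<in> l2_sets M"
      by (rule assms(1)[unfolded Sigma01_comprehension_def, rule_format])
    have "P e \<longleftrightarrow> e 0 \<in> {x. P (\<lambda>_. x)}" for e
      using supportedD[OF 0(2), of e "\<lambda>_. e 0"] by simp
    then have P: "P = (\<lambda>e. e 0 \<in> {x. P (\<lambda>_. x)})" by blast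
    have "D1 (\<lambda>e. e 0 \<in> {x. P (\<lambda>_. x)})" by (rule D1_mem A F1_var)+
    then show ?case by (subst P)
  next
    case (Suc k)
    let ?P = "\<lambda>e. P (case_nat (fst_M (e 0)) (case_nat (snd_M (e 0)) (\<lambda>i. e (Suc i))))"
    have "(\<lambda>e. P (case_nat (e (Suc 0)) (case_nat (e 0) (\<lambda>i. e (Suc (Suc (Suc i))))))) =
      (\<lambda>e. P (\<lambda>i. e (case_nat (Suc 0) (case_nat 0 (\<lambda>i. Suc (Suc (Suc i)))) i)))"
      by (intro ext arg_cong[of _ _ P]) (auto split: nat.split)
    then have "S1 (\<lambda>e. P (case_nat (e (Suc 0)) (case_nat (e 0) (\<lambda>i. e (Suc (Suc (Suc i)))))))"
      using S1_rename[OF Suc.prems(1), of "case_nat (Suc 0) (case_nat 0 (\<lambda>i. Suc (Suc (Suc i))))"] by simp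
    then have "S1 (\<lambda>e. P (case_nat (e 0) (case_nat (snd_M (e (Suc 0))) (\<lambda>i. e (Suc (Suc i))))))"
      by (intro S1_subst[where P = "\<lambda>x e. P (case_nat (e 0) (case_nat x (\<lambda>i. e (Suc (Suc i)))))"] F1_snd F1_var)
    then have "S1 ?P"
      by (intro S1_subst[where P = "\<lambda>x e. P (case_nat x (case_nat (snd_M (e 0)) (\<lambda>i. e (Suc i))))"] F1_fst F1_var)
    moreover have "supported (Suc k) ?P"
      unfolding supported_def
      by (intro allI impI supportedD[OF Suc.prems(2)]) (auto split: nat.split)
    ultimately have "D1 ?P" by (rule Suc.IH)
    then have "D1 (\<lambda>e. ?P (case_nat (e 0) (\<lambda>i. e (Suc (Suc (Suc i))))))"
    proof -
      assume "D1 ?P"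
      from D1_rename[OF this, of "case_nat 0 (\<lambda>i. Suc (Suc (Suc i)))"] show ?thesis by simp
    qed
    then have "D1 (\<lambda>e. ?P (case_nat (pair_M (e 0) (e (Suc 0))) (\<lambda>i. e (Suc (Suc i)))))"
      by (intro D1_subst[where P = "\<lambda>x e. ?P (case_nat x (\<lambda>i. e (Suc (Suc i))))"] F1_pair F1_var)
    moreover have "case_nat (e 0) (case_nat (e (Suc 0)) (\<lambda>i. e (Suc (Suc i)))) = e" for e :: "nat \<Rightarrow> 'm"
      by (auto split: nat.split)
    ultimately show ?case by simp
  qed
  moreover obtain k where "supported k P" using S1_supported assms(2) by blast
  then have "supported (Suc k) P" by (rule supported_mono) simp
  ultimately show ?thesis using assms(2) by blast
qed

lemma F1_num_val:
  assumes "\<And>i. F1 (\<lambda>e. f e i)" shows "F1 (\<lambda>e. num_val M (f e) t)"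
  by (induction t) (auto intro: assms F1_const F1_plus F1_times)

text \<open>Since Sigma01 predicates are now Delta01, an unbounded quantifier does not lead out of
  Delta01. The assignment is a definable \<open>f e\<close> so that it can be extended under
  binders.\<close>

lemma D1_arith_sat:
  assumes "Sigma01_comprehension" "range v \<subseteq> l2_sets M" "\<And>i. F1 (\<lambda>e. f e i)"
  shows "D1 (\<lambda>e. arith_sat M v (f e) p)"
  using assms(3)
proof (induction p arbitrary: f)
  case (Mem t i)
  have "v i \<in> l2_sets M" using assms(2) by auto
  then show ?case using F1_num_val[OF Mem] D1_mem by simp
next
  case (BAll t p)
  have "F1 (\<lambda>e. case_nat (e 0) (f (\<lambda>i. e (Suc i))) i)" for i
    by (cases i) (auto intro: F1_var F1_rename[OF BAll(2)])
  then show ?case using D1_ball[OF F1_num_val[OF BAll(2)], of "\<lambda>x e. arith_sat M v (case_nat x (f e)) p"]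
      BAll(1)[of "\<lambda>e. case_nat (e 0) (f (\<lambda>i. e (Suc i)))"] by simp
next
  case (BEx t p)
  have "F1 (\<lambda>e. case_nat (e 0) (f (\<lambda>i. e (Suc i))) i)" for i
    by (cases i) (auto intro: F1_var F1_rename[OF BEx(2)])
  then show ?case using D1_bex[OF F1_num_val[OF BEx(2)], of "\<lambda>x e. arith_sat M v (case_nat x (f e)) p"]
      BEx(1)[of "\<lambda>e. case_nat (e 0) (f (\<lambda>i. e (Suc i)))"] by simp
next
  case (All p)
  have "F1 (\<lambda>e. case_nat (e 0) (f (\<lambda>i. e (Suc i))) i)" for i
    by (cases i) (auto intro: F1_var F1_rename[OF All(2)])
  then have "S1 (\<lambda>e. \<exists>x. \<not> arith_sat M v (case_nat x (f e)) p)"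
    by (intro S1_ex D1_imp_S1[OF D1_not] All(1))
  from D1_not[OF S1_imp_D1[OF assms(1) this]] show ?case by simp
next
  case (Ex p)
  have "F1 (\<lambda>e. case_nat (e 0) (f (\<lambda>i. e (Suc i))) i)" for i
    by (cases i) (auto intro: F1_var F1_rename[OF Ex(2)])
  then have "S1 (\<lambda>e. \<exists>x. arith_sat M v (case_nat x (f e)) p)"
    by (intro S1_ex D1_imp_S1 Ex(1))
  from S1_imp_D1[OF assms(1) this] show ?case by simp
next
  case (Eq s t)
  then show ?case using D1_eq[OF F1_num_val F1_num_val] by simp
next
  case (Less s t)
  then show ?case using D1_less[OF F1_num_val F1_num_val] by simp
qed (auto intro: D1_not D1_conj)

text \<open>Under Sigma01 comprehension all arithmetical formulas become Delta01, so full
  comprehension and full induction reduce to instances that hold in \<open>RCA0\<close>.\<close>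

lemma ACA0_iff: "ACA0 M \<longleftrightarrow> Sigma01_comprehension"
proof
  assume aca: "ACA0 M"
  show "Sigma01_comprehension"
    unfolding Sigma01_comprehension_def
  proof (intro allI impI)
    fix P assume "S1 (\<lambda>e. P (e 0))"
    then obtain Q where Q: "D0 Q" "\<And>e. P (e 0) \<longleftrightarrow> (\<exists>y. Q (case_nat y e))" unfolding S1_def by blast
    have P: "P x \<longleftrightarrow> (\<exists>y. Q (case_nat y (\<lambda>_. x)))" for x using Q(2)[of "\<lambda>_. x"] by simp
    have "D0 (\<lambda>e. Q (case_nat (e 0) (\<lambda>_. e (Suc 0))))"
      by (rule D0_reindex[OF Q(1), of _ "case_nat 0 (\<lambda>_. Suc 0)"]) (auto split: nat.splits)
    then obtain q v c where q: "bounded_fm q" "range v \<subseteq> l2_sets M"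
      "\<And>e. Q (case_nat (e 0) (\<lambda>_. e (Suc 0))) \<longleftrightarrow> arith_sat M v (mix e c) q" unfolding D0_def by blast
    obtain q' where q': "\<And>y x. Q (case_nat y (\<lambda>_. x)) \<longleftrightarrow> arith_sat M v (case_nat y (case_nat x c)) q'"
      using bounded_formula_two_vars[where Q = "\<lambda>y x. Q (case_nat y (\<lambda>_. x))", OF q] by blast
    have "{n. arith_sat M v (case_nat n c) (Ex q')} \<in> l2_sets M"
      using aca q(2) unfolding ACA0_def arithmetical_comprehension_def by blast
    then show "{x. P x} \<in> l2_sets M" by (simp add: P q')
  qed
next
  assume sc: "Sigma01_comprehension"
  have D: "D1 (\<lambda>e'. arith_sat M v (case_nat (e' 0) e) p)" if "range v \<subseteq> l2_sets M" for v p e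
  proof (rule D1_arith_sat[OF sc that])
    show "F1 (\<lambda>e'. case_nat (e' 0) e i)" for i by (cases i) (auto intro: F1_var F1_const)
  qed
  show "ACA0 M"
    unfolding ACA0_def induction_for_def arithmetical_comprehension_def
  proof (intro conjI allI impI)
    show "l2_sets M \<noteq> {}" "basic_arithmetic M" using rca unfolding RCA0_def by auto
    fix p and v :: "nat \<Rightarrow> 'm set" and e assume v: "range v \<subseteq> l2_sets M"
    show "{n. arith_sat M v (case_nat n e) p} \<in> l2_sets M"
      by (rule comprehension[OF D[OF v]])
    fix n
    assume "arith_sat M v (case_nat \<^bold>0 e) p"
      "\<forall>n. arith_sat M v (case_nat n e) p \<longrightarrow> arith_sat M v (case_nat (suc_M n) e) p"
    then show "arith_sat M v (case_nat n e) p"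
      using S1_induct[OF D1_imp_S1[OF D[OF v]], of e p n] by blast
  qed
qed

section \<open>Finite sequences and spans\<close>

text \<open>The numbers \<open>c\<close>, \<open>d\<close>, \<open>b\<close> code a function. Taking
  the least listed value, and 0 by default, lets every triple code a total one, so that quantifying
  over finite sequences becomes quantifying over numbers.\<close>

definition is_coded_val where
  "is_coded_val c d b i x \<longleftrightarrow>
    (x \<^bold>< b \<and> mem_code c d (pair_M i x) \<and> (\<forall>z. z \<^bold>< x \<longrightarrow> \<not> mem_code c d (pair_M i z))) \<or>
    (\<not> (\<exists>y. y \<^bold>< b \<and> mem_code c d (pair_M i y)) \<and> x = \<^bold>0)"

definition coded_val where "coded_val c d b i = (THE x. is_coded_val c d b i x)"

lemma coded_val_iff: "x = coded_val c d b i \<longleftrightarrow> is_coded_val c d b i x"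
proof -
  have "D1 (\<lambda>e. e 0 \<^bold>< b \<and> mem_code c d (pair_M i (e 0)))" by (rule definable)+
  from D1_least[OF this] have "\<exists>x. is_coded_val c d b i x"
    unfolding is_coded_val_def by (metis less_trans)
  moreover have "x = y" if "is_coded_val c d b i x" "is_coded_val c d b i y" for x y
    using that less_or_eq_or_greater[of x y] unfolding is_coded_val_def by blast
  ultimately have "\<exists>!x. is_coded_val c d b i x" by blast
  from theI'[OF this] this show ?thesis unfolding coded_val_def by blast
qed

lemma D1_is_coded_val:
  "F1 c \<Longrightarrow> F1 d \<Longrightarrow> F1 b \<Longrightarrow> F1 i \<Longrightarrow> F1 x \<Longrightarrow> D1 (\<lambda>e. is_coded_val (c e) (d e) (b e) (i e) (x e))"
  unfolding is_coded_val_def by (rule definable F1_var | assumption | erule F1_rename)+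

lemma F1_coded_val: "F1 c \<Longrightarrow> F1 d \<Longrightarrow> F1 b \<Longrightarrow> F1 i \<Longrightarrow> F1 (\<lambda>e. coded_val (c e) (d e) (b e) (i e))"
  unfolding F1_def[of "\<lambda>e. coded_val (c e) (d e) (b e) (i e)"] coded_val_iff
  by (rule D1_imp_S1, rule D1_is_coded_val) (rule F1_var | erule F1_rename)+

lemmas [definable] = F1_coded_val

lemma coded_val_exists:
  assumes f: "F1 (\<lambda>e. f (e 0))" shows "\<exists>c d b. \<forall>i. i \<^bold>\<le> n \<longrightarrow> coded_val c d b i = f i"
proof -
  have "S1 (\<lambda>e. e (Suc 0) = f (e 0))" by (rule D1_imp_S1 definable F1_subst1[OF _ f])+
  from bounding[OF this, of "suc_M n"] obtain b where b: "\<And>i. i \<^bold>\<le> n \<Longrightarrow> f i \<^bold>< b" unfolding less_suc_le by blast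
  have "D1 (\<lambda>e. \<exists>i. i \<^bold>\<le> n \<and> e 0 = pair_M i (f i))" by (rule definable F1_subst1[OF _ f])+
  from code_exists[OF this, of "suc_M (pair_M n b)"] obtain c d where
    cd: "\<And>z. z \<^bold>\<le> pair_M n b \<Longrightarrow> mem_code c d z \<longleftrightarrow> (\<exists>i. i \<^bold>\<le> n \<and> z = pair_M i (f i))" unfolding less_suc_le by blast
  have "mem_code c d (pair_M i y) \<longleftrightarrow> y = f i" if "i \<^bold>\<le> n" "y \<^bold>< b" for i y
    using cd[of "pair_M i y"] that pair_mono[of i n y b] less_imp_le by auto
  then have "f i = coded_val c d b i" if "i \<^bold>\<le> n" for i
    unfolding coded_val_iff is_coded_val_def using b[OF that] that less_trans[of _ "f i" b] by (metis less_irrefl)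
  then show ?thesis by metis
qed

lemma finite_sequence_F1:
  assumes "l2_finite_sequence M A n f" shows "F1 (\<lambda>e. if e 0 \<^bold>< n then f (e 0) else z)"
proof -
  have G: "{pair_M i (f i) | i. i \<^bold>< n} \<in> l2_sets M" using assms unfolding l2_finite_sequence_def by blast
  have "x = (if i \<^bold>< n then f i else z) \<longleftrightarrow> pair_M i x \<in> {pair_M i (f i) | i. i \<^bold>< n} \<or> \<not> i \<^bold>< n \<and> x = z" for x i
    by auto
  then show ?thesis unfolding F1_def by (simp only:) (rule D1_imp_S1 definable G)+
qed

lemma F1_finite_sequence:
  assumes "F1 (\<lambda>e. f (e 0))" "\<And>i. i \<^bold>< n \<Longrightarrow> f i \<in> A" shows "l2_finite_sequence M A n f"
proof -
  have "D1 (\<lambda>e. \<exists>i. i \<^bold>< n \<and> e 0 = pair_M i (f i))" by (rule definable F1_subst1[OF _ assms(1)])+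
  from comprehension[OF this] have "{z. \<exists>i. i \<^bold>< n \<and> z = pair_M i (f i)} \<in> l2_sets M" .
  moreover have "{z. \<exists>i. i \<^bold>< n \<and> z = pair_M i (f i)} = {pair_M i (f i) | i. i \<^bold>< n}" by blast
  ultimately show ?thesis using assms(2) unfolding l2_finite_sequence_def by simp
qed

lemma sequence_iff: "l2_sequence M A f \<longleftrightarrow> range f \<subseteq> A \<and> F1 (\<lambda>e. f (e 0))"
  unfolding l2_sequence_def using graph_in_sets[of f] F1_graph[of f] F1_var by blast

end

section \<open>Ideals and spans in a ring of the structure\<close>

locale ring_in_structure = rca_structure M + cring R for M :: "'m l2_structure" and R :: "'m ring" (structure) +
  assumes ring_in: "l2_cring M R"
begin

lemma carrier_set: "carrier R \<in> l2_sets M"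
  using ring_in unfolding l2_cring_def by blast

lemma D1_carrier: "F1 t \<Longrightarrow> D1 (\<lambda>e. t e \<in> carrier R)"
  by (rule D1_mem[OF carrier_set])

text \<open>The ring operations are extended by 0 outside the carrier, since \<open>F1\<close> is about total functions.\<close>

definition add_R where "add_R a b = (if a \<in> carrier R \<and> b \<in> carrier R then a \<oplus> b else \<^bold>0)"
definition mult_R where "mult_R a b = (if a \<in> carrier R \<and> b \<in> carrier R then a \<otimes> b else \<^bold>0)"

lemma F1_add_R: "F1 s \<Longrightarrow> F1 t \<Longrightarrow> F1 (\<lambda>e. add_R (s e) (t e))"
proof (erule (1) F1_subst2)
  let ?A = "{pair_M (pair_M a b) (a \<oplus> b) | a b. a \<in> carrier R \<and> b \<in> carrier R}"
  have A: "?A \<in> l2_sets M" using ring_in unfolding l2_cring_def by blast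
  have "x = add_R a b \<longleftrightarrow> pair_M (pair_M a b) x \<in> ?A \<or> \<not> (a \<in> carrier R \<and> b \<in> carrier R) \<and> x = \<^bold>0" for x a b
    by (auto simp: add_R_def)
  then show "F1 (\<lambda>e. add_R (e 0) (e (Suc 0)))" unfolding F1_def
    by (simp only:) (rule D1_imp_S1 definable A D1_carrier)+
qed

lemma F1_mult_R: "F1 s \<Longrightarrow> F1 t \<Longrightarrow> F1 (\<lambda>e. mult_R (s e) (t e))"
proof (erule (1) F1_subst2)
  let ?A = "{pair_M (pair_M a b) (a \<otimes> b) | a b. a \<in> carrier R \<and> b \<in> carrier R}"
  have A: "?A \<in> l2_sets M" using ring_in unfolding l2_cring_def by blast
  have "x = mult_R a b \<longleftrightarrow> pair_M (pair_M a b) x \<in> ?A \<or> \<not> (a \<in> carrier R \<and> b \<in> carrier R) \<and> x = \<^bold>0" for x a b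
    by (auto simp: mult_R_def)
  then show "F1 (\<lambda>e. mult_R (e 0) (e (Suc 0)))" unfolding F1_def
    by (simp only:) (rule D1_imp_S1 definable A D1_carrier)+
qed

lemmas [definable] = D1_carrier F1_add_R F1_mult_R

lemma add_R [simp]: "a \<in> carrier R \<Longrightarrow> b \<in> carrier R \<Longrightarrow> add_R a b = a \<oplus> b"
  and mult_R [simp]: "a \<in> carrier R \<Longrightarrow> b \<in> carrier R \<Longrightarrow> mult_R a b = a \<otimes> b"
  by (auto simp: add_R_def mult_R_def)

lemma ideal_criterion:
  assumes "I \<subseteq> carrier R" "\<zero> \<in> I" "\<And>a b. a \<in> I \<Longrightarrow> b \<in> I \<Longrightarrow> a \<oplus> b \<in> I"
    "\<And>a r. a \<in> I \<Longrightarrow> r \<in> carrier R \<Longrightarrow> a \<otimes> r \<in> I"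
  shows "ideal I R"
proof (rule idealI)
  show "subgroup I (add_monoid R)"
  proof (rule subgroup.intro)
    fix x assume "x \<in> I"
    then have "x \<otimes> (\<ominus> \<one>) \<in> I" "x \<in> carrier R" using assms by auto
    moreover from this have "x \<otimes> (\<ominus> \<one>) = \<ominus> x" using r_minus by simp
    ultimately show "inv\<^bsub>add_monoid R\<^esub> x \<in> I" by (simp add: a_inv_def)
  qed (use assms in auto)
  fix a x assume a: "a \<in> I" and x: "x \<in> carrier R"
  then show "a \<otimes> x \<in> I" by (rule assms(4))
  with a x show "x \<otimes> a \<in> I" using m_comm[of x a] assms(1) by auto
qed (rule ring_axioms)

lemma spanI:
  assumes "F1 (\<lambda>e. r (e 0))" "F1 (\<lambda>e. s (e 0))" "\<And>i. i \<^bold>< n \<Longrightarrow> r i \<in> carrier R"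
    "\<And>i. i \<^bold>\<le> n \<Longrightarrow> s i \<in> carrier R" "s \<^bold>0 = \<zero>"
    "\<And>i. i \<^bold>< n \<Longrightarrow> s (suc_M i) = s i \<oplus> a i \<otimes> r i" "x = s n"
  shows "x \<in> l2_span M R n a"
  unfolding l2_span_def using assms F1_finite_sequence[OF assms(1), of n "carrier R"]
    F1_finite_sequence[OF assms(2), of "suc_M n" "carrier R"] unfolding less_suc_le by blast

text \<open>Beyond their lengths the sequences of coefficients and partial sums are arbitrary;
  setting them to zero there makes them total definable functions into the carrier.\<close>

lemma spanE:
  assumes "x \<in> l2_span M R n a"
  obtains r s where "F1 (\<lambda>e. r (e 0))" "F1 (\<lambda>e. s (e 0))" "\<And>i. r i \<in> carrier R" "\<And>i. s i \<in> carrier R"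
    "s \<^bold>0 = \<zero>" "\<And>i. i \<^bold>< n \<Longrightarrow> s (suc_M i) = s i \<oplus> a i \<otimes> r i" "x = s n"
proof -
  obtain r s where r: "l2_finite_sequence M (carrier R) n r"
    and s: "l2_finite_sequence M (carrier R) (suc_M n) s" "s \<^bold>0 = \<zero>"
      "\<And>i. i \<^bold>< n \<Longrightarrow> s (suc_M i) = s i \<oplus> a i \<otimes> r i" "x = s n"
    using assms unfolding l2_span_def by blast
  show thesis
  proof (rule that[of "\<lambda>i. if i \<^bold>< n then r i else \<zero>" "\<lambda>i. if i \<^bold>< suc_M n then s i else \<zero>"])
    show "F1 (\<lambda>e. if e 0 \<^bold>< n then r (e 0) else \<zero>)" "F1 (\<lambda>e. if e 0 \<^bold>< suc_M n then s (e 0) else \<zero>)"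
      by (rule finite_sequence_F1[OF r] finite_sequence_F1[OF s(1)])+
    show "(if suc_M i \<^bold>< suc_M n then s (suc_M i) else \<zero>) =
        (if i \<^bold>< suc_M n then s i else \<zero>) \<oplus> a i \<otimes> (if i \<^bold>< n then r i else \<zero>)" if "i \<^bold>< n" for i
      using that s(3)[OF that] less_suc[of i n] by simp
  qed (use r s in \<open>auto simp: l2_finite_sequence_def less_suc zero_less_iff\<close>)
qed

lemma span_ideal:
  assumes a: "\<And>i. i \<^bold>< n \<Longrightarrow> a i \<in> carrier R" shows "ideal (l2_span M R n a) R"
proof (rule ideal_criterion)
  show "l2_span M R n a \<subseteq> carrier R" by (auto elim: spanE)
  show "\<zero> \<in> l2_span M R n a"
    by (rule spanI[of "\<lambda>_. \<zero>" "\<lambda>_. \<zero>"]) (auto simp: a F1_const)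
next
  fix x y assume "x \<in> l2_span M R n a" "y \<in> l2_span M R n a"
  then obtain r s r' s' where *: "F1 (\<lambda>e. r (e 0))" "F1 (\<lambda>e. s (e 0))"
    "\<And>i. r i \<in> carrier R" "\<And>i. s i \<in> carrier R" "s \<^bold>0 = \<zero>"
    "\<And>i. i \<^bold>< n \<Longrightarrow> s (suc_M i) = s i \<oplus> a i \<otimes> r i" "x = s n"
    "F1 (\<lambda>e. r' (e 0))" "F1 (\<lambda>e. s' (e 0))"
    "\<And>i. r' i \<in> carrier R" "\<And>i. s' i \<in> carrier R" "s' \<^bold>0 = \<zero>"
    "\<And>i. i \<^bold>< n \<Longrightarrow> s' (suc_M i) = s' i \<oplus> a i \<otimes> r' i" "y = s' n" by (elim spanE) blast
  have F: "F1 (\<lambda>e. r (e 0) \<oplus> r' (e 0))" "F1 (\<lambda>e. s (e 0) \<oplus> s' (e 0))"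
    using F1_add_R[OF *(1,8)] F1_add_R[OF *(2,9)] by (simp_all add: *)
  have "s (suc_M i) \<oplus> s' (suc_M i) = s i \<oplus> s' i \<oplus> a i \<otimes> (r i \<oplus> r' i)" if "i \<^bold>< n" for i
    using that a[OF that] * by (simp add: r_distr a_ac)
  then show "x \<oplus> y \<in> l2_span M R n a"
    by (intro spanI[OF F]) (simp_all add: *)
next
  fix x t assume "x \<in> l2_span M R n a" and t: "t \<in> carrier R"
  then obtain r s where *: "F1 (\<lambda>e. r (e 0))" "F1 (\<lambda>e. s (e 0))"
    "\<And>i. r i \<in> carrier R" "\<And>i. s i \<in> carrier R" "s \<^bold>0 = \<zero>"
    "\<And>i. i \<^bold>< n \<Longrightarrow> s (suc_M i) = s i \<oplus> a i \<otimes> r i" "x = s n" by (elim spanE) blast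
  have F: "F1 (\<lambda>e. r (e 0) \<otimes> t)" "F1 (\<lambda>e. s (e 0) \<otimes> t)"
    using F1_mult_R[OF *(1) F1_const, of t] F1_mult_R[OF *(2) F1_const, of t] by (simp_all add: * t)
  have "s (suc_M i) \<otimes> t = s i \<otimes> t \<oplus> a i \<otimes> (r i \<otimes> t)" if "i \<^bold>< n" for i
    using that a[OF that] * t by (simp add: l_distr m_assoc)
  then show "x \<otimes> t \<in> l2_span M R n a"
    by (intro spanI[OF F]) (simp_all add: * t)
qed

lemma span_generator:
  assumes a: "\<And>i. i \<^bold>< n \<Longrightarrow> a i \<in> carrier R" and j: "j \<^bold>< n" shows "a j \<in> l2_span M R n a"
proof (rule spanI)
  show "F1 (\<lambda>e. if e 0 = j then \<one> else \<zero>)" "F1 (\<lambda>e. if j \<^bold>< e 0 then a j else \<zero>)"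
    by (rule definable)+
  show "(if j \<^bold>< suc_M i then a j else \<zero>) =
      (if j \<^bold>< i then a j else \<zero>) \<oplus> a i \<otimes> (if i = j then \<one> else \<zero>)" if "i \<^bold>< n" for i
    using a[OF that] a[OF j] by (auto simp: less_suc)
qed (use a j in auto)

text \<open>The sums may have nonstandard length, so closure of \<open>I\<close> under addition is
  not enough: the partial sums are kept in \<open>I\<close> by an induction inside the structure,
  for which membership in \<open>I\<close> has to be Sigma01.\<close>

lemma span_minimal:
  assumes I: "ideal I R" "S1 (\<lambda>e. e 0 \<in> I)" and a: "\<And>i. i \<^bold>< n \<Longrightarrow> a i \<in> I"
  shows "l2_span M R n a \<subseteq> I"
proof
  interpret ideal I R by fact
  fix x assume "x \<in> l2_span M R n a"
  then obtain r s where *: "F1 (\<lambda>e. r (e 0))" "F1 (\<lambda>e. s (e 0))"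
    "\<And>i. r i \<in> carrier R" "\<And>i. s i \<in> carrier R" "s \<^bold>0 = \<zero>"
    "\<And>i. i \<^bold>< n \<Longrightarrow> s (suc_M i) = s i \<oplus> a i \<otimes> r i" "x = s n" by (elim spanE) blast
  have "S1 (\<lambda>e. e 0 \<^bold>\<le> n \<longrightarrow> s (e 0) \<in> I)"
    by (rule S1_imp S1_subst1[OF _ I(2)] definable *(2))+
  then have "n \<^bold>\<le> n \<longrightarrow> s n \<in> I"
  proof (induction rule: S1_induct)
    case (suc i)
    then show ?case using * a[of i] I_r_closed a_closed by (auto simp: suc_le_iff less_imp_le)
  qed (simp add: *)
  then show "x \<in> I" by (simp add: *)
qed

text \<open>Coefficients and partial sums are coded as one sequence of pairs, so that membership in
  a span is the existence of three numbers with a Delta01 property, uniformly in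
  \<open>n\<close>.\<close>

lemma span_characterization:
  assumes a: "\<And>i. a i \<in> carrier R"
  shows "x \<in> l2_span M R n a \<longleftrightarrow> (\<exists>c d b. snd_M (coded_val c d b \<^bold>0) = \<zero> \<and>
    (\<forall>i. i \<^bold>\<le> n \<longrightarrow> fst_M (coded_val c d b i) \<in> carrier R \<and> snd_M (coded_val c d b i) \<in> carrier R) \<and>
    (\<forall>i. i \<^bold>< n \<longrightarrow> snd_M (coded_val c d b (suc_M i)) =
      add_R (snd_M (coded_val c d b i)) (mult_R (a i) (fst_M (coded_val c d b i)))) \<and>
    x = snd_M (coded_val c d b n))" (is "_ \<longleftrightarrow> ?R")
proof
  assume "x \<in> l2_span M R n a"
  then obtain r s where *: "F1 (\<lambda>e. r (e 0))" "F1 (\<lambda>e. s (e 0))"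
    "\<And>i. r i \<in> carrier R" "\<And>i. s i \<in> carrier R" "s \<^bold>0 = \<zero>"
    "\<And>i. i \<^bold>< n \<Longrightarrow> s (suc_M i) = s i \<oplus> a i \<otimes> r i" "x = s n" by (elim spanE) blast
  have "F1 (\<lambda>e. pair_M (r (e 0)) (s (e 0)))" by (rule definable *)+
  from coded_val_exists[OF this, of n] obtain c d b
    where "\<And>i. i \<^bold>\<le> n \<Longrightarrow> coded_val c d b i = pair_M (r i) (s i)" by blast
  note cv = this this[OF less_imp_le] this[OF suc_le_iff[THEN iffD2]]
  show ?R using * a by (rule_tac exI[of _ c], rule_tac exI[of _ d], rule_tac exI[of _ b]) (simp add: cv)
next
  assume ?R
  then obtain c d b where *: "snd_M (coded_val c d b \<^bold>0) = \<zero>"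
    "\<And>i. i \<^bold>\<le> n \<Longrightarrow> fst_M (coded_val c d b i) \<in> carrier R \<and> snd_M (coded_val c d b i) \<in> carrier R"
    "\<And>i. i \<^bold>< n \<Longrightarrow> snd_M (coded_val c d b (suc_M i)) =
      add_R (snd_M (coded_val c d b i)) (mult_R (a i) (fst_M (coded_val c d b i)))"
    "x = snd_M (coded_val c d b n)" by blast
  show "x \<in> l2_span M R n a"
  proof (rule spanI)
    show "F1 (\<lambda>e. fst_M (coded_val c d b (e 0)))" "F1 (\<lambda>e. snd_M (coded_val c d b (e 0)))"
      by (rule definable)+
  qed (use * a in \<open>auto simp: less_imp_le\<close>)
qed

lemma S1_span:
  assumes a: "l2_sequence M (carrier R) a" and "F1 x" "F1 n"
  shows "S1 (\<lambda>e. x e \<in> l2_span M R (n e) a)"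
proof (rule S1_subst2[OF assms(2,3)])
  have a': "a i \<in> carrier R" for i using a unfolding sequence_iff by auto
  have Fa: "F1 t \<Longrightarrow> F1 (\<lambda>e. a (t e))" for t using a F1_subst1 unfolding sequence_iff by blast
  show "S1 (\<lambda>e. e 0 \<in> l2_span M R (e (Suc 0)) a)"
    unfolding span_characterization[OF a'] by (rule S1_ex D1_imp_S1 definable Fa)+
qed

lemma span_mono:
  assumes a: "l2_sequence M (carrier R) a" and "m \<^bold>\<le> n"
  shows "l2_span M R m a \<subseteq> l2_span M R n a"
proof -
  have a': "a i \<in> carrier R" for i using a unfolding sequence_iff by auto
  show ?thesis
    using assms(2) by (intro span_minimal span_ideal S1_span[OF a] F1_var F1_const span_generator a')
      (auto dest: less_le_trans)
qed

section \<open>Implications between the Noetherian conditions\<close>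

lemma sequentially_Noetherian_imp_acc:
  assumes "sequentially_Noetherian M R" shows "Delta01_acc M R"
  unfolding Delta01_acc_def
proof
  assume "\<exists>J. l2_set_sequence M J \<and> (\<forall>i. Delta01_ideal M R (J i)) \<and> (\<forall>i. J i \<subset> J (suc_M i))"
  then obtain J where J: "l2_set_sequence M J" "\<And>i. Delta01_ideal M R (J i)" "\<And>i. J i \<subset> J (suc_M i)" by blast
  have DJ: "D1 (\<lambda>e. s e \<in> J (t e))" if "F1 s" "F1 t" for s t
  proof -
    obtain G where G: "G \<in> l2_sets M" "\<And>i x. x \<in> J i \<longleftrightarrow> pair_M i x \<in> G"
      using J(1) unfolding l2_set_sequence_def by (rule that) auto
    show ?thesis unfolding G(2) by (rule definable G(1) that)+
  qed
  have mono: "x \<in> J (j \<^bold>+ k)" if x: "x \<in> J j" for x j k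
  proof -
    have "D1 (\<lambda>e. x \<in> J (j \<^bold>+ e 0))" by (rule DJ definable)+
    from D1_imp_S1[OF this] show ?thesis
      by (induction k rule: S1_induct) (use x J(3) in \<open>auto simp: add_suc\<close>)
  qed
  have ex: "\<exists>x. (x \<in> J (suc_M i) \<and> x \<notin> J i) \<and> (\<forall>y. y \<^bold>< x \<longrightarrow> \<not> (y \<in> J (suc_M i) \<and> y \<notin> J i))" for i
  proof -
    have "D1 (\<lambda>e. e 0 \<in> J (suc_M i) \<and> e 0 \<notin> J i)" by (rule DJ definable)+
    then show ?thesis using D1_least[of "\<lambda>x. x \<in> J (suc_M i) \<and> x \<notin> J i"] J(3)[of i] by blast
  qed
  \<comment> \<open>Taking least elements is a choice that the structure can make, since the chain
    exists as one set. The earlier choices all lie in \<open>J i\<close>, so the new one is outside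
    their span.\<close>
  define a where "a i = (THE x. (x \<in> J (suc_M i) \<and> x \<notin> J i) \<and> (\<forall>y. y \<^bold>< x \<longrightarrow> \<not> (y \<in> J (suc_M i) \<and> y \<notin> J i)))" for i
  have a: "x = a i \<longleftrightarrow> (x \<in> J (suc_M i) \<and> x \<notin> J i) \<and> (\<forall>y. y \<^bold>< x \<longrightarrow> \<not> (y \<in> J (suc_M i) \<and> y \<notin> J i))" for x i
  proof -
    have "\<exists>!x. (x \<in> J (suc_M i) \<and> x \<notin> J i) \<and> (\<forall>y. y \<^bold>< x \<longrightarrow> \<not> (y \<in> J (suc_M i) \<and> y \<notin> J i))"
      using ex[of i] by (metis less_or_eq_or_greater)
    from theI'[OF this] this show ?thesis unfolding a_def by blast
  qed
  have Fa: "F1 (\<lambda>e. a (e 0))" unfolding F1_def a by (rule D1_imp_S1 DJ definable)+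
  have aJ: "a i \<in> J (suc_M i)" "a i \<notin> J i" for i using a by blast+
  have "J i \<subseteq> carrier R" for i using J(2)[of i] ideal.Icarr[of "J i" R] unfolding Delta01_ideal_def by blast
  then have "l2_sequence M (carrier R) a" unfolding sequence_iff using Fa aJ(1) by blast
  moreover have "a i \<notin> l2_span M R i a" for i
  proof -
    have "a j \<in> J i" if j: "j \<^bold>< i" for j
    proof -
      obtain k where "i = suc_M j \<^bold>+ k" using j unfolding suc_le_iff[symmetric] le_iff_add by blast
      then show ?thesis using mono aJ(1) by blast
    qed
    then have "l2_span M R i a \<subseteq> J i"
      using J(2)[of i] unfolding Delta01_ideal_def by (intro span_minimal D1_imp_S1 DJ F1_var F1_const) auto
    then show ?thesis using aJ(2) by blast
  qed
  ultimately show False using assms unfolding sequentially_Noetherian_def by blast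
qed

lemma Sigma01_imp_Delta01_Noetherian:
  assumes "Sigma01_Noetherian M R" shows "Delta01_Noetherian M R"
  unfolding Delta01_Noetherian_def
proof (intro allI impI)
  fix I assume I: "Delta01_ideal M R I"
  then interpret ideal I R unfolding Delta01_ideal_def by blast
  have Is: "I \<in> l2_sets M" using I unfolding Delta01_ideal_def by blast
  \<comment> \<open>A decidable ideal enumerates itself; non-members are replaced by zero, so the
    range is exactly \<open>I\<close>.\<close>
  define a where "a n = (if n \<in> I then n else \<zero>)" for n
  have range: "range a = I" using additive_subgroup.zero_closed[OF is_additive_subgroup] by (auto simp: a_def)
  have "F1 (\<lambda>e. a (e 0))" unfolding a_def by (rule definable Is)+
  then have "Sigma01_ideal M R a"
    unfolding Sigma01_ideal_def sequence_iff
  proof (intro conjI allI ballI)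
    show "range a \<subseteq> carrier R" using range Icarr by blast
    fix i j r s assume "r \<in> carrier R" "s \<in> carrier R"
    moreover have "a i \<in> I" "a j \<in> I" using range by auto
    ultimately have "a i \<otimes> r \<oplus> a j \<otimes> s \<in> I"
      by (intro additive_subgroup.a_closed[OF is_additive_subgroup] I_r_closed)
    then show "\<exists>k. a k = a i \<otimes> r \<oplus> a j \<otimes> s" unfolding range[symmetric] by (auto simp: image_iff)
  qed
  then show "l2_finitely_generated M R I"
    using assms range unfolding Sigma01_Noetherian_def by blast
qed

lemma ACA0_imp_Sigma01_Noetherian:
  assumes "ACA0 M" "Delta01_acc M R" shows "Sigma01_Noetherian M R"
  unfolding Sigma01_Noetherian_def
proof (intro allI impI, rule ccontr)
  fix a assume a: "Sigma01_ideal M R a" and nfg: "\<not> l2_finitely_generated M R (range a)"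
  have sc: "Sigma01_comprehension" using assms(1) ACA0_iff by simp
  have seq: "l2_sequence M (carrier R) a" using a unfolding Sigma01_ideal_def by blast
  have ac: "a i \<in> carrier R" for i using seq unfolding sequence_iff by auto
  have Fa: "F1 t \<Longrightarrow> F1 (\<lambda>e. a (t e))" for t using seq F1_subst1 unfolding sequence_iff by blast
  have D: "D1 (\<lambda>e. x e \<in> l2_span M R (n e) a)" if "F1 x" "F1 n" for x n
    using S1_imp_D1[OF sc S1_span[OF seq that]] .
  \<comment> \<open>The indices of genuinely new generators. Spans are a priori only Sigma01, so it
    is \<open>D\<close>, and hence Sigma01 comprehension, that makes this a set of the
    structure.\<close>
  define B where "B = {j. a j \<notin> l2_span M R j a}"
  have B: "B \<in> l2_sets M" unfolding B_def by (rule comprehension) (rule definable D Fa)+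
  have zero: "\<zero> \<in> range a"
  proof -
    obtain k where "a k = a undefined \<otimes> \<zero> \<oplus> a undefined \<otimes> \<zero>" using a unfolding Sigma01_ideal_def by (metis zero_closed)
    then show ?thesis using ac by (metis r_null l_zero zero_closed rangeI)
  qed
  have range_ideal: "ideal (range a) R"
  proof (rule ideal_criterion)
    show "range a \<subseteq> carrier R" using ac by blast
    fix x y assume "x \<in> range a" "y \<in> range a"
    then obtain i j where ij: "x = a i" "y = a j" by blast
    obtain k where "a k = a i \<otimes> \<one> \<oplus> a j \<otimes> \<one>" using a unfolding Sigma01_ideal_def by (metis one_closed)
    then show "x \<oplus> y \<in> range a" using ac ij by (metis r_one rangeI)
  next
    fix x r assume "x \<in> range a" and r: "r \<in> carrier R"
    then obtain i where i: "x = a i" by blast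
    obtain k where "a k = a i \<otimes> r \<oplus> a i \<otimes> \<zero>" using a r unfolding Sigma01_ideal_def by (metis zero_closed)
    then show "x \<otimes> r \<in> range a" using ac i r by (metis r_null r_zero m_closed rangeI)
  qed (rule zero)
  \<comment> \<open>If no index beyond \<open>n\<close> were new, strong induction would put every
    \<open>a j\<close> into the span of the first \<open>n + 1\<close> terms.\<close>
  have unb: "\<exists>x. n \<^bold>< x \<and> x \<in> B" for n
  proof (rule ccontr)
    assume "\<not> ?thesis"
    then have b: "a j \<in> l2_span M R j a" if "n \<^bold>< j" for j using that unfolding B_def by blast
    have "D1 (\<lambda>e. a (e 0) \<in> l2_span M R (suc_M n) a)" by (rule definable D Fa)+
    then have all: "a j \<in> l2_span M R (suc_M n) a" for j
    proof (induction j rule: strong_induct[OF D1_imp_S1, consumes 1, case_names less])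
      case (less j)
      show ?case
      proof (cases "n \<^bold>< j")
        case True
        have "l2_span M R j a \<subseteq> l2_span M R (suc_M n) a"
          by (intro span_minimal span_ideal D1_imp_S1[OF D] F1_var F1_const ac less)
        then show ?thesis using b[OF True] by blast
      next
        case False
        then show ?thesis by (intro span_generator ac) (simp add: less_suc_le)
      qed
    qed
    have "S1 (\<lambda>e. e 0 \<in> range a)"
    proof -
      have "S1 (\<lambda>e. \<exists>i. e 0 = a i)" by (rule S1_ex D1_imp_S1 definable Fa)+
      then show ?thesis by (simp add: image_iff)
    qed
    then have "l2_span M R (suc_M n) a \<subseteq> range a"
      by (intro span_minimal range_ideal) auto
    then have "range a = l2_span M R (suc_M n) a" using all by blast
    moreover have "l2_finite_sequence M (carrier R) (suc_M n) a"
      by (intro F1_finite_sequence Fa F1_var ac)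
    ultimately show False using nfg unfolding l2_finitely_generated_def by blast
  qed
  obtain h where h: "F1 (\<lambda>e. h (e 0))" "\<And>n. h n \<in> B" "\<And>n. h n \<^bold>< h (suc_M n)"
    using increasing_enumeration[OF B unb] by blast
  \<comment> \<open>Only spans up to indices in \<open>B\<close> are kept, so that
    \<open>a (h i)\<close> makes the step after \<open>i\<close> strict.\<close>
  let ?J = "\<lambda>i. l2_span M R (h i) a"
  have DJ: "D1 (\<lambda>e. x e \<in> ?J (n e))" if "F1 x" "F1 n" for x n
    by (intro D that F1_subst1[OF that(2) h(1)])
  have "l2_set_sequence M ?J"
  proof -
    have "D1 (\<lambda>e. \<exists>i. i \<^bold>\<le> e 0 \<and> (\<exists>x. x \<^bold>\<le> e 0 \<and> e 0 = pair_M i x \<and> x \<in> ?J i))"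
      by (rule definable DJ)+
    from comprehension[OF this] show ?thesis
      unfolding l2_set_sequence_def by (rule back_subst[where P = "\<lambda>A. A \<in> l2_sets M"]) auto
  qed
  moreover have "Delta01_ideal M R (?J i)" for i
    unfolding Delta01_ideal_def using comprehension[of "\<lambda>x. x \<in> ?J i"] DJ[OF F1_var F1_const] span_ideal ac by simp
  moreover have "?J i \<subset> ?J (suc_M i)" for i
  proof
    show "?J i \<subseteq> ?J (suc_M i)" by (intro span_mono[OF seq] less_imp_le h)
    have "a (h i) \<notin> ?J i" using h(2)[of i] unfolding B_def by blast
    moreover have "a (h i) \<in> ?J (suc_M i)" by (intro span_generator ac h)
    ultimately show "?J i \<noteq> ?J (suc_M i)" by blast
  qed
  ultimately show False using assms(2) unfolding Delta01_acc_def by blast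
qed

end

context rca_structure
begin

section \<open>The rational numbers of a structure\<close>

text \<open>\<open>qcls a b n\<close> stands for the fraction \<open>(a - b) / n\<close>.\<close>

definition qeq where "qeq a b n a' b' n' \<longleftrightarrow> a \<^bold>* n' \<^bold>+ b' \<^bold>* n = a' \<^bold>* n \<^bold>+ b \<^bold>* n'"

definition qcls :: "'m \<Rightarrow> 'm \<Rightarrow> 'm \<Rightarrow> ('m \<times> 'm \<times> 'm) set" where
  "qcls a b n = {(a', b', n'). n' \<noteq> \<^bold>0 \<and> qeq a b n a' b' n'}"

lemma qeq_sym: "qeq a b n a' b' n' \<Longrightarrow> qeq a' b' n' a b n"
  unfolding qeq_def by simp

lemma qeq_trans:
  assumes "qeq a b n a' b' n'" "qeq a' b' n' x y k" "n' \<noteq> \<^bold>0" shows "qeq a b n x y k"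
proof -
  \<comment> \<open>As terms cannot be subtracted, the equation is scaled by \<open>n'\<close> and
    padded with \<open>b' * n * k\<close>, which are cancelled at the end.\<close>
  have "(a \<^bold>* k \<^bold>+ y \<^bold>* n) \<^bold>* n' \<^bold>+ b' \<^bold>* n \<^bold>* k = (a \<^bold>* n' \<^bold>+ b' \<^bold>* n) \<^bold>* k \<^bold>+ n \<^bold>* (y \<^bold>* n')"
    by (simp add: semiring_ac)
  also have "\<dots> = (a' \<^bold>* n \<^bold>+ b \<^bold>* n') \<^bold>* k \<^bold>+ n \<^bold>* (y \<^bold>* n')"
    using assms(1) by (simp only: qeq_def)
  also have "\<dots> = n \<^bold>* (a' \<^bold>* k \<^bold>+ y \<^bold>* n') \<^bold>+ b \<^bold>* n' \<^bold>* k"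
    by (simp add: semiring_ac)
  also have "\<dots> = n \<^bold>* (x \<^bold>* n' \<^bold>+ b' \<^bold>* k) \<^bold>+ b \<^bold>* n' \<^bold>* k"
    using assms(2) by (simp only: qeq_def)
  also have "\<dots> = (x \<^bold>* n \<^bold>+ b \<^bold>* k) \<^bold>* n' \<^bold>+ b' \<^bold>* n \<^bold>* k"
    by (simp add: semiring_ac)
  finally have "(a \<^bold>* k \<^bold>+ y \<^bold>* n) \<^bold>* n' = (x \<^bold>* n \<^bold>+ b \<^bold>* k) \<^bold>* n'" by simp
  then show ?thesis using assms(3) by (simp add: qeq_def)
qed

lemma qcls_eq_iff: "n \<noteq> \<^bold>0 \<Longrightarrow> n' \<noteq> \<^bold>0 \<Longrightarrow> qcls a b n = qcls a' b' n' \<longleftrightarrow> qeq a b n a' b' n'"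
proof
  assume "n \<noteq> \<^bold>0" "n' \<noteq> \<^bold>0" "qcls a b n = qcls a' b' n'"
  moreover have "(a, b, n) \<in> qcls a b n" using \<open>n \<noteq> \<^bold>0\<close> by (simp add: qcls_def qeq_def)
  ultimately show "qeq a b n a' b' n'" unfolding qcls_def by (blast intro: qeq_sym)
next
  assume *: "n \<noteq> \<^bold>0" "n' \<noteq> \<^bold>0" "qeq a b n a' b' n'"
  then have "qeq a b n x y k \<longleftrightarrow> qeq a' b' n' x y k" for x y k
    using qeq_trans qeq_sym by blast
  then show "qcls a b n = qcls a' b' n'" unfolding qcls_def by blast
qed

definition qadd where "qadd X Y = (case (SOME t. t \<in> X, SOME t. t \<in> Y) of ((a, b, n), (a', b', n')) \<Rightarrow>
  qcls (a \<^bold>* n' \<^bold>+ a' \<^bold>* n) (b \<^bold>* n' \<^bold>+ b' \<^bold>* n) (n \<^bold>* n'))"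

definition qmult where "qmult X Y = (case (SOME t. t \<in> X, SOME t. t \<in> Y) of ((a, b, n), (a', b', n')) \<Rightarrow>
  qcls (a \<^bold>* a' \<^bold>+ b \<^bold>* b') (a \<^bold>* b' \<^bold>+ b \<^bold>* a') (n \<^bold>* n'))"

lemma qcls_rep:
  assumes "n \<noteq> \<^bold>0" obtains a' b' n' where "(SOME t. t \<in> qcls a b n) = (a', b', n')" "n' \<noteq> \<^bold>0" "qeq a b n a' b' n'"
proof -
  have "(a, b, n) \<in> qcls a b n" using assms by (simp add: qcls_def qeq_def)
  then have "(SOME t. t \<in> qcls a b n) \<in> qcls a b n" by (rule someI)
  then show thesis using that unfolding qcls_def by auto
qed

lemma qadd_cong:
  assumes "qeq a b n x y k"
  shows "qeq (a \<^bold>* n' \<^bold>+ a' \<^bold>* n) (b \<^bold>* n' \<^bold>+ b' \<^bold>* n) (n \<^bold>* n') (x \<^bold>* n' \<^bold>+ a' \<^bold>* k) (y \<^bold>* n' \<^bold>+ b' \<^bold>* k) (k \<^bold>* n')"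
proof -
  have "(a \<^bold>* n' \<^bold>+ a' \<^bold>* n) \<^bold>* (k \<^bold>* n') \<^bold>+ (y \<^bold>* n' \<^bold>+ b' \<^bold>* k) \<^bold>* (n \<^bold>* n') =
      n' \<^bold>* n' \<^bold>* (a \<^bold>* k \<^bold>+ y \<^bold>* n) \<^bold>+ n \<^bold>* k \<^bold>* n' \<^bold>* (a' \<^bold>+ b')"
    by (simp add: semiring_ac)
  also have "\<dots> = n' \<^bold>* n' \<^bold>* (x \<^bold>* n \<^bold>+ b \<^bold>* k) \<^bold>+ n \<^bold>* k \<^bold>* n' \<^bold>* (a' \<^bold>+ b')"
    using assms by (simp only: qeq_def)
  finally show ?thesis unfolding qeq_def by (simp add: semiring_ac)
qed

lemma qmult_cong:
  assumes "qeq a b n x y k"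
  shows "qeq (a \<^bold>* a' \<^bold>+ b \<^bold>* b') (a \<^bold>* b' \<^bold>+ b \<^bold>* a') (n \<^bold>* n') (x \<^bold>* a' \<^bold>+ y \<^bold>* b') (x \<^bold>* b' \<^bold>+ y \<^bold>* a') (k \<^bold>* n')"
proof -
  have "(a \<^bold>* a' \<^bold>+ b \<^bold>* b') \<^bold>* (k \<^bold>* n') \<^bold>+ (x \<^bold>* b' \<^bold>+ y \<^bold>* a') \<^bold>* (n \<^bold>* n') =
      n' \<^bold>* (a' \<^bold>* (a \<^bold>* k \<^bold>+ y \<^bold>* n) \<^bold>+ b' \<^bold>* (x \<^bold>* n \<^bold>+ b \<^bold>* k))"
    by (simp add: semiring_ac)
  also have "\<dots> = n' \<^bold>* (a' \<^bold>* (x \<^bold>* n \<^bold>+ b \<^bold>* k) \<^bold>+ b' \<^bold>* (a \<^bold>* k \<^bold>+ y \<^bold>* n))"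
    using assms by (simp only: qeq_def)
  finally show ?thesis unfolding qeq_def by (simp add: semiring_ac)
qed

lemma qadd_qcls:
  assumes "n \<noteq> \<^bold>0" "n' \<noteq> \<^bold>0"
  shows "qadd (qcls a b n) (qcls a' b' n') = qcls (a \<^bold>* n' \<^bold>+ a' \<^bold>* n) (b \<^bold>* n' \<^bold>+ b' \<^bold>* n) (n \<^bold>* n')"
proof -
  obtain x y k where 1: "(SOME t. t \<in> qcls a b n) = (x, y, k)" "k \<noteq> \<^bold>0" "qeq a b n x y k"
    using qcls_rep assms(1) by blast
  obtain x' y' k' where 2: "(SOME t. t \<in> qcls a' b' n') = (x', y', k')" "k' \<noteq> \<^bold>0" "qeq a' b' n' x' y' k'"
    using qcls_rep assms(2) by blast
  have "qcls (a \<^bold>* n' \<^bold>+ a' \<^bold>* n) (b \<^bold>* n' \<^bold>+ b' \<^bold>* n) (n \<^bold>* n') =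
      qcls (x \<^bold>* n' \<^bold>+ a' \<^bold>* k) (y \<^bold>* n' \<^bold>+ b' \<^bold>* k) (k \<^bold>* n')"
    using qadd_cong[OF 1(3)] assms 1(2) by (simp add: qcls_eq_iff)
  also have "\<dots> = qcls (x \<^bold>* k' \<^bold>+ x' \<^bold>* k) (y \<^bold>* k' \<^bold>+ y' \<^bold>* k) (k \<^bold>* k')"
    using qadd_cong[OF 2(3), of k x y] assms 1(2) 2(2)
    by (simp add: qcls_eq_iff add_commute[of "_ \<^bold>* k"] mult_commute[of k])
  finally show ?thesis by (simp add: qadd_def 1(1) 2(1))
qed

lemma qmult_qcls:
  assumes "n \<noteq> \<^bold>0" "n' \<noteq> \<^bold>0"
  shows "qmult (qcls a b n) (qcls a' b' n') = qcls (a \<^bold>* a' \<^bold>+ b \<^bold>* b') (a \<^bold>* b' \<^bold>+ b \<^bold>* a') (n \<^bold>* n')"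
proof -
  obtain x y k where 1: "(SOME t. t \<in> qcls a b n) = (x, y, k)" "k \<noteq> \<^bold>0" "qeq a b n x y k"
    using qcls_rep assms(1) by blast
  obtain x' y' k' where 2: "(SOME t. t \<in> qcls a' b' n') = (x', y', k')" "k' \<noteq> \<^bold>0" "qeq a' b' n' x' y' k'"
    using qcls_rep assms(2) by blast
  have "qcls (a \<^bold>* a' \<^bold>+ b \<^bold>* b') (a \<^bold>* b' \<^bold>+ b \<^bold>* a') (n \<^bold>* n') =
      qcls (x \<^bold>* a' \<^bold>+ y \<^bold>* b') (x \<^bold>* b' \<^bold>+ y \<^bold>* a') (k \<^bold>* n')"
    using qmult_cong[OF 1(3)] assms 1(2) by (simp add: qcls_eq_iff)
  also have "\<dots> = qcls (x \<^bold>* x' \<^bold>+ y \<^bold>* y') (x \<^bold>* y' \<^bold>+ y \<^bold>* x') (k \<^bold>* k')"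
    using qmult_cong[OF 2(3), of x y k] assms 1(2) 2(2)
    by (simp add: qcls_eq_iff qeq_def semiring_ac)
  finally show ?thesis by (simp add: qmult_def 1(1) 2(1))
qed

definition Q :: "('m \<times> 'm \<times> 'm) set ring" where
  "Q = \<lparr>carrier = {qcls a b n | a b n. n \<noteq> \<^bold>0}, mult = qmult, one = qcls \<^bold>1 \<^bold>0 \<^bold>1, zero = qcls \<^bold>0 \<^bold>0 \<^bold>1, add = qadd\<rparr>"

lemma Q_simps:
  "mult Q = qmult" "one Q = qcls \<^bold>1 \<^bold>0 \<^bold>1" "zero Q = qcls \<^bold>0 \<^bold>0 \<^bold>1" "add Q = qadd"
  by (simp_all add: Q_def)

lemma qcls_carrier: "n \<noteq> \<^bold>0 \<Longrightarrow> qcls a b n \<in> carrier Q"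
  unfolding Q_def by auto

lemma Q_cases:
  assumes "x \<in> carrier Q" obtains a b n where "x = qcls a b n" "n \<noteq> \<^bold>0"
  using assms unfolding Q_def by auto

lemmas qcls_arith = Q_simps qadd_qcls qmult_qcls qcls_eq_iff qeq_def

lemma cring_Q: "cring Q"
proof (rule cringI)
  show "abelian_group Q"
  proof (rule abelian_groupI)
    fix x y assume "x \<in> carrier Q" "y \<in> carrier Q"
    then show "x \<oplus>\<^bsub>Q\<^esub> y \<in> carrier Q" "x \<oplus>\<^bsub>Q\<^esub> y = y \<oplus>\<^bsub>Q\<^esub> x"
      by (elim Q_cases, simp add: Q_simps qadd_qcls qcls_carrier, simp add: qcls_arith semiring_ac)+
  next
    fix x y z assume "x \<in> carrier Q" "y \<in> carrier Q" "z \<in> carrier Q"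
    then show "x \<oplus>\<^bsub>Q\<^esub> y \<oplus>\<^bsub>Q\<^esub> z = x \<oplus>\<^bsub>Q\<^esub> (y \<oplus>\<^bsub>Q\<^esub> z)"
      by (elim Q_cases) (simp add: qcls_arith semiring_ac)
  next
    fix x assume "x \<in> carrier Q"
    then obtain a b n where x: "x = qcls a b n" "n \<noteq> \<^bold>0" by (rule Q_cases)
    then show "\<zero>\<^bsub>Q\<^esub> \<oplus>\<^bsub>Q\<^esub> x = x" by (simp add: qcls_arith)
    show "\<exists>y\<in>carrier Q. y \<oplus>\<^bsub>Q\<^esub> x = \<zero>\<^bsub>Q\<^esub>"
      by (rule bexI[of _ "qcls b a n"]) (use x in \<open>simp_all add: qcls_arith qcls_carrier semiring_ac\<close>)
  qed (simp add: Q_simps qcls_carrier)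
  show "Group.comm_monoid Q"
  proof (rule comm_monoidI)
    fix x y assume "x \<in> carrier Q" "y \<in> carrier Q"
    then show "x \<otimes>\<^bsub>Q\<^esub> y \<in> carrier Q" "x \<otimes>\<^bsub>Q\<^esub> y = y \<otimes>\<^bsub>Q\<^esub> x"
      by (elim Q_cases, simp add: Q_simps qmult_qcls qcls_carrier, simp add: qcls_arith semiring_ac)+
  next
    fix x y z assume "x \<in> carrier Q" "y \<in> carrier Q" "z \<in> carrier Q"
    then show "x \<otimes>\<^bsub>Q\<^esub> y \<otimes>\<^bsub>Q\<^esub> z = x \<otimes>\<^bsub>Q\<^esub> (y \<otimes>\<^bsub>Q\<^esub> z)"
      by (elim Q_cases) (simp add: qcls_arith semiring_ac)
  next
    fix x assume "x \<in> carrier Q"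
    then show "\<one>\<^bsub>Q\<^esub> \<otimes>\<^bsub>Q\<^esub> x = x"
      by (elim Q_cases) (simp add: qcls_arith)
  qed (simp add: Q_simps qcls_carrier)
  fix x y z assume "x \<in> carrier Q" "y \<in> carrier Q" "z \<in> carrier Q"
  then show "(x \<oplus>\<^bsub>Q\<^esub> y) \<otimes>\<^bsub>Q\<^esub> z = x \<otimes>\<^bsub>Q\<^esub> z \<oplus>\<^bsub>Q\<^esub> y \<otimes>\<^bsub>Q\<^esub> z"
    by (elim Q_cases) (simp add: qcls_arith semiring_ac)
qed

definition qnat where "qnat n = qcls n \<^bold>0 \<^bold>1"

lemma qnat_carrier [simp]: "qnat n \<in> carrier Q"
  by (simp add: qnat_def qcls_carrier)

lemma qnat_add: "qnat (m \<^bold>+ n) = qnat m \<oplus>\<^bsub>Q\<^esub> qnat n"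
  and qnat_mult: "qnat (m \<^bold>* n) = qnat m \<otimes>\<^bsub>Q\<^esub> qnat n"
  and qnat_inject [simp]: "qnat m = qnat n \<longleftrightarrow> m = n"
  and qnat_zero: "qnat \<^bold>0 = \<zero>\<^bsub>Q\<^esub>" and qnat_one: "qnat \<^bold>1 = \<one>\<^bsub>Q\<^esub>"
  by (simp_all add: qnat_def qcls_arith)

lemma qnat_mult_zero: "x \<in> carrier Q \<Longrightarrow> n \<noteq> \<^bold>0 \<Longrightarrow> qnat n \<otimes>\<^bsub>Q\<^esub> x = \<zero>\<^bsub>Q\<^esub> \<Longrightarrow> x = \<zero>\<^bsub>Q\<^esub>"
  by (erule Q_cases) (simp add: qnat_def qcls_arith distrib_left[symmetric])

lemma qnat_mult_qcls: "n \<noteq> \<^bold>0 \<Longrightarrow> qnat k \<otimes>\<^bsub>Q\<^esub> qcls a b n = qcls (k \<^bold>* a) (k \<^bold>* b) n"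
  by (simp add: qnat_def qcls_arith)

lemma qcls_minus: "n \<noteq> \<^bold>0 \<Longrightarrow> \<ominus>\<^bsub>Q\<^esub> qcls a b n = qcls b a n"
proof -
  assume n: "n \<noteq> \<^bold>0"
  interpret Q: cring Q by (rule cring_Q)
  have "qcls b a n \<oplus>\<^bsub>Q\<^esub> qcls a b n = \<zero>\<^bsub>Q\<^esub>" using n by (simp add: qcls_arith semiring_ac)
  then show ?thesis using n Q.minus_equality qcls_carrier by blast
qed

lemma qcls_scale: "n \<noteq> \<^bold>0 \<Longrightarrow> k \<noteq> \<^bold>0 \<Longrightarrow> qcls a b n = qcls (a \<^bold>* k) (b \<^bold>* k) (n \<^bold>* k)"
  by (simp add: qcls_arith semiring_ac)

lemma qadd_same: "n \<noteq> \<^bold>0 \<Longrightarrow> qcls a b n \<oplus>\<^bsub>Q\<^esub> qcls a' b' n = qcls (a \<^bold>+ a') (b \<^bold>+ b') n"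
  by (simp add: qcls_arith semiring_ac)

text \<open>Fractions are HOL classes that the structure does not see; it handles their
  representatives. Equality of classes unfolds to an equation between representatives and is
  therefore Delta01.\<close>

definition FQ :: "((nat \<Rightarrow> 'm) \<Rightarrow> ('m \<times> 'm \<times> 'm) set) \<Rightarrow> bool" where
  "FQ X \<longleftrightarrow> (\<exists>a b n. F1 a \<and> F1 b \<and> F1 n \<and> (\<forall>e. n e \<noteq> \<^bold>0 \<and> X e = qcls (a e) (b e) (n e)))"

lemma FQ_const: "x \<in> carrier Q \<Longrightarrow> FQ (\<lambda>e. x)"
  unfolding FQ_def by (erule Q_cases) (metis F1_const)

lemma FQ_qnat: "F1 n \<Longrightarrow> FQ (\<lambda>e. qnat (n e))"
  unfolding FQ_def qnat_def by (metis F1_const one_not_zero(1))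

lemma FQ_add: assumes "FQ X" "FQ Y" shows "FQ (\<lambda>e. X e \<oplus>\<^bsub>Q\<^esub> Y e)"
proof -
  obtain a b n where X: "F1 a" "F1 b" "F1 n" "\<And>e. n e \<noteq> \<^bold>0 \<and> X e = qcls (a e) (b e) (n e)"
    using assms(1) unfolding FQ_def by blast
  obtain a' b' n' where Y: "F1 a'" "F1 b'" "F1 n'" "\<And>e. n' e \<noteq> \<^bold>0 \<and> Y e = qcls (a' e) (b' e) (n' e)"
    using assms(2) unfolding FQ_def by blast
  show ?thesis unfolding FQ_def
    by (rule exI[of _ "\<lambda>e. a e \<^bold>* n' e \<^bold>+ a' e \<^bold>* n e"], rule exI[of _ "\<lambda>e. b e \<^bold>* n' e \<^bold>+ b' e \<^bold>* n e"],
        rule exI[of _ "\<lambda>e. n e \<^bold>* n' e"]) (simp add: X Y F1_plus F1_times Q_simps qadd_qcls)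
qed

lemma FQ_mult: assumes "FQ X" "FQ Y" shows "FQ (\<lambda>e. X e \<otimes>\<^bsub>Q\<^esub> Y e)"
proof -
  obtain a b n where X: "F1 a" "F1 b" "F1 n" "\<And>e. n e \<noteq> \<^bold>0 \<and> X e = qcls (a e) (b e) (n e)"
    using assms(1) unfolding FQ_def by blast
  obtain a' b' n' where Y: "F1 a'" "F1 b'" "F1 n'" "\<And>e. n' e \<noteq> \<^bold>0 \<and> Y e = qcls (a' e) (b' e) (n' e)"
    using assms(2) unfolding FQ_def by blast
  show ?thesis unfolding FQ_def
    by (rule exI[of _ "\<lambda>e. a e \<^bold>* a' e \<^bold>+ b e \<^bold>* b' e"], rule exI[of _ "\<lambda>e. a e \<^bold>* b' e \<^bold>+ b e \<^bold>* a' e"],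
        rule exI[of _ "\<lambda>e. n e \<^bold>* n' e"]) (simp add: X Y F1_plus F1_times Q_simps qmult_qcls)
qed

lemma D1_Q_eq: assumes "FQ X" "FQ Y" shows "D1 (\<lambda>e. X e = Y e)"
proof -
  obtain a b n where X: "F1 a" "F1 b" "F1 n" "\<And>e. n e \<noteq> \<^bold>0 \<and> X e = qcls (a e) (b e) (n e)"
    using assms(1) unfolding FQ_def by blast
  obtain a' b' n' where Y: "F1 a'" "F1 b'" "F1 n'" "\<And>e. n' e \<noteq> \<^bold>0 \<and> Y e = qcls (a' e) (b' e) (n' e)"
    using assms(2) unfolding FQ_def by blast
  have "X e = Y e \<longleftrightarrow> qeq (a e) (b e) (n e) (a' e) (b' e) (n' e)" for e
    using X(4) Y(4) by (simp add: qcls_eq_iff)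
  then show ?thesis by (simp add: qeq_def D1_eq F1_plus F1_times X(1-3) Y(1-3))
qed

end

section \<open>A ring built from an enumeration of primes\<close>

text \<open>A stage is itself a number whose first component is the prime listed there, so a listed
  prime never exceeds its stage.\<close>

locale enumeration_structure = rca_structure M for M :: "'m l2_structure" +
  fixes E :: "'m set"
  assumes E_set: "E \<in> l2_sets M"
    and E_prime: "s \<in> E \<Longrightarrow> prime_M (fst_M s)"
    and E_inj: "s \<in> E \<Longrightarrow> t \<in> E \<Longrightarrow> fst_M s = fst_M t \<Longrightarrow> s = t"
    and E_undecidable: "fst_M ` E \<notin> l2_sets M"
begin

definition listed where "listed m p \<longleftrightarrow> (\<exists>s. s \<^bold>< m \<and> s \<in> E \<and> fst_M s = p)"

text \<open>The approximation at stage \<open>m\<close> to the Sigma01 property of being inverted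
  eventually; it is decidable and grows with \<open>m\<close>.\<close>

definition inverted where
  "inverted m p \<longleftrightarrow> (\<exists>s. s \<^bold>< m \<and> s \<in> E \<and> fst_M s = p \<and> (\<exists>t. t \<^bold>< m \<and> s \<^bold>< t \<and> t \<in> E \<and> fst_M t \<^bold>< p))"

lemma D1_listed: "F1 m \<Longrightarrow> F1 p \<Longrightarrow> D1 (\<lambda>e. listed (m e) (p e))"
  unfolding listed_def by (erule (1) D1_subst2) (rule definable E_set)+

lemma D1_inverted: "F1 m \<Longrightarrow> F1 p \<Longrightarrow> D1 (\<lambda>e. inverted (m e) (p e))"
  unfolding inverted_def by (erule (1) D1_subst2) (rule definable E_set)+

lemmas [definable] = D1_listed D1_inverted

lemma listed_mono: "listed m p \<Longrightarrow> m \<^bold>\<le> m' \<Longrightarrow> listed m' p"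
  unfolding listed_def using less_le_trans by blast

lemma inverted_mono: "inverted m p \<Longrightarrow> m \<^bold>\<le> m' \<Longrightarrow> inverted m' p"
proof -
  assume "inverted m p" "m \<^bold>\<le> m'"
  moreover from this have "x \<^bold>< m \<Longrightarrow> x \<^bold>< m'" for x using less_le_trans by blast
  ultimately show ?thesis unfolding inverted_def by blast
qed

lemma listed_prime: "listed m p \<Longrightarrow> prime_M p"
  unfolding listed_def using E_prime by blast

lemma listed_less: "listed m p \<Longrightarrow> p \<^bold>< m"
  unfolding listed_def using fst_le le_less_trans by blast

definition unit_at where
  "unit_at m w \<longleftrightarrow> w \<noteq> \<^bold>0 \<and> (\<forall>p. p \<^bold>\<le> w \<longrightarrow> prime_M p \<longrightarrow> p \<^bold>| w \<longrightarrow> inverted m p)"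

lemma D1_unit_at: "F1 m \<Longrightarrow> F1 w \<Longrightarrow> D1 (\<lambda>e. unit_at (m e) (w e))"
  unfolding unit_at_def by (erule (1) D1_subst2) (rule definable)+

lemmas [definable] = D1_unit_at

lemma unit_at_not_zero: "unit_at m w \<Longrightarrow> w \<noteq> \<^bold>0"
  by (simp add: unit_at_def)

lemma unit_at_iff: "unit_at m w \<longleftrightarrow> w \<noteq> \<^bold>0 \<and> (\<forall>p. prime_M p \<longrightarrow> p \<^bold>| w \<longrightarrow> inverted m p)"
  unfolding unit_at_def using dvd_le by blast

lemma unit_at_mono: "unit_at m w \<Longrightarrow> m \<^bold>\<le> m' \<Longrightarrow> unit_at m' w"
  unfolding unit_at_iff using inverted_mono by blast

lemma unit_at_mult: "unit_at m v \<Longrightarrow> unit_at m w \<Longrightarrow> unit_at m (v \<^bold>* w)"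
  unfolding unit_at_iff using prime_dvd_mult by (metis mult_eq_zero)

lemma unit_at_one: "unit_at m \<^bold>1"
  unfolding unit_at_iff using prime_not_one by auto

lemma unit_at_mult_mono: "unit_at m v \<Longrightarrow> unit_at m' w \<Longrightarrow> unit_at (m \<^bold>+ m') (v \<^bold>* w)"
  by (intro unit_at_mult) (auto elim: unit_at_mono)

text \<open>As the listed numbers are primes, this is the product of those listed before
  \<open>m\<close>. Characterising it by minimality keeps the graph of \<open>lcm_at\<close>
  Delta01.\<close>

definition is_lcm where
  "is_lcm m x \<longleftrightarrow> (x \<noteq> \<^bold>0 \<and> (\<forall>p. p \<^bold>< m \<longrightarrow> listed m p \<longrightarrow> p \<^bold>| x)) \<and>
     (\<forall>y. y \<^bold>< x \<longrightarrow> \<not> (y \<noteq> \<^bold>0 \<and> (\<forall>p. p \<^bold>< m \<longrightarrow> listed m p \<longrightarrow> p \<^bold>| y)))"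

definition lcm_at where "lcm_at m = (THE x. is_lcm m x)"

lemma lcm_at_props: "is_lcm m (lcm_at m) \<and> (\<forall>x. is_lcm m x \<longrightarrow> x = lcm_at m) \<and>
    (\<forall>x. (\<forall>p. listed m p \<longrightarrow> p \<^bold>| x) \<longrightarrow> lcm_at m \<^bold>| x)"
proof -
  have "S1 (\<lambda>e. listed m (e 0))" by (rule D1_imp_S1 definable)+
  from least_common_multiple[OF this, of m] obtain L where
    L: "L \<noteq> \<^bold>0" "\<And>k. k \<^bold>< m \<Longrightarrow> listed m k \<Longrightarrow> k \<^bold>| L" "\<And>x. (\<And>k. k \<^bold>< m \<Longrightarrow> listed m k \<Longrightarrow> k \<^bold>| x) \<Longrightarrow> L \<^bold>| x"
    using listed_prime prime_not_zero by blast
  then have "is_lcm m L" unfolding is_lcm_def using dvd_le not_le by blast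
  moreover have "x = L" if "is_lcm m x" for x
    using that \<open>is_lcm m L\<close> unfolding is_lcm_def by (metis less_or_eq_or_greater)
  ultimately have "lcm_at m = L" unfolding lcm_at_def by (intro the_equality)
  then show ?thesis using \<open>is_lcm m L\<close> \<open>\<And>x. is_lcm m x \<Longrightarrow> x = L\<close> L(3) by blast
qed

lemma lcm_at_not_zero [simp]: "lcm_at m \<noteq> \<^bold>0"
  using lcm_at_props unfolding is_lcm_def by blast

lemma listed_dvd_lcm_at: "listed m p \<Longrightarrow> p \<^bold>| lcm_at m"
  using lcm_at_props listed_less unfolding is_lcm_def by blast

lemma lcm_at_dvd: "(\<And>p. listed m p \<Longrightarrow> p \<^bold>| x) \<Longrightarrow> lcm_at m \<^bold>| x"
  using lcm_at_props by blast

lemma lcm_at_mono: "m \<^bold>\<le> m' \<Longrightarrow> lcm_at m \<^bold>| lcm_at m'"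
  by (rule lcm_at_dvd) (use listed_dvd_lcm_at listed_mono in blast)

lemma prime_dvd_lcm_at: "prime_M p \<Longrightarrow> p \<^bold>| lcm_at m \<Longrightarrow> listed m p"
  using prime_dvd_lcm[of "lcm_at m" "listed m" p] listed_dvd_lcm_at lcm_at_dvd listed_prime by auto

lemma F1_lcm_at: "F1 m \<Longrightarrow> F1 (\<lambda>e. lcm_at (m e))"
proof (erule F1_subst1)
  have "x = lcm_at m \<longleftrightarrow> is_lcm m x" for x m using lcm_at_props by blast
  then show "F1 (\<lambda>e. lcm_at (e 0))" unfolding F1_def is_lcm_def by (simp only:) (rule D1_imp_S1 definable)+
qed

lemmas [definable] = F1_lcm_at

text \<open>The ring \<open>R\<close> consists of the dual numbers \<open>x + y \<epsilon>\<close> with \<open>x\<close> in the ring \<open>DD\<close>, where the primes that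
  are eventually inverted become units, and \<open>y\<close> in the \<open>DD\<close>-module \<open>AA\<close>, which is generated by the
  inverses of the listed primes.\<close>

definition DD where "DD = {qcls a b w | a b w m. unit_at m w}"
definition AA where "AA = {qcls c d (w \<^bold>* lcm_at m) | c d w m. unit_at m w}"

lemma DD_I: "unit_at m w \<Longrightarrow> qcls a b w \<in> DD"
  unfolding DD_def by blast

lemma AA_I: "unit_at m w \<Longrightarrow> qcls c d (w \<^bold>* lcm_at m) \<in> AA"
  unfolding AA_def by blast

lemma DD_E: assumes "x \<in> DD" obtains a b w m where "x = qcls a b w" "unit_at m w" "w \<noteq> \<^bold>0"
  using assms unit_at_not_zero unfolding DD_def by blast

lemma AA_E: assumes "x \<in> AA"
  obtains c d w m where "x = qcls c d (w \<^bold>* lcm_at m)" "unit_at m w" "w \<noteq> \<^bold>0"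
  using assms unit_at_not_zero unfolding AA_def by blast

lemma DD_carrier: "x \<in> DD \<Longrightarrow> x \<in> carrier Q"
  by (auto elim!: DD_E intro: qcls_carrier)

lemma AA_carrier: "x \<in> AA \<Longrightarrow> x \<in> carrier Q"
  by (auto elim!: AA_E intro!: qcls_carrier)

text \<open>Passage to a common denominator: numerator and denominator are multiplied by
  \<open>v\<close> and by the cofactor of \<open>lcm_at m\<close> in
  \<open>lcm_at m'\<close>.\<close>

lemma AA_raise:
  assumes "w \<noteq> \<^bold>0" "v \<noteq> \<^bold>0" "m \<^bold>\<le> m'"
  shows "\<exists>k. qcls c d (w \<^bold>* lcm_at m) = qcls (c \<^bold>* k) (d \<^bold>* k) (w \<^bold>* v \<^bold>* lcm_at m')"
proof -
  obtain k where k: "lcm_at m' = lcm_at m \<^bold>* k" using lcm_at_mono[OF assms(3)] dvd_M_def by auto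
  then have "k \<noteq> \<^bold>0" using lcm_at_not_zero[of m'] by auto
  then have "qcls c d (w \<^bold>* lcm_at m) = qcls (c \<^bold>* (v \<^bold>* k)) (d \<^bold>* (v \<^bold>* k)) (w \<^bold>* lcm_at m \<^bold>* (v \<^bold>* k))"
    using assms by (intro qcls_scale) auto
  then show ?thesis by (intro exI[of _ "v \<^bold>* k"]) (simp add: k semiring_ac)
qed

lemma DD_add: "x \<in> DD \<Longrightarrow> y \<in> DD \<Longrightarrow> x \<oplus>\<^bsub>Q\<^esub> y \<in> DD"
  by (elim DD_E) (auto simp: Q_simps qadd_qcls intro: DD_I unit_at_mult_mono)

lemma DD_mult: "x \<in> DD \<Longrightarrow> y \<in> DD \<Longrightarrow> x \<otimes>\<^bsub>Q\<^esub> y \<in> DD"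
  by (elim DD_E) (auto simp: Q_simps qmult_qcls intro: DD_I unit_at_mult_mono)

lemma DD_minus: "x \<in> DD \<Longrightarrow> \<ominus>\<^bsub>Q\<^esub> x \<in> DD"
  by (elim DD_E) (auto simp: qcls_minus intro: DD_I)

lemma DD_qnat: "qnat n \<in> DD"
  unfolding qnat_def by (rule DD_I[OF unit_at_one])

lemma DD_zero: "\<zero>\<^bsub>Q\<^esub> \<in> DD" and DD_one: "\<one>\<^bsub>Q\<^esub> \<in> DD"
  using DD_qnat[of "\<^bold>0"] DD_qnat[of "\<^bold>1"] by (simp_all add: qnat_zero qnat_one)

lemma AA_add: "x \<in> AA \<Longrightarrow> y \<in> AA \<Longrightarrow> x \<oplus>\<^bsub>Q\<^esub> y \<in> AA"
proof (elim AA_E)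
  fix c d w m c' d' w' m'
  assume x: "x = qcls c d (w \<^bold>* lcm_at m)" "unit_at m w" "w \<noteq> \<^bold>0"
    and y: "y = qcls c' d' (w' \<^bold>* lcm_at m')" "unit_at m' w'" "w' \<noteq> \<^bold>0"
  obtain k where k: "x = qcls (c \<^bold>* k) (d \<^bold>* k) (w \<^bold>* w' \<^bold>* lcm_at (m \<^bold>+ m'))"
    using AA_raise[OF x(3) y(3), of m "m \<^bold>+ m'" c d] x(1) by auto
  obtain k' where k': "y = qcls (c' \<^bold>* k') (d' \<^bold>* k') (w \<^bold>* w' \<^bold>* lcm_at (m \<^bold>+ m'))"
    using AA_raise[OF y(3) x(3), of m' "m \<^bold>+ m'" c' d'] y(1) by (auto simp: mult_commute[of w])
  show "x \<oplus>\<^bsub>Q\<^esub> y \<in> AA"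
    unfolding k k' using x(3) y(3) by (simp add: qadd_same AA_I unit_at_mult_mono x(2) y(2))
qed

lemma AA_mult: "x \<in> DD \<Longrightarrow> y \<in> AA \<Longrightarrow> x \<otimes>\<^bsub>Q\<^esub> y \<in> AA"
proof (elim DD_E AA_E)
  fix a b w m c' d' w' m'
  assume x: "x = qcls a b w" "unit_at m w" "w \<noteq> \<^bold>0"
    and y: "y = qcls c' d' (w' \<^bold>* lcm_at m')" "unit_at m' w'" "w' \<noteq> \<^bold>0"
  obtain k' where k': "y = qcls (c' \<^bold>* k') (d' \<^bold>* k') (w' \<^bold>* \<^bold>1 \<^bold>* lcm_at (m \<^bold>+ m'))"
    using AA_raise[OF y(3), of "\<^bold>1" m' "m \<^bold>+ m'" c' d'] y(1) by auto
  show "x \<otimes>\<^bsub>Q\<^esub> y \<in> AA"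
    unfolding x(1) k' using x(3) y(3)
    by (simp add: Q_simps qmult_qcls AA_I unit_at_mult_mono x(2) y(2) mult_assoc[symmetric])
qed

lemma AA_minus: "x \<in> AA \<Longrightarrow> \<ominus>\<^bsub>Q\<^esub> x \<in> AA"
  by (elim AA_E) (auto simp: qcls_minus intro: AA_I)

lemma AA_qnat: "qnat n \<in> AA"
proof -
  have "qnat n = qcls (n \<^bold>* lcm_at \<^bold>0) (\<^bold>0 \<^bold>* lcm_at \<^bold>0) (\<^bold>1 \<^bold>* lcm_at \<^bold>0)"
    unfolding qnat_def by (rule qcls_scale) auto
  then show ?thesis using AA_I[OF unit_at_one] by metis
qed

lemma AA_zero: "\<zero>\<^bsub>Q\<^esub> \<in> AA"
  using AA_qnat[of "\<^bold>0"] by (simp add: qnat_zero)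

text \<open>A number \<open>z\<close> codes \<open>((a - b) + (c - d) \<epsilon> / l) / w\<close> with \<open>l = lcm_at m\<close>; a denominator 0 is read as 1.\<close>

definition den where "den z = (if fst_M (snd_M z) = \<^bold>0 then \<^bold>1 else fst_M (snd_M z))"
definition stage where "stage z = snd_M (snd_M z)"
definition re where "re z = qcls (fst_M (fst_M (fst_M z))) (snd_M (fst_M (fst_M z))) (den z)"
definition du where "du z = qcls (fst_M (snd_M (fst_M z))) (snd_M (snd_M (fst_M z))) (den z \<^bold>* lcm_at (stage z))"
definition valid where "valid z \<longleftrightarrow> unit_at (stage z) (den z)"

lemma den_not_zero [simp]: "den z \<noteq> \<^bold>0"
  by (simp add: den_def)

lemma F1_den: "F1 z \<Longrightarrow> F1 (\<lambda>e. den (z e))" and F1_stage: "F1 z \<Longrightarrow> F1 (\<lambda>e. stage (z e))"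
  unfolding den_def stage_def by (rule definable | assumption)+

lemmas [definable] = F1_den F1_stage

lemma D1_valid: "F1 z \<Longrightarrow> D1 (\<lambda>e. valid (z e))"
  unfolding valid_def by (rule definable | assumption)+

lemmas [definable] = D1_valid

lemma FQ_re: "F1 z \<Longrightarrow> FQ (\<lambda>e. re (z e))" and FQ_du: "F1 z \<Longrightarrow> FQ (\<lambda>e. du (z e))"
  unfolding FQ_def re_def du_def by (intro exI conjI allI; (rule definable refl | assumption | simp)+)+

lemmas [definable] = FQ_const FQ_qnat FQ_add FQ_mult FQ_re FQ_du D1_Q_eq

lemma re_DD: "valid z \<Longrightarrow> re z \<in> DD" and du_AA: "valid z \<Longrightarrow> du z \<in> AA"
  unfolding valid_def re_def du_def by (auto intro: DD_I AA_I)

lemma code_exists_valid: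
  assumes "x \<in> DD" "y \<in> AA" shows "\<exists>z. valid z \<and> re z = x \<and> du z = y"
proof -
  obtain a b w m where x: "x = qcls a b w" "unit_at m w" "w \<noteq> \<^bold>0" using assms(1) by (rule DD_E)
  obtain c d v n where y: "y = qcls c d (v \<^bold>* lcm_at n)" "unit_at n v" "v \<noteq> \<^bold>0" using assms(2) by (rule AA_E)
  obtain k where k: "y = qcls (c \<^bold>* k) (d \<^bold>* k) (w \<^bold>* v \<^bold>* lcm_at (m \<^bold>+ n))"
    using AA_raise[OF y(3) x(3), of n "m \<^bold>+ n" c d] y(1) by (auto simp: mult_commute[of w])
  have "x = qcls (a \<^bold>* v) (b \<^bold>* v) (w \<^bold>* v)" unfolding x(1) using x(3) y(3) by (rule qcls_scale)
  moreover have "unit_at (m \<^bold>+ n) (w \<^bold>* v)" using x(2) y(2) by (rule unit_at_mult_mono)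
  ultimately show ?thesis using k x(3) y(3)
    by (intro exI[of _ "pair_M (pair_M (pair_M (a \<^bold>* v) (b \<^bold>* v)) (pair_M (c \<^bold>* k) (d \<^bold>* k))) (pair_M (w \<^bold>* v) (m \<^bold>+ n))"])
      (simp add: valid_def re_def du_def den_def stage_def)
qed

text \<open>An element has many codes; keeping the least makes equality in the ring equality of
  numbers. Membership is decidable because validity and equality of fractions are.\<close>

definition RC where
  "RC = {z. valid z \<and> (\<forall>y. y \<^bold>< z \<longrightarrow> \<not> (valid y \<and> re y = re z \<and> du y = du z))}"

lemma D1_RC: "F1 z \<Longrightarrow> D1 (\<lambda>e. z e \<in> RC)"
  unfolding RC_def mem_Collect_eq by (erule D1_subst1) (rule definable)+

lemmas [definable] = D1_RC

lemma RC_valid: "z \<in> RC \<Longrightarrow> valid z"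
  by (simp add: RC_def)

lemma RC_DD: "z \<in> RC \<Longrightarrow> re z \<in> DD" and RC_AA: "z \<in> RC \<Longrightarrow> du z \<in> AA"
  using RC_valid re_DD du_AA by blast+

lemma RC_eqI: "y \<in> RC \<Longrightarrow> z \<in> RC \<Longrightarrow> re y = re z \<Longrightarrow> du y = du z \<Longrightarrow> y = z"
  unfolding RC_def by (metis (mono_tags, lifting) less_or_eq_or_greater mem_Collect_eq)

lemma RC_exists:
  assumes "x \<in> DD" "y \<in> AA" shows "\<exists>z. z \<in> RC \<and> re z = x \<and> du z = y"
proof -
  have "D1 (\<lambda>e. valid (e 0) \<and> re (e 0) = x \<and> du (e 0) = y)"
    by (rule definable DD_carrier AA_carrier assms)+
  from D1_least[OF this] code_exists_valid[OF assms] obtain z where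
    "valid z \<and> re z = x \<and> du z = y" "\<And>u. u \<^bold>< z \<Longrightarrow> \<not> (valid u \<and> re u = x \<and> du u = y)" by blast
  then show ?thesis unfolding RC_def by blast
qed

definition el where "el x y = (THE z. z \<in> RC \<and> re z = x \<and> du z = y)"

lemma el:
  assumes "x \<in> DD" "y \<in> AA" shows "el x y \<in> RC" "re (el x y) = x" "du (el x y) = y"
proof -
  have "\<exists>!z. z \<in> RC \<and> re z = x \<and> du z = y" using RC_exists[OF assms] RC_eqI by blast
  from theI'[OF this] show "el x y \<in> RC" "re (el x y) = x" "du (el x y) = y" unfolding el_def by blast+
qed

definition R :: "'m ring" where
  "R = \<lparr>carrier = RC, mult = \<lambda>u v. el (re u \<otimes>\<^bsub>Q\<^esub> re v) (re u \<otimes>\<^bsub>Q\<^esub> du v \<oplus>\<^bsub>Q\<^esub> re v \<otimes>\<^bsub>Q\<^esub> du u),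
     one = el \<one>\<^bsub>Q\<^esub> \<zero>\<^bsub>Q\<^esub>, zero = el \<zero>\<^bsub>Q\<^esub> \<zero>\<^bsub>Q\<^esub>,
     add = \<lambda>u v. el (re u \<oplus>\<^bsub>Q\<^esub> re v) (du u \<oplus>\<^bsub>Q\<^esub> du v)\<rparr>"

lemma R_carrier [simp]: "carrier R = RC" by (simp add: R_def)

lemma R_one: "\<one>\<^bsub>R\<^esub> \<in> RC" "re \<one>\<^bsub>R\<^esub> = \<one>\<^bsub>Q\<^esub>" "du \<one>\<^bsub>R\<^esub> = \<zero>\<^bsub>Q\<^esub>"
  and R_zero: "\<zero>\<^bsub>R\<^esub> \<in> RC" "re \<zero>\<^bsub>R\<^esub> = \<zero>\<^bsub>Q\<^esub>" "du \<zero>\<^bsub>R\<^esub> = \<zero>\<^bsub>Q\<^esub>"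
  by (simp_all add: R_def el DD_one DD_zero AA_zero)

lemma R_add:
  assumes "u \<in> RC" "v \<in> RC"
  shows "u \<oplus>\<^bsub>R\<^esub> v \<in> RC" "re (u \<oplus>\<^bsub>R\<^esub> v) = re u \<oplus>\<^bsub>Q\<^esub> re v" "du (u \<oplus>\<^bsub>R\<^esub> v) = du u \<oplus>\<^bsub>Q\<^esub> du v"
  using assms by (simp_all add: R_def el DD_add AA_add RC_DD RC_AA)

lemma R_mult:
  assumes "u \<in> RC" "v \<in> RC"
  shows "u \<otimes>\<^bsub>R\<^esub> v \<in> RC" "re (u \<otimes>\<^bsub>R\<^esub> v) = re u \<otimes>\<^bsub>Q\<^esub> re v"
    "du (u \<otimes>\<^bsub>R\<^esub> v) = re u \<otimes>\<^bsub>Q\<^esub> du v \<oplus>\<^bsub>Q\<^esub> re v \<otimes>\<^bsub>Q\<^esub> du u"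
  using assms by (simp_all add: R_def el DD_mult AA_add AA_mult RC_DD RC_AA)

lemma Q_carrier: "z \<in> RC \<Longrightarrow> re z \<in> carrier Q" "z \<in> RC \<Longrightarrow> du z \<in> carrier Q"
  using RC_DD RC_AA DD_carrier AA_carrier by blast+

lemma cring_R: "cring R"
proof -
  interpret Q: cring Q by (rule cring_Q)
  note simps = R_one R_zero R_add R_mult Q_carrier
  show ?thesis
  proof (rule cringI)
    show "abelian_group R"
    proof (rule abelian_groupI)
      fix x y z assume "x \<in> carrier R" "y \<in> carrier R" "z \<in> carrier R"
      then show "x \<oplus>\<^bsub>R\<^esub> y \<oplus>\<^bsub>R\<^esub> z = x \<oplus>\<^bsub>R\<^esub> (y \<oplus>\<^bsub>R\<^esub> z)"
        by (intro RC_eqI) (simp_all add: simps Q.a_assoc)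
    next
      fix x y assume "x \<in> carrier R" "y \<in> carrier R"
      then show "x \<oplus>\<^bsub>R\<^esub> y = y \<oplus>\<^bsub>R\<^esub> x"
        by (intro RC_eqI) (simp_all add: simps Q.a_comm)
    next
      fix x assume x: "x \<in> carrier R"
      then show "\<zero>\<^bsub>R\<^esub> \<oplus>\<^bsub>R\<^esub> x = x"
        by (intro RC_eqI) (simp_all add: simps)
      have "\<ominus>\<^bsub>Q\<^esub> re x \<in> DD" "\<ominus>\<^bsub>Q\<^esub> du x \<in> AA" using x by (simp_all add: DD_minus AA_minus RC_DD RC_AA)
      note e = el[OF this]
      show "\<exists>y\<in>carrier R. y \<oplus>\<^bsub>R\<^esub> x = \<zero>\<^bsub>R\<^esub>"
        by (rule bexI[of _ "el (\<ominus>\<^bsub>Q\<^esub> re x) (\<ominus>\<^bsub>Q\<^esub> du x)"], rule RC_eqI)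
           (use x in \<open>simp_all add: simps e Q.l_neg\<close>)
    qed (simp_all add: simps)
    show "Group.comm_monoid R"
    proof (rule comm_monoidI)
      fix x y z assume "x \<in> carrier R" "y \<in> carrier R" "z \<in> carrier R"
      then show "x \<otimes>\<^bsub>R\<^esub> y \<otimes>\<^bsub>R\<^esub> z = x \<otimes>\<^bsub>R\<^esub> (y \<otimes>\<^bsub>R\<^esub> z)"
        by (intro RC_eqI) (simp_all add: simps Q.r_distr Q.m_ac Q.a_ac)
    next
      fix x y assume "x \<in> carrier R" "y \<in> carrier R"
      then show "x \<otimes>\<^bsub>R\<^esub> y = y \<otimes>\<^bsub>R\<^esub> x"
        by (intro RC_eqI) (simp_all add: simps Q.m_comm Q.a_comm)
    next
      fix x assume "x \<in> carrier R"
      then show "\<one>\<^bsub>R\<^esub> \<otimes>\<^bsub>R\<^esub> x = x"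
        by (intro RC_eqI) (simp_all add: simps)
    qed (simp_all add: simps)
    fix x y z assume "x \<in> carrier R" "y \<in> carrier R" "z \<in> carrier R"
    then show "(x \<oplus>\<^bsub>R\<^esub> y) \<otimes>\<^bsub>R\<^esub> z = x \<otimes>\<^bsub>R\<^esub> z \<oplus>\<^bsub>R\<^esub> y \<otimes>\<^bsub>R\<^esub> z"
      by (intro RC_eqI) (simp_all add: simps Q.l_distr Q.r_distr Q.a_ac)
  qed
qed

text \<open>The operations are given by the definite description \<open>el\<close>; their graphs
  exist because the result is pinned down by Delta01 conditions on its \<open>re\<close> and
  \<open>du\<close>.\<close>

lemma graph_of_operation:
  assumes "D1 (\<lambda>e. P (e 0) (e (Suc 0)) (e (Suc (Suc 0))))" "\<And>a b c. a \<in> RC \<Longrightarrow> b \<in> RC \<Longrightarrow> c = f a b \<longleftrightarrow> P a b c"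
  shows "{pair_M (pair_M a b) (f a b) | a b. a \<in> RC \<and> b \<in> RC} \<in> l2_sets M"
proof -
  let ?P = "\<lambda>u. fst_M (fst_M u) \<in> RC \<and> snd_M (fst_M u) \<in> RC \<and> P (fst_M (fst_M u)) (snd_M (fst_M u)) (snd_M u) \<and>
    u = pair_M (pair_M (fst_M (fst_M u)) (snd_M (fst_M u))) (snd_M u)"
  have "D1 (\<lambda>e. ?P (e 0))" by (rule definable D1_subst3[OF _ _ _ assms(1)])+
  from comprehension[OF this] have "{u. ?P u} \<in> l2_sets M" .
  moreover have "{u. ?P u} = {pair_M (pair_M a b) (f a b) | a b. a \<in> RC \<and> b \<in> RC}"
  proof (intro equalityI subsetI)
    fix u assume "u \<in> {u. ?P u}"
    then obtain a b c where "u = pair_M (pair_M a b) c" "a \<in> RC" "b \<in> RC" "P a b c" by blast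
    moreover from this have "c = f a b" using assms(2)[of a b c] by simp
    ultimately show "u \<in> {pair_M (pair_M a b) (f a b) | a b. a \<in> RC \<and> b \<in> RC}" by blast
  next
    fix u assume "u \<in> {pair_M (pair_M a b) (f a b) | a b. a \<in> RC \<and> b \<in> RC}"
    then obtain a b where u: "u = pair_M (pair_M a b) (f a b)" "a \<in> RC" "b \<in> RC" by blast
    then have "P a b (f a b)" using assms(2)[of a b "f a b"] by simp
    then show "u \<in> {u. ?P u}" using u by simp
  qed
  ultimately show ?thesis by simp
qed

lemma l2_cring_R: "l2_cring M R"
  unfolding l2_cring_def
proof (intro conjI)
  show "cring R" by (rule cring_R)
  show "carrier R \<in> l2_sets M"
    using comprehension[OF D1_RC[OF F1_var]] by simp
  show "{pair_M (pair_M a b) (a \<oplus>\<^bsub>R\<^esub> b) | a b. a \<in> carrier R \<and> b \<in> carrier R} \<in> l2_sets M"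
    unfolding R_carrier
  proof (rule graph_of_operation)
    show "D1 (\<lambda>e. e (Suc (Suc 0)) \<in> RC \<and> re (e (Suc (Suc 0))) = re (e 0) \<oplus>\<^bsub>Q\<^esub> re (e (Suc 0)) \<and>
      du (e (Suc (Suc 0))) = du (e 0) \<oplus>\<^bsub>Q\<^esub> du (e (Suc 0)))"
      by (rule definable)+
  qed (use R_add RC_eqI in metis)
  show "{pair_M (pair_M a b) (a \<otimes>\<^bsub>R\<^esub> b) | a b. a \<in> carrier R \<and> b \<in> carrier R} \<in> l2_sets M"
    unfolding R_carrier
  proof (rule graph_of_operation)
    show "D1 (\<lambda>e. e (Suc (Suc 0)) \<in> RC \<and> re (e (Suc (Suc 0))) = re (e 0) \<otimes>\<^bsub>Q\<^esub> re (e (Suc 0)) \<and>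
      du (e (Suc (Suc 0))) = re (e 0) \<otimes>\<^bsub>Q\<^esub> du (e (Suc 0)) \<oplus>\<^bsub>Q\<^esub> re (e (Suc 0)) \<otimes>\<^bsub>Q\<^esub> du (e 0))"
      by (rule definable)+
  qed (use R_mult RC_eqI in metis)
qed

sublocale R: ring_in_structure M R
  by (intro ring_in_structure.intro rca_structure_axioms ring_in_structure_axioms.intro l2_cring_R cring_R)

section \<open>Settled stages\<close>

lemma E_unbounded: "\<exists>s. n \<^bold>\<le> s \<and> s \<in> E"
proof (rule ccontr)
  assume "\<not> ?thesis"
  then have "fst_M ` E = {p. \<exists>s. s \<^bold>< n \<and> s \<in> E \<and> fst_M s = p}"
    using not_le by (fastforce simp: image_iff)
  moreover have "D1 (\<lambda>e. \<exists>s. s \<^bold>< n \<and> s \<in> E \<and> fst_M s = e 0)"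
    by (rule definable E_set)+
  ultimately show False using comprehension E_undecidable by simp
qed

definition settled where "settled s \<longleftrightarrow> s \<in> E \<and> (\<forall>t. t \<in> E \<longrightarrow> s \<^bold>< t \<longrightarrow> fst_M s \<^bold>< fst_M t)"

text \<open>Among the stages from \<open>n\<close> on, the one listing the smallest prime is
  settled: later stages list no smaller prime by minimality, and not the same one by
  injectivity.\<close>

lemma settled_exists: "\<exists>s. n \<^bold>\<le> s \<and> settled s"
proof -
  have "S1 (\<lambda>e. \<exists>s. n \<^bold>\<le> s \<and> s \<in> E \<and> fst_M s = e 0)"
    by (rule S1_ex D1_imp_S1 definable E_set)+
  from S1_least[OF this] E_unbounded[of n] obtain v s where s: "n \<^bold>\<le> s" "s \<in> E" "fst_M s = v"
    "\<And>u. u \<^bold>< v \<Longrightarrow> \<not> (\<exists>s. n \<^bold>\<le> s \<and> s \<in> E \<and> fst_M s = u)" by metis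
  have "fst_M s \<^bold>< fst_M t" if t: "t \<in> E" "s \<^bold>< t" for t
  proof -
    have "n \<^bold>\<le> t" using s(1) t(2) by simp
    then have "\<not> fst_M t \<^bold>< fst_M s" using s t(1) by blast
    moreover have "fst_M t \<noteq> fst_M s" using E_inj[OF s(2) t(1)] t(2) by auto
    ultimately show ?thesis by simp
  qed
  then show ?thesis using s unfolding settled_def by blast
qed

lemma settled_not_inverted: "settled s \<Longrightarrow> \<not> inverted m (fst_M s)"
  unfolding settled_def inverted_def using E_inj less_asym by metis

section \<open>A decidable ideal that is not finitely generated\<close>

definition qint where "qint c d = qcls c d \<^bold>1"

lemma qint_add: "qint c d \<oplus>\<^bsub>Q\<^esub> qint c' d' = qint (c \<^bold>+ c') (d \<^bold>+ d')"
  and qint_mult: "qint c d \<otimes>\<^bsub>Q\<^esub> qint c' d' = qint (c \<^bold>* c' \<^bold>+ d \<^bold>* d') (c \<^bold>* d' \<^bold>+ d \<^bold>* c')"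
  and qnat_qint: "qnat n = qint n \<^bold>0"
  by (simp_all add: qint_def qnat_def qcls_arith)

lemma FQ_qint: "F1 c \<Longrightarrow> F1 d \<Longrightarrow> FQ (\<lambda>e. qint (c e) (d e))"
  unfolding FQ_def qint_def by (metis F1_const one_not_zero(1))

lemmas [definable] = FQ_qint

lemma clear_denominator: "n \<noteq> \<^bold>0 \<Longrightarrow> qnat n \<otimes>\<^bsub>Q\<^esub> qcls a b n = qint a b"
  by (simp add: qint_def qnat_def qcls_arith semiring_ac)

definition nilpotents where "nilpotents = {z. z \<in> RC \<and> re z = \<zero>\<^bsub>Q\<^esub>}"

lemma Q_zero_carrier: "\<zero>\<^bsub>Q\<^esub> \<in> carrier Q"
  by (simp add: Q_simps qcls_carrier)

lemma nilpotents_ideal: "Delta01_ideal M R nilpotents"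
proof -
  interpret Q: cring Q by (rule cring_Q)
  have "D1 (\<lambda>e. e 0 \<in> RC \<and> re (e 0) = \<zero>\<^bsub>Q\<^esub>)" by (rule definable Q_zero_carrier qnat_carrier)+
  then have "nilpotents \<in> l2_sets M" unfolding nilpotents_def by (rule comprehension)
  moreover have "ideal nilpotents R"
    by (rule R.ideal_criterion) (auto simp: nilpotents_def R_zero R_add R_mult Q_carrier)
  ultimately show ?thesis unfolding Delta01_ideal_def by blast
qed

text \<open>The elements \<open>y \<epsilon>\<close> with \<open>y\<close> in
  \<open>(1 / lcm_at n) D\<close>. The unit \<open>w\<close> is an explicit witness, so that
  membership is visibly Sigma01, as \<open>span_minimal\<close> requires.\<close>

definition bounded_nilpotents where
  "bounded_nilpotents n = {z. z \<in> RC \<and> re z = \<zero>\<^bsub>Q\<^esub> \<and>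
     (\<exists>m w c d. unit_at m w \<and> qnat (w \<^bold>* lcm_at n) \<otimes>\<^bsub>Q\<^esub> du z = qint c d)}"

lemma S1_bounded_nilpotents: "S1 (\<lambda>e. e 0 \<in> bounded_nilpotents n)"
  unfolding bounded_nilpotents_def mem_Collect_eq
  by (rule S1_conj S1_ex D1_imp_S1 definable Q_zero_carrier qnat_carrier)+

lemma bounded_nilpotents_ideal: "ideal (bounded_nilpotents n) R"
proof -
  interpret Q: cring Q by (rule cring_Q)
  show ?thesis
  proof (rule R.ideal_criterion)
    show "bounded_nilpotents n \<subseteq> carrier R" unfolding bounded_nilpotents_def by auto
    have "qnat (\<^bold>1 \<^bold>* lcm_at n) \<otimes>\<^bsub>Q\<^esub> du \<zero>\<^bsub>R\<^esub> = qint \<^bold>0 \<^bold>0"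
      by (simp add: R_zero qnat_zero[symmetric] qnat_qint[symmetric] qnat_mult[symmetric])
    then show "\<zero>\<^bsub>R\<^esub> \<in> bounded_nilpotents n"
      unfolding bounded_nilpotents_def using R_zero unit_at_one by blast
  next
    fix x y assume "x \<in> bounded_nilpotents n" "y \<in> bounded_nilpotents n"
    then obtain m w c d m' w' c' d' where x: "x \<in> RC" "re x = \<zero>\<^bsub>Q\<^esub>" "unit_at m w"
        "qnat (w \<^bold>* lcm_at n) \<otimes>\<^bsub>Q\<^esub> du x = qint c d"
      and y: "y \<in> RC" "re y = \<zero>\<^bsub>Q\<^esub>" "unit_at m' w'" "qnat (w' \<^bold>* lcm_at n) \<otimes>\<^bsub>Q\<^esub> du y = qint c' d'"
      unfolding bounded_nilpotents_def by blast
    have "qnat (w \<^bold>* w' \<^bold>* lcm_at n) \<otimes>\<^bsub>Q\<^esub> (du x \<oplus>\<^bsub>Q\<^esub> du y) =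
      qnat w' \<otimes>\<^bsub>Q\<^esub> (qnat (w \<^bold>* lcm_at n) \<otimes>\<^bsub>Q\<^esub> du x) \<oplus>\<^bsub>Q\<^esub> qnat w \<otimes>\<^bsub>Q\<^esub> (qnat (w' \<^bold>* lcm_at n) \<otimes>\<^bsub>Q\<^esub> du y)"
      using x(1) y(1) by (simp add: qnat_mult Q_carrier Q.r_distr Q.m_ac)
    also have "\<dots> = qnat w' \<otimes>\<^bsub>Q\<^esub> qint c d \<oplus>\<^bsub>Q\<^esub> qnat w \<otimes>\<^bsub>Q\<^esub> qint c' d'" by (simp only: x(4) y(4))
    finally have "\<exists>c d. qnat (w \<^bold>* w' \<^bold>* lcm_at n) \<otimes>\<^bsub>Q\<^esub> du (x \<oplus>\<^bsub>R\<^esub> y) = qint c d"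
      using x(1) y(1) by (auto simp: R_add qnat_qint qint_mult qint_add)
    then show "x \<oplus>\<^bsub>R\<^esub> y \<in> bounded_nilpotents n"
      unfolding bounded_nilpotents_def using x y unit_at_mult_mono[OF x(3) y(3)] by (auto simp: R_add)
  next
    fix x r assume "x \<in> bounded_nilpotents n" and r: "r \<in> carrier R"
    then obtain m w c d where x: "x \<in> RC" "re x = \<zero>\<^bsub>Q\<^esub>" "unit_at m w"
        "qnat (w \<^bold>* lcm_at n) \<otimes>\<^bsub>Q\<^esub> du x = qint c d" unfolding bounded_nilpotents_def by blast
    have "re r \<in> DD" using RC_DD r by simp
    then obtain a b v k where v: "re r = qcls a b v" "unit_at k v" "v \<noteq> \<^bold>0" by (rule DD_E)
    have "qnat (w \<^bold>* v \<^bold>* lcm_at n) \<otimes>\<^bsub>Q\<^esub> (re r \<otimes>\<^bsub>Q\<^esub> du x) =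
      (qnat v \<otimes>\<^bsub>Q\<^esub> re r) \<otimes>\<^bsub>Q\<^esub> (qnat (w \<^bold>* lcm_at n) \<otimes>\<^bsub>Q\<^esub> du x)"
      using x(1) r by (simp add: qnat_mult Q_carrier Q.m_ac)
    also have "\<dots> = qint a b \<otimes>\<^bsub>Q\<^esub> qint c d" using v by (simp add: x(4) clear_denominator)
    finally have "\<exists>c d. qnat (w \<^bold>* v \<^bold>* lcm_at n) \<otimes>\<^bsub>Q\<^esub> du (x \<otimes>\<^bsub>R\<^esub> r) = qint c d"
      using x(1,2) r by (auto simp: R_mult Q_carrier qint_mult)
    then show "x \<otimes>\<^bsub>R\<^esub> r \<in> bounded_nilpotents n"
      unfolding bounded_nilpotents_def using x r unit_at_mult_mono[OF x(3) v(2)] by (auto simp: R_mult Q_carrier)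
  qed
qed

lemma nilpotent_bounded: "z \<in> nilpotents \<Longrightarrow> stage z \<^bold>\<le> n \<Longrightarrow> z \<in> bounded_nilpotents n"
proof -
  interpret Q: cring Q by (rule cring_Q)
  assume z: "z \<in> nilpotents" and n: "stage z \<^bold>\<le> n"
  obtain k where k: "lcm_at n = lcm_at (stage z) \<^bold>* k" using lcm_at_mono[OF n] dvd_M_def by auto
  have zc: "z \<in> RC" using z nilpotents_def by blast
  have "qnat (den z \<^bold>* lcm_at (stage z)) \<otimes>\<^bsub>Q\<^esub> du z = qint (fst_M (snd_M (fst_M z))) (snd_M (snd_M (fst_M z)))"
    unfolding du_def by (rule clear_denominator) simp
  moreover have "qnat (den z \<^bold>* lcm_at n) \<otimes>\<^bsub>Q\<^esub> du z = qnat k \<otimes>\<^bsub>Q\<^esub> (qnat (den z \<^bold>* lcm_at (stage z)) \<otimes>\<^bsub>Q\<^esub> du z)"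
    using Q_carrier(2)[OF zc] by (simp add: k qnat_mult Q.m_ac)
  ultimately have "\<exists>c d. qnat (den z \<^bold>* lcm_at n) \<otimes>\<^bsub>Q\<^esub> du z = qint c d"
    by (auto simp: qnat_qint qint_mult)
  moreover have "unit_at (stage z) (den z)" using RC_valid[OF zc] valid_def by blast
  ultimately show ?thesis using z unfolding nilpotents_def bounded_nilpotents_def by blast
qed

text \<open>For a settled stage \<open>s\<close> from \<open>n\<close> on, take
  \<open>(1 / lcm_at (s + 1)) \<epsilon>\<close>. If it were bounded, the prime listed at
  \<open>s\<close> would divide a unit times \<open>lcm_at n\<close>; but it is never inverted and,
  being listed only once, is not listed before \<open>n\<close>.\<close>

lemma nilpotents_not_bounded: "\<not> nilpotents \<subseteq> bounded_nilpotents n"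
proof
  assume sub: "nilpotents \<subseteq> bounded_nilpotents n"
  obtain s where s: "n \<^bold>\<le> s" "settled s" using settled_exists by blast
  let ?l = "lcm_at (suc_M s)"
  have "qcls \<^bold>1 \<^bold>0 (\<^bold>1 \<^bold>* ?l) \<in> AA" using AA_I[OF unit_at_one] .
  note z = el[OF DD_zero this]
  then have "el \<zero>\<^bsub>Q\<^esub> (qcls \<^bold>1 \<^bold>0 (\<^bold>1 \<^bold>* ?l)) \<in> bounded_nilpotents n" using sub unfolding nilpotents_def by blast
  then obtain m w c d where w: "unit_at m w" "qnat (w \<^bold>* lcm_at n) \<otimes>\<^bsub>Q\<^esub> qcls \<^bold>1 \<^bold>0 (\<^bold>1 \<^bold>* ?l) = qint c d"
    unfolding bounded_nilpotents_def mem_Collect_eq z(3) by blast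
  then have "w \<^bold>* lcm_at n \<^bold>+ d \<^bold>* ?l = c \<^bold>* ?l" by (simp add: qnat_def qint_def qcls_arith)
  then have "?l \<^bold>| d \<^bold>* ?l \<^bold>+ w \<^bold>* lcm_at n" by (metis add_commute dvd_mult_right)
  then have "?l \<^bold>| w \<^bold>* lcm_at n" by (rule dvd_add_cancel) simp
  moreover have sE: "s \<in> E" using s(2) settled_def by blast
  then have "listed (suc_M s) (fst_M s)" unfolding listed_def using less_self_suc by blast
  ultimately have "fst_M s \<^bold>| w \<^bold>* lcm_at n" using listed_dvd_lcm_at dvd_trans by blast
  then consider "fst_M s \<^bold>| w" | "fst_M s \<^bold>| lcm_at n" using prime_dvd_mult E_prime[OF sE] by blast
  then show False
  proof cases
    case 1
    then show ?thesis using w(1) E_prime[OF sE] settled_not_inverted[OF s(2)] unfolding unit_at_iff by blast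
  next
    case 2
    then have "listed n (fst_M s)" using prime_dvd_lcm_at E_prime[OF sE] by blast
    then show ?thesis using E_inj[OF sE] s(1) unfolding listed_def by (metis not_le)
  qed
qed

lemma not_Delta01_Noetherian: "\<not> Delta01_Noetherian M R"
proof
  assume "Delta01_Noetherian M R"
  then obtain n g where g: "l2_finite_sequence M (carrier R) n g" "nilpotents = l2_span M R n g"
    using nilpotents_ideal unfolding Delta01_Noetherian_def l2_finitely_generated_def by blast
  then have gc: "g i \<in> carrier R" if "i \<^bold>< n" for i using that unfolding l2_finite_sequence_def by blast
  have gn: "g i \<in> nilpotents" if "i \<^bold>< n" for i unfolding g(2) by (rule R.span_generator[OF gc that])
  have F: "F1 (\<lambda>e. if e 0 \<^bold>< n then g (e 0) else \<^bold>0)" by (rule finite_sequence_F1[OF g(1)])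
  have "S1 (\<lambda>e. stage (if e 0 \<^bold>< n then g (e 0) else \<^bold>0) = e (Suc 0))"
    by (rule D1_imp_S1 D1_eq F1_stage F F1_var)+
  \<comment> \<open>The number of generators may be nonstandard, so a common bound on their stages
    comes from Sigma01 bounding.\<close>
  from bounding[OF this, of n] obtain m where m: "\<And>i. i \<^bold>< n \<Longrightarrow> stage (g i) \<^bold>< m" by auto
  have "l2_span M R n g \<subseteq> bounded_nilpotents m"
    by (intro R.span_minimal bounded_nilpotents_ideal S1_bounded_nilpotents nilpotent_bounded gn less_imp_le m)
  then show False using nilpotents_not_bounded g(2) by blast
qed

section \<open>The ring is sequentially Noetherian\<close>

text \<open>Up to units, \<open>DD\<close> consists of natural numbers, which makes division with
  remainder and least elements available in it; the two cases are the signs.\<close>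

lemma DD_associate_nat:
  assumes "x \<in> DD"
  shows "\<exists>r\<in>DD. \<exists>r'\<in>DD. \<exists>c. r \<otimes>\<^bsub>Q\<^esub> r' = \<one>\<^bsub>Q\<^esub> \<and> x \<otimes>\<^bsub>Q\<^esub> r = qnat c"
proof -
  obtain a b w m where x: "x = qcls a b w" "unit_at m w" "w \<noteq> \<^bold>0" using assms by (rule DD_E)
  consider c where "a = b \<^bold>+ c" | c where "b = a \<^bold>+ c" using linear le_iff_add by metis
  then show ?thesis
  proof cases
    case (1 c)
    show ?thesis
      by (rule bexI[of _ "qcls w \<^bold>0 \<^bold>1"], rule bexI[of _ "qcls \<^bold>1 \<^bold>0 w"], rule exI[of _ c])
        (use x 1 in \<open>auto simp: qcls_arith qnat_def semiring_ac intro: DD_I unit_at_one\<close>)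
  next
    case (2 c)
    show ?thesis
      by (rule bexI[of _ "qcls \<^bold>0 w \<^bold>1"], rule bexI[of _ "qcls \<^bold>0 \<^bold>1 w"], rule exI[of _ c])
        (use x 2 in \<open>auto simp: qcls_arith qnat_def semiring_ac intro: DD_I unit_at_one\<close>)
  qed
qed

text \<open>Here \<open>r\<close> clears the whole denominator and the sign, and need not be a unit
  of \<open>DD\<close>.\<close>

lemma Q_multiple_nat:
  assumes "y \<in> carrier Q" shows "\<exists>r\<in>DD. \<exists>c. y \<otimes>\<^bsub>Q\<^esub> r = qnat c \<and> (c = \<^bold>0 \<longrightarrow> y = \<zero>\<^bsub>Q\<^esub>)"
proof -
  obtain a b n where y: "y = qcls a b n" "n \<noteq> \<^bold>0" using assms by (rule Q_cases)
  consider c where "a = b \<^bold>+ c" | c where "b = a \<^bold>+ c" using linear le_iff_add by metis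
  then show ?thesis
  proof cases
    case (1 c)
    show ?thesis
      by (rule bexI[of _ "qcls n \<^bold>0 \<^bold>1"], rule exI[of _ c])
        (use y 1 in \<open>auto simp: qcls_arith qnat_def semiring_ac intro: DD_I unit_at_one\<close>)
  next
    case (2 c)
    show ?thesis
      by (rule bexI[of _ "qcls \<^bold>0 n \<^bold>1"], rule exI[of _ c])
        (use y 2 in \<open>auto simp: qcls_arith qnat_def semiring_ac intro: DD_I unit_at_one\<close>)
  qed
qed

lemma R_minus:
  assumes "u \<in> RC" "v \<in> RC"
  shows "u \<ominus>\<^bsub>R\<^esub> v \<in> RC" "re (u \<ominus>\<^bsub>R\<^esub> v) = re u \<ominus>\<^bsub>Q\<^esub> re v" "du (u \<ominus>\<^bsub>R\<^esub> v) = du u \<ominus>\<^bsub>Q\<^esub> du v"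
proof -
  interpret Q: cring Q by (rule cring_Q)
  have inv: "\<ominus>\<^bsub>R\<^esub> v \<in> RC" using R.a_inv_closed[of v] assms by simp
  then have "re (\<ominus>\<^bsub>R\<^esub> v) \<oplus>\<^bsub>Q\<^esub> re v = \<zero>\<^bsub>Q\<^esub>" "du (\<ominus>\<^bsub>R\<^esub> v) \<oplus>\<^bsub>Q\<^esub> du v = \<zero>\<^bsub>Q\<^esub>"
    using R.l_neg[of v] assms by (metis R_add(2) R_zero(2) R_carrier, metis R_add(3) R_zero(3) R_carrier)
  then have "re (\<ominus>\<^bsub>R\<^esub> v) = \<ominus>\<^bsub>Q\<^esub> re v" "du (\<ominus>\<^bsub>R\<^esub> v) = \<ominus>\<^bsub>Q\<^esub> du v"
    using inv assms by (simp_all add: Q.minus_equality Q_carrier)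
  then show "u \<ominus>\<^bsub>R\<^esub> v \<in> RC" "re (u \<ominus>\<^bsub>R\<^esub> v) = re u \<ominus>\<^bsub>Q\<^esub> re v" "du (u \<ominus>\<^bsub>R\<^esub> v) = du u \<ominus>\<^bsub>Q\<^esub> du v"
    using inv assms by (simp_all add: a_minus_def R_add)
qed

definition emb where "emb x = el x \<zero>\<^bsub>Q\<^esub>"

lemma emb: "x \<in> DD \<Longrightarrow> emb x \<in> RC" "x \<in> DD \<Longrightarrow> re (emb x) = x" "x \<in> DD \<Longrightarrow> du (emb x) = \<zero>\<^bsub>Q\<^esub>"
  unfolding emb_def by (simp_all add: el AA_zero)

lemma mult_emb:
  assumes "u \<in> RC" "x \<in> DD"
  shows "u \<otimes>\<^bsub>R\<^esub> emb x \<in> RC" "re (u \<otimes>\<^bsub>R\<^esub> emb x) = re u \<otimes>\<^bsub>Q\<^esub> x" "du (u \<otimes>\<^bsub>R\<^esub> emb x) = du u \<otimes>\<^bsub>Q\<^esub> x"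
proof -
  interpret Q: cring Q by (rule cring_Q)
  show "u \<otimes>\<^bsub>R\<^esub> emb x \<in> RC" "re (u \<otimes>\<^bsub>R\<^esub> emb x) = re u \<otimes>\<^bsub>Q\<^esub> x" "du (u \<otimes>\<^bsub>R\<^esub> emb x) = du u \<otimes>\<^bsub>Q\<^esub> x"
    using assms by (simp_all add: R_mult emb Q_carrier DD_carrier Q.m_comm)
qed

lemma emb_inverse:
  assumes "u \<in> RC" "r \<in> DD" "r' \<in> DD" "r \<otimes>\<^bsub>Q\<^esub> r' = \<one>\<^bsub>Q\<^esub>" shows "u \<otimes>\<^bsub>R\<^esub> emb r \<otimes>\<^bsub>R\<^esub> emb r' = u"
proof -
  interpret Q: cring Q by (rule cring_Q)
  show ?thesis
    by (rule RC_eqI) (use assms in \<open>simp_all add: mult_emb Q_carrier DD_carrier Q.m_assoc\<close>)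
qed

lemma qnat_remainder: "qnat (m \<^bold>+ n) \<ominus>\<^bsub>Q\<^esub> qnat m = qnat n"
proof -
  interpret Q: cring Q by (rule cring_Q)
  have "qnat m \<oplus>\<^bsub>Q\<^esub> qnat n \<ominus>\<^bsub>Q\<^esub> qnat m = qnat n \<oplus>\<^bsub>Q\<^esub> (qnat m \<ominus>\<^bsub>Q\<^esub> qnat m)"
    by (simp add: Q.minus_eq Q.a_assoc Q.a_comm[of "qnat m" "qnat n"] del: Q.r_neg)
  also have "\<dots> = qnat n" by (simp add: Q.minus_eq Q.r_neg)
  finally have "qnat m \<oplus>\<^bsub>Q\<^esub> qnat n \<ominus>\<^bsub>Q\<^esub> qnat m = qnat n" .
  then show ?thesis by (simp add: qnat_add)
qed

context
  fixes a :: "'m \<Rightarrow> 'm"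
  assumes seq: "l2_sequence M (carrier R) a"
begin

abbreviation I where "I k \<equiv> l2_span M R k a"

lemma a_RC: "a i \<in> RC"
  using seq unfolding sequence_iff by auto

lemma F1_a: "F1 t \<Longrightarrow> F1 (\<lambda>e. a (t e))"
  using seq F1_subst1 unfolding sequence_iff by blast

lemma I_ideal: "ideal (I k) R"
  by (rule R.span_ideal) (simp add: a_RC)

lemma I_RC: "z \<in> I k \<Longrightarrow> z \<in> RC"
  using ideal.Icarr[OF I_ideal] by simp

lemma I_mult: "z \<in> I k \<Longrightarrow> r \<in> RC \<Longrightarrow> z \<otimes>\<^bsub>R\<^esub> r \<in> I k"
  using ideal.I_r_closed[OF I_ideal] by simp

lemma I_add: "z \<in> I k \<Longrightarrow> z' \<in> I k \<Longrightarrow> z \<oplus>\<^bsub>R\<^esub> z' \<in> I k"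
  using additive_subgroup.a_closed[OF ideal.axioms(1)[OF I_ideal]] by simp

lemma I_zero: "\<zero>\<^bsub>R\<^esub> \<in> I k"
  using additive_subgroup.zero_closed[OF ideal.axioms(1)[OF I_ideal]] by simp

lemma I_minus: "z \<in> I k \<Longrightarrow> z' \<in> I k \<Longrightarrow> z \<ominus>\<^bsub>R\<^esub> z' \<in> I k"
  unfolding a_minus_def using I_add additive_subgroup.a_inv_closed[OF ideal.axioms(1)[OF I_ideal]] by simp

lemma I_mono: "z \<in> I k \<Longrightarrow> k \<^bold>\<le> l \<Longrightarrow> z \<in> I l"
  using R.span_mono[OF seq] by blast

lemma I_generator: "j \<^bold>< k \<Longrightarrow> a j \<in> I k"
  by (rule R.span_generator) (simp_all add: a_RC)

lemma S1_I: "F1 x \<Longrightarrow> F1 n \<Longrightarrow> S1 (\<lambda>e. x e \<in> I (n e))"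
  by (rule R.S1_span[OF seq])

text \<open>\<open>DD\<close> behaves like a principal ideal domain: the least positive integer
  \<open>c\<close> among the \<open>DD\<close>-parts of elements of all \<open>I i\<close> divides
  every \<open>re (a j)\<close>. It occurs in some \<open>I i\<close>, and this \<open>I i\<close>
  already realises all of them.\<close>

lemma re_stabilizes: "\<exists>i. \<forall>j. \<exists>z. z \<in> I i \<and> re z = re (a j)"
proof (cases "\<forall>j. re (a j) = \<zero>\<^bsub>Q\<^esub>")
  case True
  then show ?thesis using I_zero R_zero by metis
next
  case False
  interpret Q: cring Q by (rule cring_Q)
  let ?N = "\<lambda>c. c \<noteq> \<^bold>0 \<and> (\<exists>i z. z \<in> I i \<and> re z = qnat c)"
  have "S1 (\<lambda>e. ?N (e 0))"
    by (rule S1_conj S1_ex S1_I D1_imp_S1[OF D1_Q_eq] D1_imp_S1[OF D1_not[OF D1_eq]] definable)+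
  moreover obtain j where j: "re (a j) \<noteq> \<zero>\<^bsub>Q\<^esub>" using False by blast
  obtain r r' c where r: "r \<in> DD" "r' \<in> DD" "r \<otimes>\<^bsub>Q\<^esub> r' = \<one>\<^bsub>Q\<^esub>" "re (a j) \<otimes>\<^bsub>Q\<^esub> r = qnat c"
    using DD_associate_nat[OF RC_DD[OF a_RC]] by blast
  have "?N c"
  proof
    show "c \<noteq> \<^bold>0"
    proof
      assume "c = \<^bold>0"
      then have "re (a j) \<otimes>\<^bsub>Q\<^esub> r \<otimes>\<^bsub>Q\<^esub> r' = \<zero>\<^bsub>Q\<^esub>" using r by (simp add: qnat_zero DD_carrier)
      moreover have "re (a j) \<otimes>\<^bsub>Q\<^esub> r \<otimes>\<^bsub>Q\<^esub> r' = re (a j)"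
        using Q.m_assoc[of "re (a j)" r r'] r(1,2,3) by (simp add: DD_carrier Q_carrier a_RC)
      ultimately have "re (a j) = \<zero>\<^bsub>Q\<^esub>" by simp
      with j show False by blast
    qed
    show "\<exists>i z. z \<in> I i \<and> re z = qnat c"
      using I_mult[OF I_generator[OF less_self_suc] emb(1)[OF r(1)]] mult_emb(2)[OF a_RC r(1)] r(4) by metis
  qed
  ultimately obtain c where c: "?N c" "\<And>y. y \<^bold>< c \<Longrightarrow> \<not> ?N y" using S1_least[of ?N] by blast
  then obtain i z where z: "z \<in> I i" "re z = qnat c" by blast
  have "\<exists>y. y \<in> I i \<and> re y = re (a j)" for j
  proof -
    obtain r r' u where r: "r \<in> DD" "r' \<in> DD" "r \<otimes>\<^bsub>Q\<^esub> r' = \<one>\<^bsub>Q\<^esub>" "re (a j) \<otimes>\<^bsub>Q\<^esub> r = qnat u"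
      using DD_associate_nat[OF RC_DD[OF a_RC]] by blast
    obtain q t where q: "t \<^bold>< c" "u = c \<^bold>* q \<^bold>+ t" using division c(1) by blast
    \<comment> \<open>Division with remainder carried out in the ideal: the \<open>DD\<close>-part
      of \<open>?y\<close> is the remainder \<open>t\<close>, which the minimality of
      \<open>c\<close> forces to be zero.\<close>
    let ?y = "a j \<otimes>\<^bsub>R\<^esub> emb r \<ominus>\<^bsub>R\<^esub> z \<otimes>\<^bsub>R\<^esub> emb (qnat q)"
    have "?y \<in> I (i \<^bold>+ suc_M j)"
      by (intro I_minus I_mult emb r DD_qnat I_generator I_mono[OF z(1)]) (simp_all add: add_suc less_suc_le less_imp_le)
    moreover have "re ?y = qnat u \<ominus>\<^bsub>Q\<^esub> qnat (c \<^bold>* q)"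
      by (simp add: R_minus mult_emb a_RC r DD_qnat I_RC[OF z(1)] z(2) qnat_mult)
    then have "re ?y = qnat t" by (simp add: q(2) qnat_remainder)
    ultimately have "t = \<^bold>0" using c(2)[OF q(1)] by blast
    then have u: "qnat u = qnat c \<otimes>\<^bsub>Q\<^esub> qnat q" by (simp add: q(2) qnat_mult)
    have "re (z \<otimes>\<^bsub>R\<^esub> emb (qnat q) \<otimes>\<^bsub>R\<^esub> emb r') = re (a j) \<otimes>\<^bsub>Q\<^esub> r \<otimes>\<^bsub>Q\<^esub> r'"
      by (simp add: mult_emb I_RC[OF z(1)] r DD_qnat z(2) u)
    also have "\<dots> = re (a j)"
      using Q.m_assoc[of "re (a j)" r r'] r(1,2,3) by (simp add: DD_carrier Q_carrier a_RC)
    finally show ?thesis using I_mult emb(1) z(1) r(2) DD_qnat by blast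
  qed
  then show ?thesis by blast
qed

text \<open>\<open>tail i j y\<close> says that \<open>y\<close> is \<open>a j\<close> with its \<open>DD\<close>-part cancelled by an element of \<open>I i\<close>.\<close>

definition tail where
  "tail i j y \<longleftrightarrow> y \<in> RC \<and> re y = \<zero>\<^bsub>Q\<^esub> \<and> (\<exists>z. z \<in> I i \<and> a j = R.add_R y z)"

lemma S1_tail: "F1 j \<Longrightarrow> F1 y \<Longrightarrow> S1 (\<lambda>e. tail i (j e) (y e))"
  unfolding tail_def
  by (erule (1) S1_subst2) (rule S1_conj S1_ex S1_I F1_a D1_imp_S1[OF D1_eq] D1_imp_S1[OF D1_RC] D1_imp_S1[OF D1_Q_eq]
      R.F1_add_R definable Q_zero_carrier qnat_carrier)+

lemma tail_exists: "z \<in> I i \<Longrightarrow> re z = re (a j) \<Longrightarrow> \<exists>y. tail i j y"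
proof -
  interpret Q: cring Q by (rule cring_Q)
  assume z: "z \<in> I i" "re z = re (a j)"
  have zc: "z \<in> RC" using z(1) by (rule I_RC)
  have "a j = (a j \<ominus>\<^bsub>R\<^esub> z) \<oplus>\<^bsub>R\<^esub> z" using a_RC[of j] zc
    unfolding R_carrier[symmetric] by (simp add: R.minus_eq R.a_assoc R.l_neg del: R_carrier)
  moreover have "a j \<ominus>\<^bsub>R\<^esub> z \<in> RC" "re (a j \<ominus>\<^bsub>R\<^esub> z) = \<zero>\<^bsub>Q\<^esub>"
    using zc a_RC[of j] z(2) by (simp_all add: R_minus Q.minus_eq Q.r_neg Q_carrier)
  ultimately show ?thesis unfolding tail_def using z(1) zc by (metis R.add_R R_carrier)
qed

lemma tail_in: assumes "tail i j y" "i \<^bold>\<le> suc_M j" shows "y \<in> I (suc_M j)"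
proof -
  obtain z where z: "y \<in> RC" "z \<in> I i" "a j = y \<oplus>\<^bsub>R\<^esub> z" using assms(1) I_RC unfolding tail_def by auto
  then have "y = a j \<ominus>\<^bsub>R\<^esub> z" using I_RC[OF z(2)]
    unfolding R_carrier[symmetric] by (simp add: R.minus_eq R.a_assoc R.r_neg del: R_carrier)
  then show ?thesis using I_minus[OF I_generator I_mono[OF z(2) assms(2)]] by simp
qed

lemma tail_not_in: assumes "tail i j y" "i \<^bold>\<le> j" "a j \<notin> I j" shows "y \<notin> I j"
proof
  assume "y \<in> I j"
  obtain z where z: "y \<in> RC" "z \<in> I i" "a j = y \<oplus>\<^bsub>R\<^esub> z" using assms(1) I_RC unfolding tail_def by auto
  then show False using I_add[OF \<open>y \<in> I j\<close> I_mono[OF z(2) assms(2)]] assms(3) by simp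
qed

text \<open>A certificate that can be found by search: \<open>m\<close> exceeds the stages of tails
  for \<open>c * L\<close> consecutive terms, the number of terms after which \<open>descent\<close>
  breaks down when \<open>L\<close> clears their denominators up to units.\<close>

definition good where
  "good i c b m \<longleftrightarrow> (\<exists>L. (L \<noteq> \<^bold>0 \<and> (\<forall>k. k \<^bold>< b \<longrightarrow> k \<noteq> \<^bold>0 \<longrightarrow> k \<^bold>| L)) \<and>
     (\<forall>j. j \<^bold>< c \<^bold>* L \<longrightarrow> (\<exists>y. tail i (suc_M i \<^bold>+ j) y \<and> stage y \<^bold>< m)))"

lemma S1_good: "F1 b \<Longrightarrow> F1 m \<Longrightarrow> S1 (\<lambda>e. good i c (b e) (m e))"
  unfolding good_def
proof (erule (1) S1_subst2)
  show "S1 (\<lambda>e. \<exists>L. (L \<noteq> \<^bold>0 \<and> (\<forall>k. k \<^bold>< e 0 \<longrightarrow> k \<noteq> \<^bold>0 \<longrightarrow> k \<^bold>| L)) \<and>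
     (\<forall>j. j \<^bold>< c \<^bold>* L \<longrightarrow> (\<exists>y. tail i (suc_M i \<^bold>+ j) y \<and> stage y \<^bold>< e (Suc 0))))"
    apply (rule S1_ex, rule S1_conj)
     apply (rule D1_imp_S1, (rule definable)+)
    apply (rule S1_ball, (rule definable)+)
    apply (rule S1_ex, rule S1_conj, rule S1_tail, (rule definable)+)
    apply (rule D1_imp_S1, (rule definable)+)
    done
qed

lemma good_exists:
  assumes "\<And>j. \<exists>y. tail i j y" shows "\<exists>m. good i c b m"
proof -
  obtain L where L: "L \<noteq> \<^bold>0" "\<And>k. k \<^bold>\<le> b \<Longrightarrow> k \<noteq> \<^bold>0 \<Longrightarrow> k \<^bold>| L" using common_multiple by blast
  have "S1 (\<lambda>e. \<exists>y. tail i (suc_M i \<^bold>+ e 0) y \<and> stage y = e (Suc 0))"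
    by (rule S1_ex S1_conj S1_tail D1_imp_S1[OF D1_eq] definable)+
  from bounding[OF this, of "c \<^bold>* L"] assms
  obtain m where "\<And>j. j \<^bold>< c \<^bold>* L \<Longrightarrow> \<exists>y. tail i (suc_M i \<^bold>+ j) y \<and> stage y \<^bold>< m" by metis
  then show ?thesis unfolding good_def using L less_imp_le by blast
qed

text \<open>The least positive \<open>d\<close> with \<open>(d / L) \<epsilon>\<close> in \<open>I (i + 1 + j)\<close> is at most \<open>c L\<close> and drops with every \<open>j\<close>.\<close>

lemma descent:
  assumes bad: "\<And>j. a j \<notin> I j" and c: "x0 \<in> I (suc_M i)" "re x0 = \<zero>\<^bsub>Q\<^esub>" "du x0 = qnat c" "c \<noteq> \<^bold>0"
    and L: "L \<noteq> \<^bold>0" and y: "\<And>j. j \<^bold>< c \<^bold>* L \<Longrightarrow> \<exists>y. tail i (suc_M i \<^bold>+ j) y \<and> qnat L \<otimes>\<^bsub>Q\<^esub> du y \<in> DD"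
  shows False
proof -
  interpret Q: cring Q by (rule cring_Q)
  \<comment> \<open>The descent has to run as a Sigma01 induction: after \<open>k\<close> terms some
    positive \<open>d\<close> with \<open>(d / L) \<epsilon>\<close> in the ideal satisfies
    \<open>d + k \<le> c * L\<close>, and at \<open>k = c * L\<close> no positive \<open>d\<close>
    is left.\<close>
  have "S1 (\<lambda>e. e 0 \<^bold>\<le> c \<^bold>* L \<longrightarrow> (\<exists>d x. (d \<noteq> \<^bold>0 \<and> d \<^bold>+ e 0 \<^bold>\<le> c \<^bold>* L \<and> re x = \<zero>\<^bsub>Q\<^esub> \<and>
      qnat L \<otimes>\<^bsub>Q\<^esub> du x = qnat d) \<and> x \<in> I (suc_M i \<^bold>+ e 0)))"
    apply (rule S1_imp, (rule definable)+)
    apply (rule S1_ex, rule S1_ex, rule S1_conj)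
     apply (rule D1_imp_S1, (rule definable Q_zero_carrier qnat_carrier)+)
    apply (rule S1_I, (rule definable)+)
    done
  then have "c \<^bold>* L \<^bold>\<le> c \<^bold>* L \<longrightarrow> (\<exists>d x. (d \<noteq> \<^bold>0 \<and> d \<^bold>+ c \<^bold>* L \<^bold>\<le> c \<^bold>* L \<and> re x = \<zero>\<^bsub>Q\<^esub> \<and>
      qnat L \<otimes>\<^bsub>Q\<^esub> du x = qnat d) \<and> x \<in> I (suc_M i \<^bold>+ c \<^bold>* L))"
  proof (induction rule: S1_induct)
    case zero
    have "qnat L \<otimes>\<^bsub>Q\<^esub> du x0 = qnat (c \<^bold>* L)" by (simp add: c(3) qnat_mult Q.m_comm)
    then show ?case using c L by (intro impI exI[of _ "c \<^bold>* L"] exI[of _ x0]) simp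
  next
    case (suc k)
    show ?case
    proof
      assume "suc_M k \<^bold>\<le> c \<^bold>* L"
      then have k: "k \<^bold>< c \<^bold>* L" by (simp add: suc_le_iff)
      let ?j = "suc_M i \<^bold>+ k"
      let ?N = "\<lambda>d. \<exists>x. x \<in> I ?j \<and> d \<noteq> \<^bold>0 \<and> re x = \<zero>\<^bsub>Q\<^esub> \<and> qnat L \<otimes>\<^bsub>Q\<^esub> du x = qnat d"
      have "S1 (\<lambda>e. ?N (e 0))"
        apply (rule S1_ex, rule S1_conj, rule S1_I, (rule definable)+)
        apply (rule D1_imp_S1, (rule definable Q_zero_carrier qnat_carrier)+)
        done
      moreover obtain d' where d': "?N d'" "d' \<^bold>+ k \<^bold>\<le> c \<^bold>* L" using suc k less_imp_le by blast
      ultimately obtain d where d: "?N d" "\<And>u. u \<^bold>< d \<Longrightarrow> \<not> ?N u" using S1_least[of ?N d'] by blast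
      then have "d \<^bold>\<le> d'" using d'(1) not_le by blast
      then have dk: "d \<^bold>+ k \<^bold>\<le> c \<^bold>* L" using d'(2) by (meson add_le_cancel_right order_trans)
      obtain x where x: "x \<in> I ?j" "d \<noteq> \<^bold>0" "re x = \<zero>\<^bsub>Q\<^esub>" "qnat L \<otimes>\<^bsub>Q\<^esub> du x = qnat d" using d(1) by blast
      obtain y where y: "tail i ?j y" "qnat L \<otimes>\<^bsub>Q\<^esub> du y \<in> DD" using y[OF k] by blast
      have yc: "y \<in> RC" "re y = \<zero>\<^bsub>Q\<^esub>" using y(1) tail_def by auto
      have ij: "i \<^bold>\<le> ?j" by (simp add: suc_add[of i k] le_M_def[of i] less_suc_le)
      have yI: "y \<in> I (suc_M ?j)" using tail_in[OF y(1)] ij by (simp add: le_M_def[of _ "suc_M _"] less_suc_le)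
      have xc: "x \<in> RC" using x(1) by (rule I_RC)
      obtain r r' u where r: "r \<in> DD" "r' \<in> DD" "r \<otimes>\<^bsub>Q\<^esub> r' = \<one>\<^bsub>Q\<^esub>" "qnat L \<otimes>\<^bsub>Q\<^esub> du y \<otimes>\<^bsub>Q\<^esub> r = qnat u"
        using DD_associate_nat[OF y(2)] by blast
      obtain q t where q: "t \<^bold>< d" "u = d \<^bold>* q \<^bold>+ t" using division x(2) by blast
      \<comment> \<open>Its \<epsilon>-part times \<open>L\<close> is the remainder \<open>t\<close>
        of \<open>u\<close> by \<open>d\<close>, so it provides a smaller positive integer once
        \<open>t\<close> is known not to vanish.\<close>
      let ?x = "y \<otimes>\<^bsub>R\<^esub> emb r \<ominus>\<^bsub>R\<^esub> x \<otimes>\<^bsub>R\<^esub> emb (qnat q)"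
      note simps = R_minus mult_emb yc xc r(1) DD_qnat x(3) DD_carrier Q_carrier
      have xI: "?x \<in> I (suc_M ?j)"
        by (intro I_minus I_mult emb r DD_qnat yI I_mono[OF x(1)]) (simp add: le_M_def)
      have "qnat L \<otimes>\<^bsub>Q\<^esub> du ?x = qnat L \<otimes>\<^bsub>Q\<^esub> du y \<otimes>\<^bsub>Q\<^esub> r \<ominus>\<^bsub>Q\<^esub> qnat L \<otimes>\<^bsub>Q\<^esub> du x \<otimes>\<^bsub>Q\<^esub> qnat q"
        by (simp add: simps Q.minus_eq Q.r_distr Q.r_minus Q.m_assoc)
      also have "\<dots> = qnat u \<ominus>\<^bsub>Q\<^esub> qnat (d \<^bold>* q)" by (simp add: r(4) x(4) qnat_mult)
      also have "\<dots> = qnat t" by (simp add: q(2) qnat_remainder)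
      finally have t: "qnat L \<otimes>\<^bsub>Q\<^esub> du ?x = qnat t" .
      have re: "re ?x = \<zero>\<^bsub>Q\<^esub>" by (simp add: simps Q.minus_eq)
      \<comment> \<open>With remainder zero the tail \<open>y\<close> would be a multiple of
        \<open>x\<close>, hence in the ideal spanned so far, although \<open>a\<close> brings
        something new at this index.\<close>
      have "t \<noteq> \<^bold>0"
      proof
        assume "t = \<^bold>0"
        then have "du ?x = \<zero>\<^bsub>Q\<^esub>" using t qnat_mult_zero[OF _ L] Q_carrier(2)[OF I_RC[OF xI]] by (simp add: qnat_zero)
        then have "?x = \<zero>\<^bsub>R\<^esub>" using re R_zero I_RC[OF xI] by (intro RC_eqI) simp_all
        moreover have "y \<otimes>\<^bsub>R\<^esub> emb r \<in> carrier R" "x \<otimes>\<^bsub>R\<^esub> emb (qnat q) \<in> carrier R"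
          by (simp_all add: mult_emb yc xc r DD_qnat)
        ultimately have "y \<otimes>\<^bsub>R\<^esub> emb r = x \<otimes>\<^bsub>R\<^esub> emb (qnat q)" 
          using R.sum_zero_eq_neg[of "y \<otimes>\<^bsub>R\<^esub> emb r" "\<ominus>\<^bsub>R\<^esub> (x \<otimes>\<^bsub>R\<^esub> emb (qnat q))"]
          by (simp add: R.minus_eq del: R_carrier)
        then have "y = x \<otimes>\<^bsub>R\<^esub> emb (qnat q) \<otimes>\<^bsub>R\<^esub> emb r'" using emb_inverse[OF yc(1) r(1,2,3)] by simp
        then have "y \<in> I ?j" using I_mult[OF I_mult[OF x(1)]] emb(1) DD_qnat r(2) by simp
        then show False using tail_not_in[OF y(1) ij bad] by blast
      qed
      moreover have "t \<^bold>+ suc_M k \<^bold>\<le> c \<^bold>* L"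
      proof -
        have "t \<^bold>+ suc_M k = suc_M t \<^bold>+ k" by (simp add: add_suc suc_add)
        also have "\<dots> \<^bold>\<le> d \<^bold>+ k" using q(1) by (simp add: suc_le_iff)
        finally show ?thesis using dk by (rule order_trans)
      qed
      moreover have "?x \<in> I (suc_M i \<^bold>+ suc_M k)" using xI by (simp add: add_suc)
      ultimately show "\<exists>d x. (d \<noteq> \<^bold>0 \<and> d \<^bold>+ suc_M k \<^bold>\<le> c \<^bold>* L \<and> re x = \<zero>\<^bsub>Q\<^esub> \<and>
        qnat L \<otimes>\<^bsub>Q\<^esub> du x = qnat d) \<and> x \<in> I (suc_M i \<^bold>+ suc_M k)" using re t by blast
    qed
  qed
  then obtain d where "d \<noteq> \<^bold>0" "d \<^bold>+ c \<^bold>* L \<^bold>\<le> c \<^bold>* L" by auto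
  then show False using add_le_cancel_right[of d "c \<^bold>* L" "\<^bold>0"] by simp
qed

text \<open>If every prime from \<open>b\<close> on that is listed before \<open>m\<close> came from
  an unsettled stage, all of them would be inverted by some stage \<open>n\<close>. Then
  \<open>L\<close> would clear the denominators of all tails in question up to units, and
  \<open>descent\<close> would apply.\<close>

lemma good_settled:
  assumes bad: "\<And>j. a j \<notin> I j" and c: "x0 \<in> I (suc_M i)" "re x0 = \<zero>\<^bsub>Q\<^esub>" "du x0 = qnat c" "c \<noteq> \<^bold>0"
    and good: "good i c b m"
  shows "\<exists>s. s \<^bold>< m \<and> settled s \<and> b \<^bold>\<le> fst_M s"
proof (rule ccontr)
  assume no: "\<not> ?thesis"
  \<comment> \<open>\<open>t\<close> is the later stage with a smaller prime that shows
    \<open>s\<close> to be unsettled; bounding finds such stages below one \<open>m1\<close> for all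
    \<open>s\<close> below \<open>m\<close>.\<close>
  let ?P = "\<lambda>s t. s \<in> E \<and> b \<^bold>\<le> fst_M s \<longrightarrow> s \<^bold>< t \<and> t \<in> E \<and> fst_M t \<^bold>< fst_M s"
  have "\<exists>t. ?P s t" if s: "s \<^bold>< m" for s
  proof (cases "s \<in> E \<and> b \<^bold>\<le> fst_M s")
    case True
    then have "\<not> settled s" using no s by blast
    then obtain t where t: "t \<in> E" "s \<^bold>< t" "\<not> fst_M s \<^bold>< fst_M t" using True unfolding settled_def by blast
    moreover have "fst_M t \<noteq> fst_M s" using E_inj t True by (metis less_irrefl)
    ultimately have "fst_M t \<^bold>< fst_M s" by simp
    then show ?thesis using t by blast
  qed blast
  moreover have "S1 (\<lambda>e. ?P (e 0) (e (Suc 0)))" by (rule D1_imp_S1 definable E_set)+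
  ultimately obtain m1 where m1: "\<And>s. s \<^bold>< m \<Longrightarrow> \<exists>t. t \<^bold>< m1 \<and> ?P s t" using bounding[of ?P m] by blast
  define n where "n = m \<^bold>+ m1"
  have n: "x \<^bold>< m \<Longrightarrow> x \<^bold>< n" "x \<^bold>< m1 \<Longrightarrow> x \<^bold>< n" for x
    unfolding n_def using less_le_trans le_add1 le_add2 by blast+
  have listed: "p \<^bold>< b \<or> inverted n p" if "listed m p" for p
  proof -
    obtain s where s: "s \<^bold>< m" "s \<in> E" "fst_M s = p" using \<open>listed m p\<close> unfolding listed_def by blast
    show ?thesis
    proof (cases "b \<^bold>\<le> p")
      case True
      then obtain t where "t \<^bold>< m1" "s \<^bold>< t" "t \<in> E" "fst_M t \<^bold>< p" using m1[OF s(1)] s by blast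
      then show ?thesis unfolding inverted_def using s n by blast
    next
      case False
      then show ?thesis using not_le by blast
    qed
  qed
  have inv: "k \<^bold>< n" "prime_M k" if "inverted n k" for k
    using that listed_less listed_prime unfolding inverted_def listed_def by blast+
  have "S1 (\<lambda>e. inverted n (e 0))" by (rule D1_imp_S1 definable)+
  from least_common_multiple[OF this, of n] inv prime_not_zero obtain W where
    W: "W \<noteq> \<^bold>0" "\<And>k. inverted n k \<Longrightarrow> k \<^bold>| W" "\<And>x. (\<And>k. inverted n k \<Longrightarrow> k \<^bold>| x) \<Longrightarrow> W \<^bold>| x" by metis
  have Wu: "unit_at n W" unfolding unit_at_iff using prime_dvd_lcm[OF W inv(2)] W(1) by blast
  obtain L where L: "L \<noteq> \<^bold>0" "\<And>k. k \<^bold>< b \<Longrightarrow> k \<noteq> \<^bold>0 \<Longrightarrow> k \<^bold>| L"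
    "\<And>j. j \<^bold>< c \<^bold>* L \<Longrightarrow> \<exists>y. tail i (suc_M i \<^bold>+ j) y \<and> stage y \<^bold>< m" using good unfolding good_def by blast
  \<comment> \<open>A prime listed before \<open>m\<close> is either below \<open>b\<close> and
    divides \<open>L\<close>, or is inverted by stage \<open>n\<close> and divides the unit
    \<open>W\<close>.\<close>
  have lcm: "lcm_at m \<^bold>| L \<^bold>* W"
    by (rule lcm_at_dvd) (use listed L(2) W(2) dvd_mult dvd_mult2 listed_prime prime_not_zero in blast)
  have "qnat L \<otimes>\<^bsub>Q\<^esub> du y \<in> DD" if y: "tail i j y" "stage y \<^bold>< m" for j y
  proof -
    obtain k where k: "L \<^bold>* W = lcm_at (stage y) \<^bold>* k"
      using dvd_trans[OF lcm_at_mono[OF less_imp_le[OF y(2)]] lcm] dvd_M_def by auto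
    let ?c = "fst_M (snd_M (fst_M y))" and ?d = "snd_M (snd_M (fst_M y))"
    have *: "v \<^bold>* L \<^bold>* (w \<^bold>* W) = v \<^bold>* k \<^bold>* (w \<^bold>* lcm_at (stage y))" for v w
    proof -
      have "v \<^bold>* L \<^bold>* (w \<^bold>* W) = v \<^bold>* w \<^bold>* (L \<^bold>* W)" by (simp add: semiring_ac)
      then show ?thesis unfolding k by (simp add: semiring_ac)
    qed
    have "qnat L \<otimes>\<^bsub>Q\<^esub> du y = qcls (L \<^bold>* ?c) (L \<^bold>* ?d) (den y \<^bold>* lcm_at (stage y))"
      unfolding du_def by (rule qnat_mult_qcls) simp
    also have "\<dots> = qcls (?c \<^bold>* k) (?d \<^bold>* k) (den y \<^bold>* W)"
      using *[of ?c "den y"] *[of ?d "den y"] W(1) by (simp add: qcls_eq_iff qeq_def mult_commute[of L])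
    also have "\<dots> \<in> DD"
    proof (rule DD_I, rule unit_at_mult_mono[OF _ Wu])
      show "unit_at (stage y) (den y)" using y(1) RC_valid unfolding tail_def valid_def by blast
    qed
    finally show ?thesis .
  qed
  then show False using descent[OF bad c L(1)] L(3) by blast
qed

lemma bad_sequence_contradiction:
  assumes bad: "\<And>j. a j \<notin> I j" shows False
proof -
  interpret Q: cring Q by (rule cring_Q)
  obtain i where "\<And>j. \<exists>z. z \<in> I i \<and> re z = re (a j)" using re_stabilizes by blast
  then have tail: "\<exists>y. tail i j y" for j using tail_exists by blast
  obtain y where y: "tail i i y" using tail by blast
  have yc: "y \<in> RC" "re y = \<zero>\<^bsub>Q\<^esub>" using y tail_def by auto
  have "y \<noteq> \<zero>\<^bsub>R\<^esub>" using tail_not_in[OF y _ bad] I_zero by auto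
  then have "du y \<noteq> \<zero>\<^bsub>Q\<^esub>" using yc R_zero RC_eqI by metis
  then obtain r c where r: "r \<in> DD" "du y \<otimes>\<^bsub>Q\<^esub> r = qnat c" "c \<noteq> \<^bold>0"
    using Q_multiple_nat[OF Q_carrier(2)[OF yc(1)]] by blast
  \<comment> \<open>Scaling a nonzero tail gives \<open>c \<epsilon>\<close> in
    \<open>I (i + 1)\<close> with \<open>c\<close> positive. It starts the descent, and as
    \<open>c\<close> is fixed, the number \<open>c * L\<close> of terms needed depends on
    \<open>L\<close> alone.\<close>
  let ?x = "y \<otimes>\<^bsub>R\<^esub> emb r"
  have x: "?x \<in> I (suc_M i)" using I_mult[OF tail_in[OF y] emb(1)[OF r(1)]] by (simp add: le_M_def)
  have x': "re ?x = \<zero>\<^bsub>Q\<^esub>" "du ?x = qnat c" using yc r by (simp_all add: mult_emb DD_carrier)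
  \<comment> \<open>Being unlisted is found by search: a certificate for the bound
    \<open>n + 1\<close> forces a settled stage below \<open>m\<close> listing a prime above
    \<open>n\<close>, after which \<open>n\<close> cannot appear. As being listed is Sigma01 anyway,
    the listed set becomes Delta01.\<close>
  have listed_iff: "n \<notin> fst_M ` E \<longleftrightarrow> (\<exists>m. good i c (suc_M n) m \<and> (\<forall>s. s \<^bold>< m \<longrightarrow> s \<in> E \<longrightarrow> fst_M s \<noteq> n))" for n
  proof
    assume "n \<notin> fst_M ` E"
    then show "\<exists>m. good i c (suc_M n) m \<and> (\<forall>s. s \<^bold>< m \<longrightarrow> s \<in> E \<longrightarrow> fst_M s \<noteq> n)"
      using good_exists[OF tail] by blast
  next
    assume "\<exists>m. good i c (suc_M n) m \<and> (\<forall>s. s \<^bold>< m \<longrightarrow> s \<in> E \<longrightarrow> fst_M s \<noteq> n)"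
    then obtain m where m: "good i c (suc_M n) m" "\<And>s. s \<^bold>< m \<Longrightarrow> s \<in> E \<Longrightarrow> fst_M s \<noteq> n" by blast
    obtain s where s: "s \<^bold>< m" "settled s" "n \<^bold>< fst_M s"
      using good_settled[OF bad x x' r(3) m(1)] suc_le_iff by blast
    show "n \<notin> fst_M ` E"
    proof
      assume "n \<in> fst_M ` E"
      then obtain t where t: "t \<in> E" "fst_M t = n" by blast
      then have "m \<^bold>\<le> t" using m(2) not_le by blast
      then have "s \<^bold>< t" using s(1) by simp
      then have "fst_M s \<^bold>< n" using s(2) t unfolding settled_def by blast
      then show False using s(3) by simp
    qed
  qed
  have "S1 (\<lambda>e. \<exists>s. s \<in> E \<and> e 0 = fst_M s)" by (rule S1_ex D1_imp_S1 definable E_set)+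
  then have "S1 (\<lambda>e. e 0 \<in> fst_M ` E)" by (rule back_subst[where P = S1]) (auto simp: image_iff)
  moreover have "S1 (\<lambda>e. e 0 \<notin> fst_M ` E)" unfolding listed_iff
    apply (rule S1_ex, rule S1_conj, rule S1_good, (rule definable)+)
    apply (rule D1_imp_S1, (rule definable E_set)+)
    done
  ultimately have "D1 (\<lambda>e. e 0 \<in> fst_M ` E)" unfolding D1_def by blast
  then show False using comprehension[of "\<lambda>x. x \<in> fst_M ` E"] E_undecidable by simp
qed

end

lemma sequentially_Noetherian_R: "sequentially_Noetherian M R"
  unfolding sequentially_Noetherian_def using bad_sequence_contradiction by blast

end

context rca_structure
begin

text \<open>Sending \<open>n\<close> to the prime \<open>h n\<close> turns any missing Sigma01 set
  into a missing set of primes, because \<open>h\<close> is definable and injective.\<close>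

lemma counterexample_ring:
  assumes "\<not> Sigma01_comprehension"
  shows "\<exists>R. l2_cring M R \<and> sequentially_Noetherian M R \<and> \<not> Delta01_Noetherian M R"
proof -
  obtain P where P: "S1 (\<lambda>e. P (e 0))" "{x. P x} \<notin> l2_sets M"
    using assms unfolding Sigma01_comprehension_def by blast
  have "D1 (\<lambda>e. prime_M (e 0))" by (rule definable)+
  from comprehension[OF this] obtain h where h: "F1 (\<lambda>e. h (e 0))" "\<And>n. prime_M (h n)" "\<And>n. h n \<^bold>< h (suc_M n)"
    using increasing_enumeration[of "{p. prime_M p}"] primes_unbounded by auto
  have h_inj: "m = n" if "h m = h n" for m n
    using strict_increasing[OF h(1,3)] that less_or_eq_or_greater[of m n] by (metis less_irrefl)
  let ?Y = "\<lambda>p. \<exists>n. p = h n \<and> P n"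
  have "S1 (\<lambda>e. ?Y (e 0))"
    by (rule S1_ex S1_conj D1_imp_S1[OF D1_eq] S1_subst1[OF F1_var P(1)] F1_subst1[OF F1_var h(1)] F1_var)+
  then obtain T where T: "D0 T" "\<And>e. ?Y (e 0) \<longleftrightarrow> (\<exists>y. T (case_nat y e))" unfolding S1_def by blast
  define W where "W p y = T (case_nat y (\<lambda>_. p))" for p y
  have Y: "?Y p \<longleftrightarrow> (\<exists>y. W p y)" for p unfolding W_def using T(2)[of "\<lambda>_. p"] by simp
  have "D0 (\<lambda>e. W (e 0) (e (Suc 0)))"
    unfolding W_def by (rule D0_reindex[OF T(1), of _ "case_nat (Suc 0) (\<lambda>_. 0)"]) (auto split: nat.splits)
  then have W: "D1 (\<lambda>e. W (s e) (t e))" if "F1 s" "F1 t" for s t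
    using D1_subst2[OF that] D1_D0 by blast
  \<comment> \<open>A stage pairs a prime with its least witness: this makes the stages decidable
    and lists each prime only once.\<close>
  define E where "E = {s. s = pair_M (fst_M s) (snd_M s) \<and> W (fst_M s) (snd_M s) \<and> (\<forall>y. y \<^bold>< snd_M s \<longrightarrow> \<not> W (fst_M s) y)}"
  have E: "E \<in> l2_sets M" unfolding E_def by (rule comprehension) (rule definable W)+
  have img: "fst_M ` E = {p. ?Y p}"
  proof (intro equalityI subsetI)
    fix p assume "p \<in> {p. ?Y p}"
    then obtain y where "W p y" using Y by blast
    moreover have "D1 (\<lambda>e. W p (e 0))" by (rule W definable)+
    ultimately obtain y where "W p y" "\<forall>z. z \<^bold>< y \<longrightarrow> \<not> W p z" using D1_least[of "W p"] by blast
    then have "pair_M p y \<in> E" unfolding E_def by simp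
    then show "p \<in> fst_M ` E" by (rule rev_image_eqI) simp
  qed (use Y in \<open>auto simp: E_def\<close>)
  interpret enumeration_structure M E
  proof
    show "E \<in> l2_sets M" by fact
    show "prime_M (fst_M s)" if "s \<in> E" for s
    proof -
      have "?Y (fst_M s)" using that img by blast
      then show ?thesis using h(2) by auto
    qed
    fix s t assume st: "s \<in> E" "t \<in> E" "fst_M s = fst_M t"
    then have "snd_M s = snd_M t" unfolding E_def using less_or_eq_or_greater[of "snd_M s" "snd_M t"] by auto
    then show "s = t" using st unfolding E_def by (metis (mono_tags, lifting) mem_Collect_eq)
  next
    show "fst_M ` E \<notin> l2_sets M"
    proof
      assume A: "fst_M ` E \<in> l2_sets M"
      have "D1 (\<lambda>e. h (e 0) \<in> fst_M ` E)" by (rule D1_mem A F1_subst1[OF F1_var h(1)])+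
      then have "{n. h n \<in> fst_M ` E} \<in> l2_sets M" by (rule comprehension)
      moreover have "{n. h n \<in> fst_M ` E} = {n. P n}" unfolding img using h_inj by blast
      ultimately show False using P(2) by simp
    qed
  qed
  show ?thesis using l2_cring_R sequentially_Noetherian_R not_Delta01_Noetherian by blast
qed

end

theorem theorem5p10:
  fixes M :: "'m l2_structure"
  assumes "RCA0 M"
  shows
    "(ACA0 M \<longleftrightarrow> (\<forall>R. l2_cring M R \<and> Delta01_acc M R \<longrightarrow> Sigma01_Noetherian M R)) \<and>
     (ACA0 M \<longleftrightarrow> (\<forall>R. l2_cring M R \<and> Delta01_acc M R \<longrightarrow> Delta01_Noetherian M R)) \<and>
     (ACA0 M \<longleftrightarrow> (\<forall>R. l2_cring M R \<and> sequentially_Noetherian M R \<longrightarrow> Sigma01_Noetherian M R)) \<and>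
     (ACA0 M \<longleftrightarrow> (\<forall>R. l2_cring M R \<and> sequentially_Noetherian M R \<longrightarrow> Delta01_Noetherian M R))"
proof -
  interpret rca_structure M by unfold_locales (rule assms)
  have ring: "ring_in_structure M R" if "l2_cring M R" for R
    using that by (intro ring_in_structure.intro rca_structure_axioms ring_in_structure_axioms.intro)
      (auto simp: l2_cring_def)
  note facts = ring_in_structure.sequentially_Noetherian_imp_acc[OF ring]
    ring_in_structure.Sigma01_imp_Delta01_Noetherian[OF ring]
    ring_in_structure.ACA0_imp_Sigma01_Noetherian[OF ring] counterexample_ring
  show ?thesis unfolding ACA0_iff[symmetric] using facts ACA0_iff by meson
qed

end
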